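(* Let $\delta>0$ be sufficiently small and let $N^{1/2+\delta}\le Q\le N$. If $N$ is large enough in terms of $\delta$, then $$V(N,Q;\varpi)\gg_\delta Q^2(\log\log N)^2+QN\log\left(\frac{\log N}{\log(2N/Q)}\right).$$ This holds both for $\varpi=\omega$ and for $\varpi=\Omega$.
   Context: For an arithmetic function $f:\mathbb{N}\to\mathbb{C}$, a positive integer $N$ and a real number $1<Q\le N$, $$V(N,Q;f):=\sum_{q\le Q}\ \sum_{h\mid q}\ \sum_{\substack{a \bmod q\\ (a,q)=h}}\Bigg|\sum_{\substack{n\le N\\ n\equiv a \bmod q}}f(n)-\frac{1}{\varphi(q/h)}\sum_{\substack{n\le N\\ (n,q)=h}}f(n)\Bigg|^2,$$ where $\varphi$ is Euler's totient function and $(\cdot,\cdot)$ is the greatest common divisor. $\omega(n)$ and $\Omega(n)$ denote the number of prime divisors of $n$ counted without and with multiplicity, respectively; $\varpi$ denotes either one of them. $A\gg_\delta B$ means $A\ge \kappa B$ for some constant $\kappa=\kappa(\delta)>0$. *)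

theory Defs
  imports "HOL-Analysis.Analysis" "HOL-Number_Theory.Number_Theory"
begin

definition omega :: "nat \<Rightarrow> nat" where
  "omega n = card (prime_factors n)"

definition Omega :: "nat \<Rightarrow> nat" where
  "Omega n = size (prime_factorization n)"

text \<open>
  Arithmetic functions live on the positive integers, so \<open>n\<close> and \<open>q\<close> start at 1 (a function
  on \<^typ>\<open>nat\<close> contributes nothing through its value at 0). The residue classes modulo \<open>q\<close>
  are represented by \<open>a \<in> {1..q}\<close>. In the innermost term \<open>h\<close> divides \<open>q\<close>, so
  \<open>q div h\<close> is the exact quotient.
\<close>

definition V :: "nat \<Rightarrow> real \<Rightarrow> (nat \<Rightarrow> complex) \<Rightarrow> real" where
  "V N Q f =
    (\<Sum>q | 1 \<le> q \<and> real q \<le> Q.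
      \<Sum>h | h dvd q.
        \<Sum>a | a \<in> {1..q} \<and> gcd a q = h.
          (cmod ((\<Sum>n | n \<in> {1..N} \<and> [n = a] (mod q). f n)
                 - 1 / of_nat (totient (q div h)) * (\<Sum>n | n \<in> {1..N} \<and> gcd n q = h. f n)))\<^sup>2)"

end

theory Submission
  imports Defs "HOL-Computational_Algebra.Squarefree" "HOL-Real_Asymp.Real_Asymp"
begin

text \<open>
  Pairing the class sums with functions \<open>g(q, a)\<close> that are odd in \<open>a\<close> removes the subtracted means, so by
  Cauchy--Schwarz \<open>V\<close> is at least the square of \<open>\<Sum>\<^sub>n f(n) G(n)\<close>, \<open>G(n) = \<Sum>\<^sub>q g(q, n)\<close>, divided by
  the squared norm of \<open>g\<close>. Two test functions are used.

  For \<open>g(q, a) = sin (2 \<pi> a / q)\<close>, replacing \<open>f\<close> by its mean \<open>\<mu>\<close>, of size \<open>log log N\<close>, gives a main term of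
  size \<open>\<mu> Q\<^sup>2\<close>, because the classes \<open>a \<le> N mod q\<close> contain one integer more than the others.
  Turan--Kubilius and a large sieve bound for \<open>G\<close> make the error admissible when \<open>Q\<close> exceeds a
  multiple of \<open>N / \<mu>\<close>; this gives \<open>Q\<^sup>2 (log log N)\<^sup>2\<close>, which dominates in that range.

  For smaller \<open>Q\<close> let \<open>g(q, a)\<close> be the sum over \<open>n \<equiv> a\<close> modulo \<open>q\<close> of \<open>\<beta>(n)\<close>, the smoothly weighted excess
  of the number of prime divisors \<open>p\<close> of \<open>n\<close> with \<open>8 N / Q < p \<le> R\<close>, \<open>R = N\<close> to the power \<open>1/2 - \<delta>/2\<close>,
  made odd in \<open>n\<close>. Off-diagonal terms come from \<open>n\<close> and \<open>n + k q\<close> with \<open>0 < \<bar>k\<bar> \<le> 4 N / Q < p\<close>.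
  For fixed \<open>n\<close>, \<open>k\<close>, \<open>p\<close> the condition that \<open>p\<close> divides \<open>n + k q\<close> is a single residue class for \<open>q\<close>, and as
  \<open>Q / p\<close> exceeds a power of \<open>N\<close>, summation over \<open>q\<close> with a weight of high enough smoothness makes
  these terms negligible. The diagonal leaves \<open>Q N L\<close> for the norm and for the correlation, where \<open>L\<close> is the
  sum of \<open>1 / p\<close>. In the correlation with \<open>f\<close>, primes \<open>p'\<close> with \<open>p p' > N\<close> contribute negatively, but by
  Mertens at most 7/8 of the main term.
\<close>

section \<open>Prime sums\<close>

text \<open>The sine test stops working at \<open>Q\<close> about \<open>N / \<mu>\<close> because
  Cauchy--Schwarz bounds the square of its error by a multiple of \<open>N \<mu>\<close> (mean
  square deviation of \<open>f\<close>) times \<open>Q^3\<close> (second moment of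
  \<open>G\<close>), and this is small against the square of \<open>\<mu> Q^2\<close> once
  \<open>Q \<mu>\<close> exceeds a multiple of \<open>N\<close>. Below that point the second test
  must also pay for the first term of the claim. With \<open>l = log log N\<close> one then has
  \<open>Q l \<le> C N\<close>. Either \<open>Q l^2 < N\<close>, hence \<open>Q^2 l^2 < Q N\<close>;
  or \<open>N / Q \<le> l^2\<close>, so that \<open>log (2 N / Q)\<close> is at most of size
  \<open>log l\<close> and the double logarithm is itself at least of size \<open>l\<close>.

  The exponent of \<open>R\<close> is squeezed from two sides. It lies below that of
  \<open>Q\<close>, so that \<open>(R / Q)^A\<close> beats any fixed power of \<open>N\<close> for
  suitable \<open>A\<close>. It also lies below \<open>1/2\<close>: then \<open>p p' > N\<close>
  forces \<open>p' > sqrt N\<close>, and the reciprocals of the primes between \<open>sqrt N\<close>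
  and \<open>N\<close> sum to about \<open>ln 2\<close>, leaving part of the main term. The lower
  limit \<open>8 N / Q\<close> of the primes is what turns their reciprocal sum into the double
  logarithm of the claim.\<close>

definition primes_in :: "real \<Rightarrow> real \<Rightarrow> nat set" where
  "primes_in x y = {p. prime p \<and> x < real p \<and> real p \<le> y}"

lemma finite_primes_in [simp, intro]: "finite (primes_in x y)"
proof (rule finite_subset)
  show "primes_in x y \<subseteq> {..nat \<lfloor>y\<rfloor>}"
    by (auto simp: primes_in_def le_nat_floor)
qed simp

abbreviation prime_recip :: "real \<Rightarrow> real \<Rightarrow> real" where
  "prime_recip x y \<equiv> \<Sum>p\<in>primes_in x y. 1 / real p"

lemma primes_inD:
  assumes "p \<in> primes_in x y"
  shows "prime p" "x < real p" "real p \<le> y" "2 \<le> p" "2 \<le> real p"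
  using assms prime_ge_2_nat[of p] by (auto simp: primes_in_def)

lemma primes_in_Un: "x \<le> y \<Longrightarrow> y \<le> z \<Longrightarrow> primes_in x z = primes_in x y \<union> primes_in y z"
  by (auto simp: primes_in_def)

lemma sum_primes_in_split:
  "x \<le> y \<Longrightarrow> y \<le> z \<Longrightarrow> sum f (primes_in x z) = sum f (primes_in x y) + (sum f (primes_in y z) :: real)"
  unfolding primes_in_Un by (rule sum.union_disjoint[OF finite_primes_in finite_primes_in]) (auto simp: primes_in_def)

lemma primes_in_mono: "x' \<le> x \<Longrightarrow> y \<le> y' \<Longrightarrow> primes_in x y \<subseteq> primes_in x' y'"
  by (auto simp: primes_in_def)

lemma primes_in_floor: "primes_in x y = primes_in x (real_of_int \<lfloor>y\<rfloor>)"
proof -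
  have "real p \<le> y \<longleftrightarrow> real p \<le> real_of_int \<lfloor>y\<rfloor>" for p
    using le_floor_iff[of "int p" y] of_int_le_iff[of "int p" "\<lfloor>y\<rfloor>", where ?'a = real] by simp
  then show ?thesis by (simp add: primes_in_def)
qed

section \<open>Chebyshev's upper bound\<close>

lemma central_binomial_odd_le: "(2 * m + 1) choose m \<le> 4 ^ m"
proof -
  have "2 * ((2 * m + 1) choose m) = (\<Sum>k\<in>{m, Suc m}. (2 * m + 1) choose k)"
    using binomial_symmetric[of m "2 * m + 1"] by simp
  also have "\<dots> \<le> (\<Sum>k\<le>2 * m + 1. (2 * m + 1) choose k)"
    by (rule sum_mono2) auto
  also have "\<dots> = 2 * 4 ^ m"
    by (simp only: choose_row_sum) (simp add: power_mult)
  finally show ?thesis by simp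
qed

lemma prod_primes_dvd:
  fixes x :: nat
  assumes "finite S" "\<And>p. p \<in> S \<Longrightarrow> prime p" "\<And>p. p \<in> S \<Longrightarrow> p dvd x"
  shows "\<Prod>S dvd x"
  using assms
proof (induction S rule: finite_induct)
  case (insert q S)
  have "coprime q (\<Prod>S)"
    using insert by (intro prod_coprime_right primes_coprime) auto
  with insert show ?case by (simp add: divides_mult)
qed simp

text \<open>Erdos' argument: for \<open>n = 2 m + 1\<close> a prime in \<open>(m + 1, n]\<close>
  divides \<open>n!\<close> but neither \<open>m!\<close> nor \<open>(n - m)!\<close>, so the
  product of these primes divides \<open>n choose m\<close>, which is at most \<open>4 ^ m\<close>.
  The primes up to \<open>m + 1\<close> are covered by induction, and an even \<open>n > 2\<close>
  adds no prime.\<close>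

lemma primorial_le: "\<Prod>{p. prime p \<and> p \<le> n} \<le> (4::nat) ^ n"
proof (induction n rule: less_induct)
  case (less n)
  have fin: "finite {p. prime p \<and> p \<le> m}" for m :: nat
    by (rule finite_subset[of _ "{..m}"]) auto
  consider "n < 2" | "n = 2" | "n > 2" "even n" | "n > 2" "odd n" by (metis linorder_neqE_nat)
  then show ?case
  proof cases
    case 1
    then have "{p. prime p \<and> p \<le> n} = {}" by (auto dest!: prime_ge_2_nat)
    then show ?thesis by (simp only:) simp
  next
    case 2
    have "{p. prime p \<and> p \<le> n} = {2::nat}"
      using 2 by (auto dest: prime_ge_2_nat)
    then show ?thesis using 2 by simp
  next
    case 3
    have "\<not> prime n" using 3 by (metis prime_odd_nat)
    then have "p \<le> n \<longleftrightarrow> p \<le> n - 1" if "prime p" for p using that by (cases "p = n") auto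
    then have "{p. prime p \<and> p \<le> n} = {p. prime p \<and> p \<le> n - 1}" by blast
    then have "\<Prod>{p. prime p \<and> p \<le> n} \<le> 4 ^ (n - 1)"
      using less[of "n - 1"] 3 by simp
    also have "\<dots> \<le> 4 ^ n" by (intro power_increasing) auto
    finally show ?thesis .
  next
    case 4
    then obtain m where m: "n = 2 * m + 1" "m \<ge> 1" by (elim oddE) auto
    let ?B = "{p. prime p \<and> m + 1 < p \<and> p \<le> n}"
    have split: "{p. prime p \<and> p \<le> n} = {p. prime p \<and> p \<le> m + 1} \<union> ?B"
      using m by auto
    have fin2: "finite ?B"
      by (rule finite_subset[OF _ fin[of n]]) auto
    have "\<Prod>?B dvd (n choose m)"
    proof (rule prod_primes_dvd[OF fin2])
      fix p assume p: "p \<in> ?B"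
      then have pr: "prime p" and le: "p \<le> n" "\<not> p \<le> m" "\<not> p \<le> n - m" using m by auto
      have "fact m * fact (n - m) * (n choose m) = fact n"
        using m by (intro binomial_fact_lemma) simp
      then have "p dvd fact m * fact (n - m) * (n choose m)"
        using pr le(1) by (simp only: prime_dvd_fact_iff)
      then show "p dvd (n choose m)"
        using pr le(2,3) by (simp only: prime_dvd_mult_iff prime_dvd_fact_iff) blast
    qed auto
    then have "\<Prod>?B \<le> 4 ^ m"
      using central_binomial_odd_le[of m] m by (auto dest!: dvd_imp_le simp: zero_less_binomial_iff)
    moreover have "\<Prod>{p. prime p \<and> p \<le> m + 1} \<le> 4 ^ (m + 1)"
      using less[of "m + 1"] m by auto
    ultimately have "\<Prod>{p. prime p \<and> p \<le> n} \<le> 4 ^ (m + 1) * 4 ^ m"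
      unfolding split
      by (subst prod.union_disjoint) (use fin fin2 in \<open>auto intro!: mult_mono simp del: power_Suc\<close>)
    also have "\<dots> = 4 ^ n" using m by (simp add: power_add mult_2)
    finally show ?thesis .
  qed
qed

lemma theta_le:
  assumes "x \<ge> 0"
  shows "(\<Sum>p\<in>primes_in 0 x. ln p) \<le> 2 * x"
proof -
  define n where "n = nat \<lfloor>x\<rfloor>"
  have eq: "primes_in 0 x = {p. prime p \<and> p \<le> n}"
    using assms by (auto simp: primes_in_def n_def le_nat_floor prime_gt_0_nat le_nat_iff le_floor_iff)
  have "(\<Sum>p\<in>primes_in 0 x. ln p) = ln (real (\<Prod>(primes_in 0 x)))"
    unfolding of_nat_prod by (subst ln_prod) (auto dest: primes_inD)
  also have "\<dots> \<le> ln (real (4 ^ n))"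
  proof (subst ln_le_cancel_iff)
    show "real (\<Prod>(primes_in 0 x)) \<le> real (4 ^ n)"
      unfolding eq of_nat_le_iff by (rule primorial_le)
    have "\<Prod>(primes_in 0 x) > 0" by (rule prod_pos) (use primes_inD(4) in fastforce)
    then show "real (\<Prod>(primes_in 0 x)) > 0" by (simp only: of_nat_0_less_iff)
  qed auto
  also have "\<dots> = n * ln 4" by (simp add: ln_realpow)
  also have "ln (4::real) \<le> 2"
  proof -
    have "exp (1::real) ^ 2 \<ge> 2 ^ 2" using exp_ge_add_one_self[of 1] by (intro power_mono) auto
    then have "exp (2::real) \<ge> 4" by (simp flip: exp_of_nat_mult)
    then show ?thesis by (metis exp_gt_zero ln_exp ln_mono zero_less_numeral)
  qed
  then have "real n * ln 4 \<le> real n * 2" by (intro mult_left_mono) auto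
  also have "\<dots> \<le> 2 * x" using assms by (simp add: n_def)
  finally show ?thesis by simp
qed

section \<open>Prime power divisors and Legendre's formula\<close>

lemma card_multiples:
  assumes "s > 0"
  shows "card {m\<in>{1..n}. s dvd m} = n div (s::nat)"
proof -
  have "{m\<in>{1..n}. s dvd m} = (\<lambda>j. s * j) ` {1..n div s}"
    using assms by (auto simp: dvd_def less_eq_div_iff_mult_less_eq mult.commute intro: Suc_leI)
  moreover have "inj_on (\<lambda>j. s * j) {1..n div s}" using assms by (auto simp: inj_on_def)
  ultimately show ?thesis by (simp add: card_image)
qed

text \<open>The crude exponent range \<open>{1..n}\<close> is enough since
  \<open>k < p ^ k \<le> m \<le> n\<close>. As it depends neither on \<open>p\<close> nor on
  \<open>m\<close>, the sums over \<open>m\<close>, \<open>p\<close> and \<open>k\<close> can later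
  be interchanged freely.\<close>

lemma multiplicity_eq_card:
  assumes "prime p" "1 \<le> m" "m \<le> (n::nat)"
  shows "multiplicity p m = card {k\<in>{1..n}. p ^ k dvd m}"
proof -
  have "multiplicity p m \<le> n"
  proof -
    have "p ^ multiplicity p m \<le> m" using assms by (intro dvd_imp_le multiplicity_dvd) auto
    moreover have "multiplicity p m < p ^ multiplicity p m"
      using assms by (intro power_gt_expt) (auto dest: prime_gt_1_nat)
    ultimately show ?thesis using assms by linarith
  qed
  moreover have "p ^ k dvd m \<longleftrightarrow> k \<le> multiplicity p m" for k
    using assms(2) prime_gt_1_nat[OF assms(1)] by (intro power_dvd_iff_le_multiplicity) auto
  ultimately have "{k\<in>{1..n}. p ^ k dvd m} = {1..multiplicity p m}"
    by (simp only: set_eq_iff mem_Collect_eq atLeastAtMost_iff) (meson order.trans)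
  then show ?thesis by (simp only: card_atLeastAtMost)
qed

lemma sum_multiplicity_eq:
  fixes g :: "nat \<Rightarrow> real"
  assumes "1 \<le> m" "m \<le> n"
  shows "(\<Sum>p\<in>prime_factors m. real (multiplicity p m) * g p) =
         (\<Sum>p\<in>primes_in 0 n. \<Sum>k=1..n. if p ^ k dvd m then g p else 0)"
proof -
  have sub: "prime_factors m \<subseteq> primes_in 0 n"
    using assms by (auto simp: primes_in_def prime_factors_dvd prime_gt_0_nat dest: dvd_imp_le)
  have "(\<Sum>p\<in>prime_factors m. real (multiplicity p m) * g p) =
        (\<Sum>p\<in>primes_in 0 n. real (multiplicity p m) * g p)"
  proof (rule sum.mono_neutral_left[OF _ sub])
    show "\<forall>p\<in>primes_in 0 (real n) - prime_factors m. real (multiplicity p m) * g p = 0"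
      using assms by (auto simp: primes_in_def prime_factors_dvd intro!: not_dvd_imp_multiplicity_0)
  qed auto
  also have "\<dots> = (\<Sum>p\<in>primes_in 0 n. \<Sum>k=1..n. if p ^ k dvd m then g p else 0)"
  proof (rule sum.cong[OF refl])
    fix p assume "p \<in> primes_in 0 n"
    then have "prime p" by (auto dest: primes_inD)
    have "(\<Sum>k=1..n. if p ^ k dvd m then g p else 0) = (\<Sum>k\<in>{k\<in>{1..n}. p ^ k dvd m}. g p)"
      by (rule sum.inter_filter[symmetric]) simp
    then show "real (multiplicity p m) * g p = (\<Sum>k=1..n. if p ^ k dvd m then g p else 0)"
      using multiplicity_eq_card[OF \<open>prime p\<close> assms] by simp
  qed
  finally show ?thesis .
qed

lemma ln_eq_sum_primes:
  assumes "1 \<le> m" "m \<le> n"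
  shows "ln (real m) = (\<Sum>p\<in>primes_in 0 n. \<Sum>k=1..n. if p ^ k dvd m then ln p else 0)"
proof -
  have "ln (real m) = ln (real (\<Prod>p\<in>prime_factors m. p ^ multiplicity p m))"
    using assms prime_factorization_nat[of m] by simp
  also have "\<dots> = (\<Sum>p\<in>prime_factors m. ln (real p ^ multiplicity p m))"
    unfolding of_nat_prod of_nat_power
    using assms by (intro ln_prod) (auto simp: prime_factors_dvd)
  also have "\<dots> = (\<Sum>p\<in>prime_factors m. real (multiplicity p m) * ln p)"
    by (intro sum.cong refl) (simp add: ln_realpow)
  finally show ?thesis using sum_multiplicity_eq[OF assms] by simp
qed

lemma Omega_eq_sum:
  assumes "1 \<le> m" "m \<le> n"
  shows "real (Omega m) = (\<Sum>p\<in>primes_in 0 n. \<Sum>k=1..n. if p ^ k dvd m then 1 else 0)"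
proof -
  have "real (Omega m) = (\<Sum>p\<in>prime_factors m. real (multiplicity p m) * 1)"
    using assms by (auto simp: Omega_def size_multiset_overloaded_eq count_prime_factorization
      prime_factors_dvd intro!: sum.cong)
  then show ?thesis using sum_multiplicity_eq[OF assms, of "\<lambda>_. 1"] by simp
qed

lemma omega_eq_sum:
  assumes "1 \<le> m" "m \<le> n"
  shows "real (omega m) = (\<Sum>p\<in>primes_in 0 n. if p dvd m then 1 else 0)"
proof -
  have "{p\<in>primes_in 0 n. p dvd m} = prime_factors m"
    using assms by (auto simp: primes_in_def prime_gt_0_nat prime_factors_dvd dest: dvd_imp_le)
  moreover have "(\<Sum>p\<in>primes_in 0 n. if p dvd m then 1 else (0::real)) = (\<Sum>p\<in>{p\<in>primes_in 0 n. p dvd m}. 1)"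
    by (rule sum.inter_filter[symmetric]) simp
  ultimately show ?thesis by (simp add: omega_def)
qed

lemma real_div_nat_ge:
  assumes "s > 0"
  shows "real n / real s - 1 \<le> real (n div s)"
proof -
  have "real n = real (n div s) * s + real (n mod s)" by (simp flip: of_nat_mult of_nat_add)
  moreover have "real (n mod s) \<le> real s" using assms by (simp add: less_imp_le)
  ultimately have "real n \<le> (real (n div s) + 1) * s" by (simp add: distrib_right)
  then show ?thesis using assms by (simp add: field_simps)
qed

lemma sum_indicator_multiples:
  assumes "s > 0"
  shows "(\<Sum>m=1..n. if s dvd m then c else (0::real)) = real (n div s) * c"
proof -
  have "(\<Sum>m=1..n. if s dvd m then c else 0) = (\<Sum>m\<in>{m\<in>{1..n}. s dvd m}. c)"
    by (rule sum.inter_filter[symmetric]) simp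
  then show ?thesis using card_multiples[OF assms, of n] by simp
qed

text \<open>Legendre's formula in logarithmic form: \<open>ln_eq_sum_primes\<close> summed over
  \<open>m \<le> n\<close>, with the multiples of each prime power counted.\<close>

lemma ln_fact_eq_sum:
  "ln (fact n :: real) = (\<Sum>p\<in>primes_in 0 n. \<Sum>k=1..n. real (n div p ^ k) * ln p)"
proof -
  have "ln (fact n :: real) = (\<Sum>m=1..n. ln (real m))"
    unfolding fact_prod of_nat_prod of_nat_id by (rule ln_prod) auto
  also have "\<dots> = (\<Sum>m=1..n. \<Sum>p\<in>primes_in 0 n. \<Sum>k=1..n. if p ^ k dvd m then ln p else 0)"
    by (intro sum.cong refl ln_eq_sum_primes) auto
  also have "\<dots> = (\<Sum>p\<in>primes_in 0 n. \<Sum>k=1..n. \<Sum>m=1..n. if p ^ k dvd m then ln p else 0)"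
    by (rule trans[OF sum.swap], rule sum.cong[OF refl], rule sum.swap)
  also have "\<dots> = (\<Sum>p\<in>primes_in 0 n. \<Sum>k=1..n. real (n div p ^ k) * ln p)"
    by (intro sum.cong refl sum_indicator_multiples) (auto dest: primes_inD)
  finally show ?thesis .
qed

section \<open>Mertens' first theorem\<close>

lemma ln_fact_ge: "ln (fact n :: real) \<ge> real n * ln n - n"
proof (induction n)
  case (Suc n)
  have "real n * (ln (real (Suc n)) - ln n) \<le> 1"
  proof (cases "n = 0")
    case False
    then have "ln (real (Suc n)) - ln n = ln (1 + 1 / n)"
      by (subst ln_divide_pos[symmetric]) (auto simp: field_simps)
    also have "\<dots> \<le> 1 / n" by (rule ln_add_one_self_le_self) simp
    finally show ?thesis using False by (simp add: field_simps)
  qed simp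
  moreover have "ln (fact (Suc n) :: real) = ln (real (Suc n)) + ln (fact n)"
    by (simp only: fact_Suc, subst ln_mult_pos) (auto simp del: of_nat_Suc)
  ultimately show ?case using Suc by (simp add: algebra_simps)
qed simp

lemma ln_fact_le: "ln (fact n :: real) \<le> real n * ln n"
proof (cases "n = 0")
  case False
  have "(fact n :: real) \<le> real n ^ n" using fact_le_power[of n, where ?'a = real] by simp
  then have "ln (fact n :: real) \<le> ln (real n ^ n)" using False by (subst ln_le_cancel_iff) auto
  then show ?thesis using False by (simp add: ln_realpow)
qed simp

text \<open>The limit \<open>3 / 4\<close> admits both \<open>x = 1 / p\<close> and
  \<open>x = 1 / sqrt p\<close> for every prime \<open>p\<close>, and makes
  \<open>1 / (1 - x)\<close> at most 4.\<close>

lemma sum_powers_from_2_le: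
  fixes x :: real
  assumes "0 \<le> x" "x \<le> 3 / 4"
  shows "(\<Sum>k=2..n. x ^ k) \<le> 4 * x\<^sup>2"
proof (cases "2 \<le> n")
  case True
  have "(1 - x) * (\<Sum>k=2..n. x ^ k) \<le> x\<^sup>2"
    using sum_gp_multiplied[OF True, of x] assms by simp
  moreover have "1 / 4 * (\<Sum>k=2..n. x ^ k) \<le> (1 - x) * (\<Sum>k=2..n. x ^ k)"
    using assms by (intro mult_right_mono sum_nonneg) auto
  ultimately show ?thesis by simp
qed (use assms in auto)

lemma sum_ln_over_square_bounded: "\<exists>C. \<forall>S. finite S \<longrightarrow> (\<Sum>m\<in>S. ln (real m) / real m ^ 2) \<le> C"
proof -
  have s: "summable (\<lambda>m. 2 * real m powr (-3/2))"
    by (intro summable_mult) (simp add: summable_real_powr_iff)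
  have "(\<Sum>m\<in>S. ln (real m) / real m ^ 2) \<le> (\<Sum>m. 2 * real m powr (-3/2))" if "finite S" for S
  proof -
    have "ln (real m) / real m ^ 2 \<le> 2 * real m powr (-3/2)" for m
    proof (cases "m = 0")
      case False
      have "ln (real m) = 2 * ln (sqrt m)" using False by (simp add: ln_sqrt)
      also have "\<dots> \<le> 2 * sqrt m"
        using ln_le_minus_one[of "sqrt m"] False by simp
      finally have "ln (real m) / real m ^ 2 \<le> 2 * sqrt m / real m ^ 2"
        by (intro divide_right_mono) auto
      also have "\<dots> = 2 * real m powr (-3/2)"
        using False powr_diff[of "real m" "1/2" 2] by (simp add: powr_half_sqrt powr_numeral)
      finally show ?thesis .
    qed simp
    then have "(\<Sum>m\<in>S. ln (real m) / real m ^ 2) \<le> (\<Sum>m\<in>S. 2 * real m powr (-3/2))"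
      by (intro sum_mono)
    also have "\<dots> \<le> (\<Sum>m. 2 * real m powr (-3/2))" by (intro sum_le_suminf s that) auto
    finally show ?thesis .
  qed
  then show ?thesis by blast
qed

text \<open>Compare \<open>ln (fact n) = n ln n + O(n)\<close> with Legendre's formula. The terms
  \<open>k = 1\<close> are \<open>n\<close> times the sum of \<open>ln p / p\<close>, up to rounding
  errors whose total \<open>theta_le\<close> bounds by \<open>2 n\<close>; the terms
  \<open>k \<ge> 2\<close> add at most a multiple of the convergent sum of
  \<open>ln p / p^2\<close>.\<close>

lemma mertens_nat: "\<exists>C. \<forall>n\<ge>1. \<bar>(\<Sum>p\<in>primes_in 0 (real n). ln p / p) - ln n\<bar> \<le> C"
proof -
  obtain C0 where C0: "\<And>S. finite S \<Longrightarrow> (\<Sum>m\<in>S. ln (real m) / real m ^ 2) \<le> C0"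
    using sum_ln_over_square_bounded by blast
  have "\<bar>(\<Sum>p\<in>primes_in 0 (real n). ln p / p) - ln n\<bar> \<le> max 2 (1 + 4 * C0)" if "n \<ge> 1" for n
  proof -
    let ?M = "\<Sum>p\<in>primes_in 0 (real n). ln p / p"
    have "real n * ?M - 2 * n \<le> (\<Sum>p\<in>primes_in 0 n. (n / p - 1) * ln p)"
      using theta_le[of n] by (simp add: sum_subtractf left_diff_distrib sum_distrib_left)
    also have "\<dots> \<le> (\<Sum>p\<in>primes_in 0 n. real (n div p ^ 1) * ln p)"
    proof (intro sum_mono mult_right_mono)
      fix p assume p: "p \<in> primes_in 0 n"
      show "real n / real p - 1 \<le> real (n div p ^ 1)"
        using real_div_nat_ge[of p n] primes_inD[OF p] by simp
      show "0 \<le> ln (real p)" using primes_inD[OF p] by simp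
    qed
    also have "\<dots> \<le> ln (fact n)"
      unfolding ln_fact_eq_sum
    proof (rule sum_mono)
      fix p assume p: "p \<in> primes_in 0 n"
      show "real (n div p ^ 1) * ln p \<le> (\<Sum>k=1..n. real (n div p ^ k) * ln p)"
        using that primes_inD[OF p] by (intro member_le_sum[of 1]) auto
    qed
    also have "\<dots> \<le> real n * ln n" by (rule ln_fact_le)
    finally have "real n * (?M - 2 - ln n) \<le> 0" by (simp add: algebra_simps)
    then have up: "?M - ln n \<le> 2" using that by (auto simp: mult_le_0_iff)
    have "real n * ln n - n \<le> (\<Sum>p\<in>primes_in 0 n. \<Sum>k=1..n. real (n div p ^ k) * ln p)"
      using ln_fact_ge[of n] unfolding ln_fact_eq_sum .
    also have "\<dots> \<le> (\<Sum>p\<in>primes_in 0 n. real n * (ln p / p + 4 * (ln p / p\<^sup>2)))"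
    proof (rule sum_mono)
      fix p assume p: "p \<in> primes_in 0 n"
      have "(\<Sum>k=1..n. real (n div p ^ k) * ln p) \<le> (\<Sum>k=1..n. n * (1 / real p) ^ k * ln p)"
      proof (intro sum_mono mult_right_mono)
        fix k show "real (n div p ^ k) \<le> n * (1 / real p) ^ k"
          using of_nat_div_le_of_nat[of n "p ^ k", where ?'a = real] by (simp add: power_divide)
      qed (use primes_inD[OF p] in auto)
      also have "\<dots> = n * ln p * (\<Sum>k=1..n. (1 / real p) ^ k)"
        by (simp add: sum_distrib_left sum_distrib_right mult_ac)
      also have "(\<Sum>k=1..n. (1 / real p) ^ k) = 1 / p + (\<Sum>k=2..n. (1 / real p) ^ k)"
        using that by (subst sum.atLeast_Suc_atMost) (auto simp: numeral_2_eq_2)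
      also have "n * ln p * (1 / p + (\<Sum>k=2..n. (1 / real p) ^ k)) \<le> n * ln p * (1 / p + 4 * (1 / p)\<^sup>2)"
      proof -
        have "1 / real p \<le> 3 / 4" using primes_inD(5)[OF p] by (simp add: field_simps)
        then show ?thesis
          using primes_inD(5)[OF p] by (intro mult_left_mono add_left_mono sum_powers_from_2_le) auto
      qed
      finally show "(\<Sum>k=1..n. real (n div p ^ k) * ln p) \<le> real n * (ln p / p + 4 * (ln p / p\<^sup>2))"
        by (simp add: algebra_simps power_divide)
    qed
    also have "\<dots> = real n * (?M + 4 * (\<Sum>p\<in>primes_in 0 n. ln p / p\<^sup>2))"
      by (simp add: sum_distrib_left sum.distrib distrib_left)
    also have "\<dots> \<le> real n * (?M + 4 * C0)"
      using C0[of "primes_in 0 n"] by (intro mult_left_mono add_left_mono) auto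
    finally have "real n * (ln n - 1 - ?M - 4 * C0) \<le> 0" by (simp add: algebra_simps)
    then have "ln n - ?M \<le> 1 + 4 * C0" using that by (auto simp: mult_le_0_iff)
    with up show ?thesis by linarith
  qed
  then show ?thesis by blast
qed

lemma mertens: "\<exists>C\<ge>0. \<forall>x\<ge>1. \<bar>(\<Sum>p\<in>primes_in 0 x. ln p / p) - ln x\<bar> \<le> C"
proof -
  obtain C where C: "\<And>n::nat. n \<ge> 1 \<Longrightarrow> \<bar>(\<Sum>p\<in>primes_in 0 (real n). ln p / p) - ln n\<bar> \<le> C"
    using mertens_nat by blast
  have "\<bar>(\<Sum>p\<in>primes_in 0 x. ln p / p) - ln x\<bar> \<le> C + 1" if "x \<ge> 1" for x
  proof -
    define n where "n = nat \<lfloor>x\<rfloor>"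
    have n: "n \<ge> 1" "real n = real_of_int \<lfloor>x\<rfloor>" "real n \<le> x" "x < real n + 1"
      using that by (auto simp: n_def le_nat_floor)
    have "ln x \<le> ln (real n * (1 + 1 / n))"
      using n(1,4) that by (subst ln_le_cancel_iff) (auto simp: distrib_left)
    also have "\<dots> = ln n + ln (1 + 1 / n)" using n(1) by (intro ln_mult_pos add_pos_pos) auto
    also have "ln (1 + 1 / n) \<le> 1 / n" by (rule ln_add_one_self_le_self) simp
    also have "1 / real n \<le> 1" using n(1) by simp
    finally have "ln x \<le> ln n + 1" by simp
    moreover have "ln n \<le> ln x" using n(1,3) that by simp
    moreover have eq: "primes_in 0 x = primes_in 0 (real n)"
      unfolding n(2) by (rule primes_in_floor)
    ultimately show ?thesis using C[OF n(1)] unfolding eq by linarith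
  qed
  moreover have "0 \<le> C" using C[of 1] by linarith
  ultimately show ?thesis by (meson add_nonneg_nonneg zero_le_one)
qed

section \<open>Counting primes and summing their reciprocals\<close>

lemma card_primes_in_le:
  assumes "x > 1"
  shows "real (card (primes_in 0 x)) \<le> sqrt x + 4 * x / ln x"
proof -
  have sq: "1 < sqrt x" "sqrt x \<le> x" using assms by (auto simp: real_le_lsqrt power2_eq_square)
  have "primes_in 0 (sqrt x) \<subseteq> {1..nat \<lfloor>sqrt x\<rfloor>}"
    by (auto simp: primes_in_def le_nat_floor)
  then have "card (primes_in 0 (sqrt x)) \<le> nat \<lfloor>sqrt x\<rfloor>"
    using card_mono[of "{1..nat \<lfloor>sqrt x\<rfloor>}"] by fastforce
  also have "real \<dots> \<le> sqrt x" using sq by (intro of_nat_floor) auto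
  finally have 1: "real (card (primes_in 0 (sqrt x))) \<le> sqrt x" by simp
  \<comment> \<open>Each prime above \<open>sqrt x\<close> contributes at least
    \<open>ln x / 2\<close> to Chebyshev's theta function.\<close>
  have "real (card (primes_in (sqrt x) x)) * (ln x / 2) = (\<Sum>p\<in>primes_in (sqrt x) x. ln (sqrt x))"
    using assms by (simp add: ln_sqrt)
  also have "\<dots> \<le> (\<Sum>p\<in>primes_in (sqrt x) x. ln p)"
  proof (rule sum_mono)
    fix p assume "p \<in> primes_in (sqrt x) x"
    from primes_inD(2,4)[OF this] show "ln (sqrt x) \<le> ln (real p)"
      using sq(1) by (intro ln_mono) linarith+
  qed
  also have "\<dots> \<le> (\<Sum>p\<in>primes_in 0 x. ln p)"
    using sq by (intro sum_mono2 primes_in_mono) (auto dest: primes_inD(5))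
  also have "\<dots> \<le> 2 * x" using assms by (intro theta_le) simp
  finally have 2: "real (card (primes_in (sqrt x) x)) \<le> 4 * x / ln x"
    using assms by (simp add: field_simps)
  have "card (primes_in 0 x) = card (primes_in 0 (sqrt x)) + card (primes_in (sqrt x) x)"
  proof -
    have "primes_in 0 (sqrt x) \<inter> primes_in (sqrt x) x = {}" by (auto simp: primes_in_def)
    moreover have "primes_in 0 x = primes_in 0 (sqrt x) \<union> primes_in (sqrt x) x"
      using sq by (intro primes_in_Un) auto
    ultimately show ?thesis by (simp add: card_Un_disjoint)
  qed
  with 1 2 show ?thesis by simp
qed

lemma eventually_card_primes_in_le:
  assumes "e > 0"
  shows "eventually (\<lambda>x. real (card (primes_in 0 x)) \<le> e * x) at_top"
proof -
  have "((\<lambda>x::real. (sqrt x + 4 * x / ln x) / x) \<longlongrightarrow> 0) at_top" by real_asymp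
  then have "eventually (\<lambda>x::real. (sqrt x + 4 * x / ln x) / x < e) at_top"
    using assms by (rule order_tendstoD)
  then show ?thesis using eventually_gt_at_top[of 1]
  proof eventually_elim
    case (elim x)
    then have "sqrt x + 4 * x / ln x \<le> e * x" by (simp add: field_simps)
    then show ?case using card_primes_in_le[of x] elim by linarith
  qed
qed

text \<open>Instead of partial summation, \<open>ln p\<close> is replaced by its value at an end of
  the range. This loses a constant factor unless \<open>y\<close> is close to \<open>x\<close> on
  the logarithmic scale, so longer ranges are cut into pieces below.\<close>

lemma sum_prime_recip_bounds:
  "\<exists>C\<ge>0. \<forall>x y. 1 < x \<longrightarrow> x \<le> y \<longrightarrow>
     (ln y - ln x - C) / ln y \<le> prime_recip x y \<and>
     prime_recip x y \<le> (ln y - ln x + C) / ln x"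
proof -
  obtain C where C: "C \<ge> 0" "\<And>x. x \<ge> 1 \<Longrightarrow> \<bar>(\<Sum>p\<in>primes_in 0 x. ln p / p) - ln x\<bar> \<le> C"
    using mertens by blast
  have "(ln y - ln x - 2 * C) / ln y \<le> prime_recip x y \<and>
     prime_recip x y \<le> (ln y - ln x + 2 * C) / ln x" if xy: "1 < x" "x \<le> y" for x y
  proof -
    let ?S = "\<Sum>p\<in>primes_in x y. ln p / p"
    have S: "?S = (\<Sum>p\<in>primes_in 0 y. ln p / p) - (\<Sum>p\<in>primes_in 0 x. ln p / p)"
      using sum_primes_in_split[of 0 x y "\<lambda>p. ln p / p"] xy by simp
    have "?S \<le> prime_recip x y * ln y"
      unfolding sum_distrib_right
      by (intro sum_mono) (use xy in \<open>auto simp: primes_in_def divide_simps dest: prime_gt_0_nat\<close>)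
    moreover have "prime_recip x y * ln x \<le> ?S"
      unfolding sum_distrib_right
      by (intro sum_mono) (use xy in \<open>auto simp: primes_in_def divide_simps dest: prime_gt_0_nat\<close>)
    moreover have "\<bar>?S - (ln y - ln x)\<bar> \<le> 2 * C"
      using C(2)[of x] C(2)[of y] S xy by linarith
    ultimately have "ln y - ln x - 2 * C \<le> prime_recip x y * ln y"
      "prime_recip x y * ln x \<le> ln y - ln x + 2 * C" by linarith+
    then show ?thesis using xy by (simp add: pos_divide_le_eq pos_le_divide_eq)
  qed
  then show ?thesis using C(1) by (intro exI[of _ "2 * C"]) (metis mult_nonneg_nonneg zero_le_numeral)
qed

text \<open>The true limit is \<open>ln 2\<close>. Used once on the whole range, the crude bound
  would give only 1; with a cut at \<open>x powr (3 / 4)\<close> it gives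
  \<open>1/2 + 1/3 = 5/6\<close>, safely below 1.\<close>

lemma eventually_sum_large_prime_recip_le:
  "eventually (\<lambda>x. prime_recip (sqrt x) x \<le> 7 / 8) at_top"
proof -
  obtain C where C: "C \<ge> 0" "\<And>x y. 1 < x \<Longrightarrow> x \<le> y \<Longrightarrow>
     prime_recip x y \<le> (ln y - ln x + C) / ln x"
    using sum_prime_recip_bounds by blast
  \<comment> \<open>The two constants \<open>C\<close> add \<open>10 C / (3 ln x)\<close> to
    \<open>5/6\<close>; this stays within \<open>7/8 - 5/6 = 1/24\<close> once
    \<open>ln x \<ge> 80 C\<close>.\<close>
  have "eventually (\<lambda>x::real. ln x \<ge> 80 * C + 1) at_top" by real_asymp
  then show ?thesis using eventually_gt_at_top[of 1]
  proof eventually_elim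
    case (elim x)
    define y where "y = x powr (3 / 4)"
    have ln: "ln (sqrt x) = ln x / 2" "ln y = 3 / 4 * ln x" using elim by (auto simp: ln_sqrt y_def ln_powr)
    have y: "1 < sqrt x" "sqrt x \<le> y" "y \<le> x" "1 < y"
      using elim powr_mono[of "1/2" "3/4" x] powr_mono[of "3/4" 1 x] powr_less_mono[of 0 "3/4" x]
      by (auto simp: y_def powr_half_sqrt)
    have "prime_recip (sqrt x) x = prime_recip (sqrt x) y + prime_recip y x"
      using y by (intro sum_primes_in_split) auto
    also have "\<dots> \<le> (3 / 4 * ln x - ln x / 2 + C) / (ln x / 2) + (ln x - 3 / 4 * ln x + C) / (3 / 4 * ln x)"
      using C(2)[of "sqrt x" y] C(2)[of y x] y unfolding ln by (intro add_mono) auto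
    also have "\<dots> \<le> 7 / 8" using elim C(1) by (simp add: field_simps)
    finally show ?case .
  qed
qed

text \<open>Cut the range at \<open>P\<close>, \<open>P powr (1 + \<eta>)\<close>,
  \<open>P powr ((1 + \<eta>) ^ 2)\<close> and so on. Each piece contributes at least a constant,
  and the number of complete pieces is of size \<open>ln (ln R / ln P)\<close>. At least one piece
  fits, so taking the floor loses at most a factor 2.\<close>

lemma sum_prime_recip_ge:
  assumes "\<eta> > 0"
  shows "\<exists>c>0. \<exists>P0>1. \<forall>P\<ge>P0. \<forall>R\<ge>P powr (1 + \<eta>).
           c * ln (ln R / ln P) \<le> prime_recip P R"
proof -
  obtain C where C: "C \<ge> 0" "\<And>x y. 1 < x \<Longrightarrow> x \<le> y \<Longrightarrow>
     (ln y - ln x - C) / ln y \<le> prime_recip x y"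
    using sum_prime_recip_bounds by blast
  \<comment> \<open>Half of \<open>\<eta> / (1 + \<eta>)\<close>, the contribution of one piece
    without the error \<open>C\<close>; the other half pays for \<open>C\<close> when
    \<open>ln x\<close> is large.\<close>
  define c0 where "c0 = \<eta> / (2 * (1 + \<eta>))"
  have c0: "c0 > 0" using assms by (simp add: c0_def)
  have step: "c0 \<le> prime_recip x (x powr (1 + \<eta>))" if x: "ln x \<ge> 2 * C / \<eta> + 1" "x > 0" for x
  proof -
    have l: "ln x > 0" "1 < x" using x C(1) assms by (auto simp: add_nonneg_pos intro: ccontr)
      (smt (verit) divide_nonneg_pos ln_le_zero_iff mult_nonneg_nonneg)+
    have "C \<le> \<eta> / 2 * ln x" using x(1) assms by (simp add: field_simps)
    moreover have "c0 * (1 + \<eta>) = \<eta> / 2" using assms by (simp add: c0_def field_simps)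
    ultimately have "c0 * ((1 + \<eta>) * ln x) \<le> (1 + \<eta>) * ln x - ln x - C"
      by (simp only: mult.assoc[symmetric]) (simp add: algebra_simps)
    then have "c0 \<le> ((1 + \<eta>) * ln x - ln x - C) / ((1 + \<eta>) * ln x)"
      using l assms by (subst pos_le_divide_eq) auto
    also have "\<dots> \<le> prime_recip x (x powr (1 + \<eta>))"
      using C(2)[of x "x powr (1 + \<eta>)"] l assms powr_mono[of 1 "1 + \<eta>" x] by (simp add: ln_powr)
    finally show ?thesis .
  qed
  have multi: "real J * c0 \<le> prime_recip P (P powr ((1 + \<eta>) ^ J))"
    if P: "ln P \<ge> 2 * C / \<eta> + 1" "P > 1" for P J
  proof (induction J)
    case (Suc J)
    let ?x = "P powr ((1 + \<eta>) ^ J)"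
    have e1: "(1 + \<eta>) ^ J \<ge> 1" using assms by simp
    then have "ln P \<le> ln ?x" using P by (simp add: ln_powr)
    then have st: "c0 \<le> prime_recip ?x (?x powr (1 + \<eta>))"
      using P by (intro step) (linarith, simp)
    have eq: "?x powr (1 + \<eta>) = P powr ((1 + \<eta>) ^ Suc J)" by (simp add: powr_powr mult.commute)
    have "P \<le> ?x" using P e1 powr_mono[of 1 "(1 + \<eta>) ^ J" P] by simp
    moreover have "?x \<le> P powr ((1 + \<eta>) ^ Suc J)" using P assms by (intro powr_mono) auto
    ultimately show ?case
      using Suc st sum_primes_in_split[of P ?x "P powr ((1 + \<eta>) ^ Suc J)" "\<lambda>p. 1 / real p"]
      unfolding eq by (simp add: algebra_simps)
  qed (simp add: sum_nonneg)
  have "c0 / (2 * ln (1 + \<eta>)) * ln (ln R / ln P) \<le> prime_recip P R"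
    if P: "P \<ge> exp (2 * C / \<eta> + 1)" and R: "R \<ge> P powr (1 + \<eta>)" for P R
  proof -
    have "2 * C / \<eta> + 1 > 0" using C(1) assms by (simp add: add_nonneg_pos)
    then have P1: "P > 1" using P by (meson less_le_trans one_less_exp_iff)
    then have P1: "ln P \<ge> 2 * C / \<eta> + 1" "P > 1" using P by (auto simp: ln_ge_iff)
    have lP: "ln P > 0" using P1(2) by simp
    have R1: "R \<ge> P" using R P1 assms powr_mono[of 1 "1 + \<eta>" P] by simp
    have "(1 + \<eta>) * ln P = ln (P powr (1 + \<eta>))" using P1 by (simp add: ln_powr)
    also have "\<dots> \<le> ln R" using R P1 R1 by (subst ln_le_cancel_iff) auto
    finally have q: "ln R / ln P \<ge> 1 + \<eta>" using lP by (simp add: field_simps)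
    define t where "t = ln (ln R / ln P) / ln (1 + \<eta>)"
    have l1: "ln (1 + \<eta>) > 0" using assms by simp
    have "t \<ge> 1" unfolding t_def using q l1 assms by simp
    define J where "J = nat \<lfloor>t\<rfloor>"
    have J1: "real J = real_of_int \<lfloor>t\<rfloor>" "1 \<le> real_of_int \<lfloor>t\<rfloor>"
      using \<open>t \<ge> 1\<close> by (auto simp: J_def)
    have J: "real J \<le> t" "t / 2 \<le> real J"
      using J1 of_int_floor_le[of t] real_of_int_floor_add_one_gt[of t] by linarith+
    have "(1 + \<eta>) ^ J = exp (ln (1 + \<eta>)) ^ J" using assms by simp
    also have "\<dots> = exp (real J * ln (1 + \<eta>))" by (rule exp_of_nat_mult[symmetric])
    also have "\<dots> \<le> exp (t * ln (1 + \<eta>))" using J l1 by simp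
    also have "\<dots> = ln R / ln P" using l1 q assms by (simp add: t_def)
    finally have "(1 + \<eta>) ^ J * ln P \<le> ln R" using lP by (simp add: field_simps)
    then have "ln (P powr ((1 + \<eta>) ^ J)) \<le> ln R" using P1 by (simp add: ln_powr)
    then have xR: "P powr ((1 + \<eta>) ^ J) \<le> R" using P1 R1 by (subst (asm) ln_le_cancel_iff) auto
    have "c0 / (2 * ln (1 + \<eta>)) * ln (ln R / ln P) = t / 2 * c0"
      using l1 by (simp add: t_def field_simps)
    also have "\<dots> \<le> real J * c0" using J c0 by (intro mult_right_mono) auto
    also have "\<dots> \<le> prime_recip P (P powr ((1 + \<eta>) ^ J))" using multi P1 by blast
    also have "\<dots> \<le> prime_recip P R"
      using xR by (intro sum_mono2 primes_in_mono) auto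
    finally show ?thesis .
  qed
  moreover have "c0 / (2 * ln (1 + \<eta>)) > 0" using c0 assms by simp
  moreover have "exp (2 * C / \<eta> + 1) > 1" using C(1) assms by (simp add: add_nonneg_pos)
  ultimately show ?thesis by meson
qed

section \<open>Duality\<close>

lemma sum_by_gcd:
  fixes F :: "nat \<Rightarrow> real"
  assumes "q \<ge> 1"
  shows "(\<Sum>h | h dvd q. \<Sum>a | a \<in> {1..q} \<and> gcd a q = h. F a) = (\<Sum>a=1..q. F a)"
proof -
  have "(\<Sum>a=1..q. F a) = (\<Sum>h\<in>{h. h dvd q}. sum F {a\<in>{1..q}. gcd a q = h})"
    using assms by (intro sum.group[symmetric]) auto
  then show ?thesis by simp
qed

text \<open>Cauchy--Schwarz against any test function whose sum over each class \<open>gcd a q = h\<close>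
  vanishes: such a function does not see the subtracted means.\<close>

lemma V_duality:
  fixes f :: "nat \<Rightarrow> real" and g :: "nat \<Rightarrow> nat \<Rightarrow> real" and w :: "nat \<Rightarrow> real"
  assumes Qs: "finite Qs" "\<And>q. q \<in> Qs \<Longrightarrow> 1 \<le> q \<and> real q \<le> Q"
    and w: "\<And>q. q \<in> Qs \<Longrightarrow> 0 \<le> w q" "\<And>q. q \<in> Qs \<Longrightarrow> w q \<le> 1"
    and per: "\<And>q n a. q \<in> Qs \<Longrightarrow> [n = a] (mod q) \<Longrightarrow> g q n = g q a"
    and mean0: "\<And>q h. q \<in> Qs \<Longrightarrow> h dvd q \<Longrightarrow> (\<Sum>a | a \<in> {1..q} \<and> gcd a q = h. g q a) = 0"
  shows "(\<Sum>n=1..N. f n * (\<Sum>q\<in>Qs. w q * g q n))\<^sup>2 \<le>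
         V N Q (\<lambda>n. of_real (f n)) * (\<Sum>q\<in>Qs. w q * (\<Sum>a=1..q. (g q a)\<^sup>2))"
proof -
  define X where "X q a = (\<Sum>n | n \<in> {1..N} \<and> [n = a] (mod q). f n)" for q a
  define c where "c q h = 1 / real (totient (q div h)) * (\<Sum>n | n \<in> {1..N} \<and> gcd n q = h. f n)" for q h
  define D where "D q a = X q a - c q (gcd a q)" for q a
  have Veq: "V N Q (\<lambda>n. of_real (f n)) = (\<Sum>q | 1 \<le> q \<and> real q \<le> Q. \<Sum>a=1..q. (D q a)\<^sup>2)"
    unfolding V_def
  proof (rule sum.cong[OF refl])
    fix q assume "q \<in> {q. 1 \<le> q \<and> real q \<le> Q}"
    then have "(\<Sum>a=1..q. (D q a)\<^sup>2) = (\<Sum>h | h dvd q. \<Sum>a | a \<in> {1..q} \<and> gcd a q = h. (D q a)\<^sup>2)"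
      by (intro sum_by_gcd[symmetric]) auto
    also have "\<dots> = (\<Sum>h | h dvd q. \<Sum>a | a \<in> {1..q} \<and> gcd a q = h.
          (cmod ((\<Sum>n | n \<in> {1..N} \<and> [n = a] (mod q). of_real (f n))
                 - 1 / of_nat (totient (q div h)) * (\<Sum>n | n \<in> {1..N} \<and> gcd n q = h. of_real (f n))))\<^sup>2)"
      (is "_ = (\<Sum>h | h dvd q. \<Sum>a | a \<in> {1..q} \<and> gcd a q = h. (cmod (?X a h))\<^sup>2)")
    proof (intro sum.cong refl)
      fix h a assume a: "a \<in> {a. a \<in> {1..q} \<and> gcd a q = h}"
      have "?X a h = of_real (D q a)"
        using a unfolding D_def X_def c_def by simp
      then show "(D q a)\<^sup>2 = (cmod (?X a h))\<^sup>2"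
        by (simp only: norm_of_real power2_abs)
    qed
    finally show "(\<Sum>h | h dvd q. \<Sum>a | a \<in> {1..q} \<and> gcd a q = h. (cmod (?X a h))\<^sup>2) = (\<Sum>a=1..q. (D q a)\<^sup>2)" ..
  qed
  have finq: "finite {q. 1 \<le> q \<and> real q \<le> Q}"
    by (rule finite_subset[of _ "{..nat \<lfloor>Q\<rfloor>}"]) (auto simp: le_nat_floor)
  have cov: "(\<Sum>n=1..N. f n * (\<Sum>q\<in>Qs. w q * g q n)) = (\<Sum>q\<in>Qs. \<Sum>a=1..q. w q * (D q a * g q a))"
  proof -
    have "(\<Sum>n=1..N. f n * (\<Sum>q\<in>Qs. w q * g q n)) = (\<Sum>q\<in>Qs. w q * (\<Sum>n=1..N. f n * g q n))"
      by (simp add: sum_distrib_left mult_ac) (rule sum.swap)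
    also have "\<dots> = (\<Sum>q\<in>Qs. w q * (\<Sum>a=1..q. D q a * g q a))"
    proof (rule sum.cong[OF refl])
      fix q assume q: "q \<in> Qs"
      then have q1: "q \<ge> 1" using Qs by auto
      have "(\<Sum>a=1..q. D q a * g q a) = (\<Sum>a=1..q. X q a * g q a) - (\<Sum>a=1..q. c q (gcd a q) * g q a)"
        by (simp add: D_def left_diff_distrib sum_subtractf)
      also have "(\<Sum>a=1..q. c q (gcd a q) * g q a) =
        (\<Sum>h | h dvd q. \<Sum>a | a \<in> {1..q} \<and> gcd a q = h. c q (gcd a q) * g q a)"
        by (rule sum_by_gcd[OF q1, symmetric])
      also have "\<dots> = (\<Sum>h | h dvd q. c q h * (\<Sum>a | a \<in> {1..q} \<and> gcd a q = h. g q a))"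
        by (intro sum.cong refl) (auto simp: sum_distrib_left intro!: sum.cong)
      also have "\<dots> = 0" using mean0[OF q] by simp
      \<comment> \<open>Classes are represented in \<open>{1..q}\<close>, so the multiples of
        \<open>q\<close> belong to \<open>a = q\<close>, where \<open>n mod q\<close> would give
        0.\<close>
      also have "(\<Sum>a=1..q. X q a * g q a) = (\<Sum>a=1..q. \<Sum>n\<in>{n\<in>{1..N}. (if n mod q = 0 then q else n mod q) = a}. f n * g q n)"
        unfolding X_def sum_distrib_right
      proof (rule sum.cong[OF refl], rule sum.cong)
        fix a assume a: "a \<in> {1..q}"
        have "[n = a] (mod q) \<longleftrightarrow> (if n mod q = 0 then q else n mod q) = a" for n
          using a less_imp_neq[OF mod_less_divisor[of q n]] by (cases "a = q") (auto simp: cong_def)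
        then show "{n. n \<in> {1..N} \<and> [n = a] (mod q)} = {n\<in>{1..N}. (if n mod q = 0 then q else n mod q) = a}"
          by auto
      next
        fix a n assume "n \<in> {n\<in>{1..N}. (if n mod q = 0 then q else n mod q) = a}"
        then have "[n = a] (mod q)" by (auto simp: cong_def split: if_splits)
        then show "f n * g q a = f n * g q n" using per[OF q] by simp
      qed
      also have "\<dots> = (\<Sum>n=1..N. f n * g q n)"
        using q1 by (intro sum.group) (auto simp: Suc_le_eq less_imp_le)
      finally show "w q * (\<Sum>n=1..N. f n * g q n) = w q * (\<Sum>a=1..q. D q a * g q a)" by simp
    qed
    finally show ?thesis by (simp add: sum_distrib_left)
  qed
  let ?I = "SIGMA q:Qs. {1..q}"
  have "(\<Sum>q\<in>Qs. \<Sum>a=1..q. w q * (D q a * g q a)) =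
        (\<Sum>(q,a)\<in>?I. (sqrt (w q) * D q a) * (sqrt (w q) * g q a))"
    using Qs by (subst sum.Sigma[symmetric]) (auto intro!: sum.cong simp: w algebra_simps)
  also have "\<dots>\<^sup>2 \<le> (\<Sum>(q,a)\<in>?I. (sqrt (w q) * D q a)\<^sup>2) * (\<Sum>(q,a)\<in>?I. (sqrt (w q) * g q a)\<^sup>2)"
    using Cauchy_Schwarz_ineq_sum[of "\<lambda>(q,a). sqrt (w q) * D q a" "\<lambda>(q,a). sqrt (w q) * g q a" ?I]
    by (simp add: case_prod_unfold)
  also have "(\<Sum>(q,a)\<in>?I. (sqrt (w q) * g q a)\<^sup>2) = (\<Sum>q\<in>Qs. w q * (\<Sum>a=1..q. (g q a)\<^sup>2))"
    using Qs by (subst sum.Sigma[symmetric]) (auto intro!: sum.cong simp: w power_mult_distrib sum_distrib_left)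
  also have "(\<Sum>(q,a)\<in>?I. (sqrt (w q) * D q a)\<^sup>2) = (\<Sum>q\<in>Qs. w q * (\<Sum>a=1..q. (D q a)\<^sup>2))"
    using Qs by (subst sum.Sigma[symmetric]) (auto intro!: sum.cong simp: w power_mult_distrib sum_distrib_left)
  also have "\<dots> \<le> (\<Sum>q\<in>Qs. \<Sum>a=1..q. (D q a)\<^sup>2)"
    using w by (intro sum_mono mult_left_le_one_le sum_nonneg) auto
  also have "\<dots> \<le> V N Q (\<lambda>n. of_real (f n))"
    unfolding Veq using Qs(2) by (intro sum_mono2 finq sum_nonneg) auto
  finally show ?thesis unfolding cov
    by (simp add: mult_right_mono sum_nonneg w)
qed

text \<open>The reflection of \<open>a\<close> to \<open>q - a\<close> preserves
  \<open>gcd a q\<close> and reverses the sign. The class \<open>a = q\<close> is its own mirror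
  image, so \<open>g q = 0\<close> is assumed separately.\<close>

lemma sum_class_odd:
  fixes g :: "nat \<Rightarrow> real"
  assumes q: "q \<ge> 1" and odd: "\<And>a. 1 \<le> a \<Longrightarrow> a < q \<Longrightarrow> g (q - a) = - g a" and gq: "g q = 0"
  shows "(\<Sum>a | a \<in> {1..q} \<and> gcd a q = h. g a) = 0"
proof -
  let ?S = "{a. a \<in> {1..q} \<and> gcd a q = h}"
  define r where "r a = (if a = q then q else q - a)" for a
  have r: "r a \<in> ?S" "r (r a) = a" "g (r a) = - g a" if "a \<in> ?S" for a
  proof -
    have "gcd (q - a) q = gcd a q" if "a \<le> q"
      using that by (metis gcd.commute gcd_diff1_nat gcd_diff2_nat)
    then show "r a \<in> ?S" "r (r a) = a" "g (r a) = - g a" using that odd[of a] gq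
      by (auto simp: r_def)
  qed
  have "(\<Sum>a\<in>?S. g a) = (\<Sum>a\<in>?S. - g a)"
    by (rule sum.reindex_bij_witness[of _ r r]) (use r in auto)
  then show ?thesis by (simp add: sum_negf)
qed

section \<open>Smooth sums over residue classes\<close>

definition fdiff :: "(int \<Rightarrow> real) \<Rightarrow> int \<Rightarrow> real" where
  "fdiff F q = F (q + 1) - F q"

lemma card_residue_class_le:
  fixes a b c p :: int
  assumes "p \<ge> 1" "a \<le> b"
  shows "real (card {q\<in>{a..b}. q mod p = c mod p}) \<le> (b - a) / p + 1"
proof -
  let ?S = "{q\<in>{a..b}. q mod p = c mod p}"
  have "inj_on (\<lambda>q. (q - a) div p) ?S"
  proof (rule inj_onI)
    fix x y assume xy: "x \<in> ?S" "y \<in> ?S" "(x - a) div p = (y - a) div p"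
    then have "(x - a) mod p = (y - a) mod p" by (metis (mono_tags, lifting) mem_Collect_eq mod_diff_left_eq)
    with xy(3) have "x - a = y - a" by (metis div_mult_mod_eq)
    then show "x = y" by simp
  qed
  moreover have "(\<lambda>q. (q - a) div p) ` ?S \<subseteq> {0..(b - a) div p}"
    using assms by (auto intro!: zdiv_mono1 pos_imp_zdiv_nonneg_iff[THEN iffD2])
  ultimately have "card ?S \<le> card {0..(b - a) div p}" by (intro card_inj_on_le) auto
  also have "real \<dots> = real_of_int ((b - a) div p) + 1"
    using assms by (simp add: pos_imp_zdiv_nonneg_iff)
  also have "\<dots> \<le> (b - a) / p + 1" using real_of_int_div4[of "b - a" p] by simp
  finally show ?thesis by simp
qed

lemma sum_fdiff: "a \<le> b \<Longrightarrow> (\<Sum>q=a..b. fdiff F q) = F (b + 1) - F a"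
proof (induction b rule: int_ge_induct)
  case (step b)
  have "{a..b + 1} = insert (b + 1) {a..b}" using step by auto
  then show ?case using step by (simp add: fdiff_def)
qed (simp add: fdiff_def)

text \<open>Induction on \<open>m\<close>. Sums over the neighbouring classes \<open>c\<close> and
  \<open>c + 1\<close> differ by the sum of \<open>fdiff F\<close> over the class \<open>c\<close>;
  as \<open>fdiff F\<close> has total 0, the induction hypothesis bounds that difference by some
  \<open>B\<close>. Hence every class sum is within \<open>p B\<close> of the average over all
  \<open>p\<close> classes. Each difference costs a factor \<open>p\<close>, but \<open>K\<close>
  bounds the differenced function; a difference also moves the support one step to the left, hence
  \<open>a + int m\<close>.\<close>

lemma sum_residue_class_equidist:
  fixes F :: "int \<Rightarrow> real" and a b c p :: int
  assumes p: "p \<ge> 1" and ab: "a \<le> b"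
    and supp: "\<And>q. q < a + int m \<or> q > b \<Longrightarrow> F q = 0"
    and K: "\<And>q. \<bar>(fdiff ^^ m) F q\<bar> \<le> K"
  shows "\<bar>(\<Sum>q=a..b. if q mod p = c mod p then F q else 0) - (\<Sum>q=a..b. F q) / p\<bar>
         \<le> 2 * p ^ m * ((b - a) / p + 1) * K"
  using supp K
proof (induction m arbitrary: F c)
  case 0
  have K0: "K \<ge> 0" "\<bar>F q\<bar> \<le> K" for q using 0(2)[of 0] 0(2)[of q] by auto
  have "\<bar>\<Sum>q=a..b. if q mod p = c mod p then F q else 0\<bar> = \<bar>\<Sum>q\<in>{q\<in>{a..b}. q mod p = c mod p}. F q\<bar>"
    by (subst sum.inter_filter) auto
  also have "\<dots> \<le> (\<Sum>q\<in>{q\<in>{a..b}. q mod p = c mod p}. K)"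
    by (rule order.trans[OF sum_abs]) (intro sum_mono K0)
  also have "\<dots> \<le> ((b - a) / p + 1) * K"
    using mult_right_mono[OF card_residue_class_le[OF p ab, of c] K0(1)] by simp
  finally have 1: "\<bar>\<Sum>q=a..b. if q mod p = c mod p then F q else 0\<bar> \<le> ((b - a) / p + 1) * K" .
  have "\<bar>\<Sum>q=a..b. F q\<bar> \<le> (\<Sum>q=a..b. K)"
    by (rule order.trans[OF sum_abs]) (intro sum_mono K0)
  also have "\<dots> = (b - a + 1) * K" using ab by simp
  finally have "\<bar>(\<Sum>q=a..b. F q) / p\<bar> \<le> (b - a + 1) * K / p" using p by (simp add: divide_right_mono)
  also have "(b - a + 1) * K / p = ((b - a) / p + 1 / p) * K" by (simp add: add_divide_distrib distrib_right)
  also have "\<dots> \<le> ((b - a) / p + 1) * K" using p K0 by (intro mult_right_mono) auto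
  finally have "\<bar>(\<Sum>q=a..b. if q mod p = c mod p then F q else 0) - (\<Sum>q=a..b. F q) / p\<bar>
      \<le> 2 * (((b - a) / p + 1) * K)" using 1 by linarith
  then show ?case by (simp only: power_0 mult_1_right mult.assoc)
next
  case (Suc m)
  define S where "S F c = (\<Sum>q=a..b. if q mod p = c mod p then F q else 0)" for F :: "int \<Rightarrow> real" and c
  define B where "B = 2 * p ^ m * ((b - a) / p + 1) * K"
  have F0: "F a = 0" "F (b + 1) = 0" using Suc.prems(1) by auto
  have "(\<Sum>q=a..b. fdiff F q) = F (b + 1) - F a"
    by (rule sum_fdiff[OF ab])
  then have tot: "(\<Sum>q=a..b. fdiff F q) = 0" using F0 by simp
  have "\<bar>(\<Sum>q=a..b. if q mod p = c mod p then fdiff F q else 0) - (\<Sum>q=a..b. fdiff F q) / p\<bar> \<le> B" for c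
    unfolding B_def
  proof (rule Suc.IH)
    show "fdiff F q = 0" if "q < a + int m \<or> q > b" for q
      using that Suc.prems(1)[of q] Suc.prems(1)[of "q + 1"] unfolding fdiff_def by auto
    show "\<bar>(fdiff ^^ m) (fdiff F) q\<bar> \<le> K" for q
      using Suc.prems(2)[of q] by (simp add: funpow_swap1)
  qed
  then have IH: "\<bar>S (fdiff F) c\<bar> \<le> B" for c unfolding tot S_def by simp
  have B0: "B \<ge> 0" using IH[of 0] by linarith
  have step: "S F (c + 1) - S F c = S (fdiff F) c" for c
  proof -
    have mod_shift: "(q + 1) mod p = (c + 1) mod p \<longleftrightarrow> q mod p = c mod p" for q
      by (simp add: mod_eq_dvd_iff)
    have "(\<Sum>q=a..b. if q mod p = c mod p then F (q + 1) else 0)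
        = (\<Sum>q=a+1..b+1. if q mod p = (c + 1) mod p then F q else 0)"
      by (rule sum.reindex_bij_witness[of _ "\<lambda>q. q - 1" "\<lambda>q. q + 1"]) (auto simp: mod_shift)
    also have "\<dots> = (\<Sum>q=a..b+1. if q mod p = (c + 1) mod p then F q else 0)"
    proof -
      have "{a..b + 1} = insert a {a+1..b+1}" using ab by auto
      then show ?thesis using F0 by simp
    qed
    also have "\<dots> = S F (c + 1)"
    proof -
      have "{a..b + 1} = insert (b + 1) {a..b}" using ab by auto
      then show ?thesis using F0 by (simp add: S_def)
    qed
    finally have shifted: "(\<Sum>q=a..b. if q mod p = c mod p then F (q + 1) else 0) = S F (c + 1)" .
    have "S (fdiff F) c = (\<Sum>q=a..b. if q mod p = c mod p then F (q + 1) else 0) - S F c"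
      unfolding S_def fdiff_def by (subst sum_subtractf[symmetric]) (auto intro!: sum.cong)
    then show ?thesis unfolding shifted by simp
  qed
  have dist: "\<bar>S F (c + int j) - S F c\<bar> \<le> real j * B" for c j
  proof (induction j)
    case (Suc j)
    have "\<bar>S F (c + int j + 1) - S F (c + int j)\<bar> \<le> B" using step IH by simp
    then show ?case using Suc by (simp add: algebra_simps)
  qed simp
  define P where "P = nat p"
  have P: "P \<ge> 1" "p = int P" using p by (auto simp: P_def)
  have avg: "(\<Sum>j<P. S F (c + int j)) = (\<Sum>q=a..b. F q)"
  proof -
    have "(\<Sum>j<P. S F (c + int j)) = (\<Sum>q=a..b. \<Sum>j<P. if q mod p = (c + int j) mod p then F q else 0)"
      unfolding S_def by (rule sum.swap)
    also have "\<dots> = (\<Sum>q=a..b. F q)"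
    proof (rule sum.cong[OF refl])
      fix q
      have "q mod p = (c + int j) mod p \<longleftrightarrow> j = nat ((q - c) mod p)" if "j < P" for j
      proof -
        have "q mod p = (c + int j) mod p \<longleftrightarrow> (q - c) mod p = int j mod p"
          by (simp add: mod_eq_dvd_iff algebra_simps)
        also have "int j mod p = int j" using that P by simp
        finally show ?thesis using p by auto
      qed
      then have "(\<Sum>j<P. if q mod p = (c + int j) mod p then F q else 0) =
            (\<Sum>j<P. if j = nat ((q - c) mod p) then F q else 0)"
        by (intro sum.cong refl) auto
      also have "\<dots> = F q" using p P by (simp add: nat_less_iff)
      finally show "(\<Sum>j<P. if q mod p = (c + int j) mod p then F q else 0) = F q" .
    qed
    finally show ?thesis .
  qed
  have "real P * S F c - (\<Sum>q=a..b. F q) = (\<Sum>j<P. S F c - S F (c + int j))"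
    unfolding avg[symmetric] by (simp add: sum_subtractf)
  also have "\<bar>\<dots>\<bar> \<le> (\<Sum>j<P. real P * B)"
  proof (rule order.trans[OF sum_abs], rule sum_mono)
    fix j assume "j \<in> {..<P}"
    then have "real j * B \<le> real P * B" using B0 by (intro mult_right_mono) auto
    then show "\<bar>S F c - S F (c + int j)\<bar> \<le> real P * B"
      using dist[of c j] by linarith
  qed
  also have "\<dots> = real P * (real P * B)" by simp
  finally have "real P * \<bar>S F c - (\<Sum>q=a..b. F q) / real P\<bar> \<le> real P * (real P * B)"
    using P by (simp add: abs_mult[of "real P", symmetric, simplified] right_diff_distrib)
  then have "\<bar>S F c - (\<Sum>q=a..b. F q) / real P\<bar> \<le> real P * B"
    using P by (simp only: mult_le_cancel_left_pos)
  then show ?case unfolding S_def B_def P(2) by (simp add: mult_ac)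
qed

section \<open>Calculus of iterated differences\<close>

lemma fdiff_funpow_Suc: "(fdiff ^^ Suc i) F = (fdiff ^^ i) (fdiff F)"
  by (simp add: funpow_swap1)

lemma fdiff_funpow_add: "(fdiff ^^ i) (\<lambda>q. F q + G q) q = (fdiff ^^ i) F q + (fdiff ^^ i) G q"
  by (induction i arbitrary: q) (auto simp: fdiff_def)

lemma fdiff_funpow_shift: "(fdiff ^^ i) (\<lambda>q. F (q + 1)) q = (fdiff ^^ i) F (q + 1)"
  by (induction i arbitrary: q) (auto simp: fdiff_def)

lemma fdiff_funpow_eq_0: "(\<And>j. j \<le> i \<Longrightarrow> F (q + int j) = 0) \<Longrightarrow> (fdiff ^^ i) F q = 0"
proof (induction i arbitrary: q)
  case (Suc i)
  have "(fdiff ^^ i) F (q + 1) = 0"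
    using Suc.prems[of "Suc _"] by (intro Suc.IH) (simp add: add_ac)
  moreover have "(fdiff ^^ i) F q = 0" using Suc.prems by (intro Suc.IH) auto
  ultimately show ?case using fdiff_def[of "(fdiff ^^ i) F" q] by simp
next
  case 0
  show ?case using 0[of 0] by simp
qed

text \<open>The discrete form of \<open>i\<close>-th derivatives of size \<open>M h^i\<close>. An
  \<open>i\<close>-th difference at \<open>q\<close> uses the values at
  \<open>q, ..., q + i\<close>, so all of these have to lie in the window.\<close>

definition diff_bounded :: "nat \<Rightarrow> real \<Rightarrow> real \<Rightarrow> int \<Rightarrow> int \<Rightarrow> (int \<Rightarrow> real) \<Rightarrow> bool" where
  "diff_bounded m M h lo hi F \<longleftrightarrow>
     (\<forall>i\<le>m. \<forall>q. lo \<le> q \<and> q + int i \<le> hi \<longrightarrow> \<bar>(fdiff ^^ i) F q\<bar> \<le> M * h ^ i)"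

lemma diff_bounded_mono:
  assumes "diff_bounded m M h lo hi F" "M \<le> M'" "0 \<le> h" "h \<le> h'" "0 \<le> M"
  shows "diff_bounded m M' h' lo hi F"
  unfolding diff_bounded_def
proof (intro allI impI)
  fix i q assume "i \<le> m" "lo \<le> q \<and> q + int i \<le> hi"
  then have "\<bar>(fdiff ^^ i) F q\<bar> \<le> M * h ^ i" using assms(1) by (auto simp: diff_bounded_def)
  also have "\<dots> \<le> M' * h' ^ i" using assms by (intro mult_mono power_mono) auto
  finally show "\<bar>(fdiff ^^ i) F q\<bar> \<le> M' * h' ^ i" .
qed

text \<open>Discrete Leibniz rule
  \<open>fdiff (F G) q = fdiff F q * G (q + 1) + F q * fdiff G q\<close>, iterated. The shifted
  argument \<open>q + 1\<close> costs one point at the right end of the window at each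
  stage.\<close>

lemma fdiff_mult_bound:
  assumes "diff_bounded i M h lo hi F" "diff_bounded i M' h' lo hi G"
    and "0 \<le> M" "0 \<le> M'" "0 \<le> h" "0 \<le> h'" "lo \<le> q" "q + int i \<le> hi"
  shows "\<bar>(fdiff ^^ i) (\<lambda>q. F q * G q) q\<bar> \<le> M * M' * (h + h') ^ i"
  using assms
proof (induction i arbitrary: M M' hi F G)
  case 0
  then have "\<bar>F q\<bar> \<le> M" "\<bar>G q\<bar> \<le> M'" by (auto simp: diff_bounded_def)
  then show ?case using 0 by (simp add: abs_mult mult_mono)
next
  case (Suc i)
  have eq: "fdiff (\<lambda>q. F q * G q) = (\<lambda>q. fdiff F q * G (q + 1) + F q * fdiff G q)"
    by (auto simp: fdiff_def algebra_simps)
  have d: "diff_bounded i (m * k) k lo (hi - 1) (fdiff H)" if "diff_bounded (Suc i) m k lo hi H" for H m k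
    unfolding diff_bounded_def
  proof (intro allI impI)
    fix j q assume "j \<le> i" "lo \<le> q \<and> q + int j \<le> hi - 1"
    then have "\<bar>(fdiff ^^ Suc j) H q\<bar> \<le> m * k ^ Suc j"
      by (intro that[unfolded diff_bounded_def, rule_format]) auto
    then show "\<bar>(fdiff ^^ j) (fdiff H) q\<bar> \<le> m * k * k ^ j"
      unfolding fdiff_funpow_Suc by (simp add: mult_ac)
  qed
  note dF = d[OF Suc.prems(1)] and dG = d[OF Suc.prems(2)]
  have F: "diff_bounded i M h lo (hi - 1) F" using Suc.prems(1) by (auto simp: diff_bounded_def)
  have G: "diff_bounded i M' h' lo (hi - 1) (\<lambda>q. G (q + 1))"
    using Suc.prems(2) by (auto simp: diff_bounded_def fdiff_funpow_shift)
  have "\<bar>(fdiff ^^ i) (\<lambda>q. fdiff F q * G (q + 1)) q\<bar> \<le> M * h * M' * (h + h') ^ i"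
    using Suc.prems by (intro Suc.IH[OF dF G]) auto
  moreover have "\<bar>(fdiff ^^ i) (\<lambda>q. F q * fdiff G q) q\<bar> \<le> M * (M' * h') * (h + h') ^ i"
    using Suc.prems by (intro Suc.IH[OF F dG]) auto
  moreover have "M * h * M' * (h + h') ^ i + M * (M' * h') * (h + h') ^ i = M * M' * (h + h') ^ Suc i"
    by (simp add: algebra_simps)
  ultimately show ?case
    unfolding fdiff_funpow_Suc eq fdiff_funpow_add by linarith
qed

lemma diff_bounded_mult:
  assumes "diff_bounded m M h lo hi F" "diff_bounded m M' h' lo hi G"
    and "0 \<le> M" "0 \<le> M'" "0 \<le> h" "0 \<le> h'"
  shows "diff_bounded m (M * M') (h + h') lo hi (\<lambda>q. F q * G q)"
  unfolding diff_bounded_def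
proof (intro allI impI)
  fix i q assume i: "i \<le> m" "lo \<le> q \<and> q + int i \<le> hi"
  have "diff_bounded i M h lo hi F" "diff_bounded i M' h' lo hi G"
    using assms(1,2) i(1) by (auto simp: diff_bounded_def)
  then show "\<bar>(fdiff ^^ i) (\<lambda>q. F q * G q) q\<bar> \<le> M * M' * (h + h') ^ i"
    using assms i by (intro fdiff_mult_bound) auto
qed

lemma diff_bounded_linear:
  assumes "\<And>q. lo \<le> q \<Longrightarrow> q \<le> hi \<Longrightarrow> \<bar>\<alpha> + t * real_of_int q\<bar> \<le> X" "\<bar>t\<bar> \<le> X * h" "0 \<le> h" "0 \<le> X"
  shows "diff_bounded m X h lo hi (\<lambda>q. \<alpha> + t * real_of_int q)"
  unfolding diff_bounded_def
proof (intro allI impI)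
  fix i q assume i: "i \<le> m" "lo \<le> q \<and> q + int i \<le> hi"
  have d: "fdiff (\<lambda>q. \<alpha> + t * real_of_int q) = (\<lambda>_. t)" by (auto simp: fdiff_def algebra_simps)
  consider "i = 0" | "i = 1" | j where "i = Suc (Suc j)" by (metis One_nat_def nat.exhaust)
  then show "\<bar>(fdiff ^^ i) (\<lambda>q. \<alpha> + t * real_of_int q) q\<bar> \<le> X * h ^ i"
  proof cases
    case 1 then show ?thesis using assms(1)[of q] i by simp
  next
    case 2 then show ?thesis using d assms(2) by simp
  next
    case 3
    have "fdiff (\<lambda>_. t) = (\<lambda>_. 0)" by (auto simp: fdiff_def)
    then have "(fdiff ^^ i) (\<lambda>q. \<alpha> + t * real_of_int q) q = (fdiff ^^ j) (\<lambda>_. 0) q"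
      unfolding 3 fdiff_funpow_Suc d by simp
    also have "\<dots> = 0" by (rule fdiff_funpow_eq_0) simp
    finally show ?thesis using assms by simp
  qed
qed

text \<open>Truncated powers are the building blocks of the weights: they vanish on a half line and
  have \<open>B - 1\<close> continuous derivatives, which is enough because only a number of
  differences depending on \<delta> is ever taken.\<close>

lemma has_derivative_max_power:
  assumes "B \<ge> 2"
  shows "((\<lambda>x::real. max 0 x ^ B) has_real_derivative real B * max 0 x ^ (B - 1)) (at x)"
proof -
  consider "x > 0" | "x < 0" | "x = 0" by linarith
  then show ?thesis
  proof cases
    case 1
    have "((\<lambda>x::real. x ^ B) has_real_derivative real B * x ^ (B - 1)) (at x)"
      by (auto intro!: derivative_eq_intros)
    then have "((\<lambda>x::real. max 0 x ^ B) has_real_derivative real B * x ^ (B - 1)) (at x)"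
      by (rule has_field_derivative_transform_within_open[of _ _ _ "{0<..}"]) (use 1 in auto)
    then show ?thesis using 1 by simp
  next
    case 2
    have "((\<lambda>x::real. 0) has_real_derivative 0) (at x)" by simp
    then have "((\<lambda>x::real. max 0 x ^ B) has_real_derivative 0) (at x)"
      by (rule has_field_derivative_transform_within_open[of _ _ _ "{..<0}"]) (use 2 assms in auto)
    moreover have "real B * max 0 x ^ (B - 1) = 0" using 2 assms by (simp add: max_def power_0_left)
    ultimately show ?thesis by (simp only:)
  next
    case 3
    have "max 0 z ^ B - max 0 0 ^ B = max 0 z ^ (B - 1) * (z - 0)" for z :: real
      using assms by (cases "z > 0") (auto simp: max_def power_eq_if[of _ B])
    moreover have "isCont (\<lambda>z::real. max 0 z ^ (B - 1)) 0" by (intro continuous_intros)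
    ultimately show ?thesis unfolding 3 using assms
      by (subst CARAT_DERIV) (intro exI[of _ "\<lambda>z. max 0 z ^ (B - 1)"], auto)
  qed
qed

text \<open>Integer differences along \<open>q \<mapsto> \<alpha> + t q\<close> become differences
  with real step \<open>t\<close>, and these can be bounded by differentiating in
  \<open>x\<close>.\<close>

definition rdiff :: "real \<Rightarrow> (real \<Rightarrow> real) \<Rightarrow> real \<Rightarrow> real" where
  "rdiff t F x = F (x + t) - F x"

lemma rdiff_funpow_deriv:
  assumes "\<And>x. (F has_real_derivative F' x) (at x)"
  shows "((rdiff t ^^ i) F has_real_derivative (rdiff t ^^ i) F' x) (at x)"
proof (induction i arbitrary: x)
  case (Suc i)
  have "((\<lambda>x. (rdiff t ^^ i) F (x + t)) has_real_derivative (rdiff t ^^ i) F' (x + t)) (at x)"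
    using Suc[of "x + t"] by (simp add: DERIV_shift)
  from DERIV_diff[OF this Suc[of x]] show ?case
    by (simp add: rdiff_def[abs_def])
qed (use assms in auto)

lemma rdiff_funpow_cmult: "(rdiff t ^^ i) (\<lambda>x. c * F x) x = c * (rdiff t ^^ i) F x"
  by (induction i arbitrary: x) (auto simp: rdiff_def right_diff_distrib)

text \<open>By the mean value inequality one difference costs \<open>\<bar>t\<bar>\<close> times the
  derivative of the remaining ones. Differentiation lowers \<open>B\<close> by one, whence
  \<open>i < B\<close>, and \<open>1 \<le> X\<close> lets the lower power of \<open>X\<close> be
  replaced by \<open>X ^ B\<close>.\<close>

lemma rdiff_max_power_bound:
  assumes "i < B" "\<And>j. j \<le> i \<Longrightarrow> x + real j * t \<le> X" "1 \<le> X"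
  shows "\<bar>(rdiff t ^^ i) (\<lambda>x. max 0 x ^ B) x\<bar> \<le> (real B * \<bar>t\<bar>) ^ i * X ^ B"
  using assms
proof (induction i arbitrary: B x)
  case 0
  have "max 0 x ^ B \<le> X ^ B" using 0(2)[of 0] 0 by (intro power_mono) auto
  then show ?case by simp
next
  case (Suc i)
  have B2: "B \<ge> 2" using Suc by simp
  define D where "D y = real B * (rdiff t ^^ i) (\<lambda>x. max 0 x ^ (B - 1)) y" for y
  have der: "((rdiff t ^^ i) (\<lambda>x. max 0 x ^ B) has_real_derivative D y) (at y)" for y
    using rdiff_funpow_deriv[OF has_derivative_max_power[OF B2], where t = t and i = i and x = y]
    by (simp add: rdiff_funpow_cmult D_def)
  have bd: "norm (D y) \<le> real B * ((real B * \<bar>t\<bar>) ^ i * X ^ B)" if y: "y \<in> closed_segment x (x + t)" for y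
  proof -
    obtain u where u: "0 \<le> u" "u \<le> 1" "y = (1 - u) * x + u * (x + t)"
      using y by (auto simp: in_segment)
    have "\<bar>(rdiff t ^^ i) (\<lambda>x. max 0 x ^ (B - 1)) y\<bar> \<le> (real (B - 1) * \<bar>t\<bar>) ^ i * X ^ (B - 1)"
    proof (rule Suc.IH)
      fix j assume j: "j \<le> i"
      have 1: "x + real j * t \<le> X" "x + real (Suc j) * t \<le> X"
        using j Suc.prems(2)[of j] Suc.prems(2)[of "Suc j"] by auto
      have "y + real j * t = (1 - u) * (x + real j * t) + u * (x + real (Suc j) * t)"
        unfolding u by (simp add: algebra_simps)
      also have "\<dots> \<le> (1 - u) * X + u * X" using u 1 by (intro add_mono mult_left_mono) auto
      finally show "y + real j * t \<le> X" by (simp add: algebra_simps)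
    qed (use Suc.prems in auto)
    also have "\<dots> \<le> (real B * \<bar>t\<bar>) ^ i * X ^ B"
      using Suc.prems(3) B2 by (intro mult_mono power_mono power_increasing mult_right_mono) auto
    finally show ?thesis unfolding D_def using B2 by (simp add: abs_mult)
  qed
  have "norm ((rdiff t ^^ i) (\<lambda>x. max 0 x ^ B) (x + t) - (rdiff t ^^ i) (\<lambda>x. max 0 x ^ B) x)
      \<le> real B * ((real B * \<bar>t\<bar>) ^ i * X ^ B) * norm (x + t - x)"
    by (rule field_differentiable_bound[of "closed_segment x (x + t)" _ D])
      (use der bd in \<open>auto intro: has_field_derivative_at_within\<close>)
  then show ?case by (simp add: rdiff_def[of t "(rdiff t ^^ i) _"] mult_ac)
qed

lemma fdiff_funpow_affine:
  "(fdiff ^^ i) (\<lambda>q. \<psi> (\<alpha> + t * real_of_int q)) q = (rdiff t ^^ i) \<psi> (\<alpha> + t * real_of_int q)"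
  by (induction i arbitrary: q) (auto simp: fdiff_def rdiff_def algebra_simps)

lemma diff_bounded_max_power:
  assumes "\<And>q. lo \<le> q \<Longrightarrow> q \<le> hi \<Longrightarrow> \<alpha> + t * real_of_int q \<le> X" "1 \<le> X" "m < B"
  shows "diff_bounded m (X ^ B) (real B * \<bar>t\<bar>) lo hi (\<lambda>q. max 0 (\<alpha> + t * real_of_int q) ^ B)"
  unfolding diff_bounded_def
proof (intro allI impI)
  fix i q assume i: "i \<le> m" "lo \<le> q \<and> q + int i \<le> hi"
  have "\<bar>(rdiff t ^^ i) (\<lambda>x. max 0 x ^ B) (\<alpha> + t * real_of_int q)\<bar> \<le> (real B * \<bar>t\<bar>) ^ i * X ^ B"
  proof (rule rdiff_max_power_bound)
    fix j assume "j \<le> i"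
    then show "\<alpha> + t * real_of_int q + real j * t \<le> X"
      using assms(1)[of "q + int j"] i by (simp add: algebra_simps)
  qed (use assms i in auto)
  then show "\<bar>(fdiff ^^ i) (\<lambda>q. max 0 (\<alpha> + t * real_of_int q) ^ B) q\<bar> \<le> X ^ B * (real B * \<bar>t\<bar>) ^ i"
    using fdiff_funpow_affine[of i "\<lambda>x. max 0 x ^ B" \<alpha> t q] by (simp add: mult.commute)
qed

section \<open>The weights in \<open>q\<close> and \<open>n\<close>\<close>

definition bump :: "nat \<Rightarrow> real \<Rightarrow> real" where
  "bump B x = max 0 (x - 1 / 2) ^ B * max 0 (1 - x) ^ B"

text \<open>On \<open>[-1, 1]\<close> this is \<open>x (1 - x^2)^B\<close>. The factor
  \<open>x\<close> makes it odd, as the duality requires, and the elementary primitive gives the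
  mean \<open>1 / (2 (B + 1))\<close> over \<open>[0, 1]\<close>.\<close>

definition wave :: "nat \<Rightarrow> real \<Rightarrow> real" where
  "wave B x = x * max 0 (1 - x) ^ B * max 0 (1 + x) ^ B"

lemma bump_nonneg: "0 \<le> bump B x"
  by (simp add: bump_def)

lemma bump_eq_0: "B \<ge> 1 \<Longrightarrow> x \<le> 1 / 2 \<or> x \<ge> 1 \<Longrightarrow> bump B x = 0"
  by (auto simp: bump_def max_def power_0_left)

lemma bump_le_1: "B \<ge> 1 \<Longrightarrow> bump B x \<le> 1"
proof (cases "x \<le> 1 / 2 \<or> x \<ge> 1")
  case False
  then have "max 0 (x - 1 / 2) ^ B \<le> 1" "max 0 (1 - x) ^ B \<le> 1" by (auto intro!: power_le_one)
  then show ?thesis unfolding bump_def by (intro mult_le_one) auto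
qed (simp add: bump_eq_0)

lemma wave_minus: "wave B (- x) = - wave B x"
  by (simp add: wave_def)

lemma wave_0 [simp]: "wave B 0 = 0"
  by (simp add: wave_def)

lemma wave_eq_0: "B \<ge> 1 \<Longrightarrow> \<bar>x\<bar> \<ge> 1 \<Longrightarrow> wave B x = 0"
  by (auto simp: wave_def max_def power_0_left)

lemma wave_unit: "0 \<le> x \<Longrightarrow> x \<le> 1 \<Longrightarrow> wave B x = x * (1 - x\<^sup>2) ^ B"
proof -
  assume x: "0 \<le> x" "x \<le> 1"
  then have "max 0 (1 - x) = 1 - x" "max 0 (1 + x) = 1 + x" by auto
  moreover have "(1 - x) * (1 + x) = 1 - x\<^sup>2" by (simp add: power2_eq_square algebra_simps)
  ultimately show ?thesis by (simp add: wave_def mult.assoc flip: power_mult_distrib)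
qed

lemma wave_nonneg: "0 \<le> x \<Longrightarrow> 0 \<le> wave B x"
  by (simp add: wave_def)

lemma wave_le_1: "0 \<le> x \<Longrightarrow> x \<le> 1 \<Longrightarrow> wave B x \<le> 1"
  by (subst wave_unit) (auto intro!: mult_le_one power_le_one simp: power_le_one)

lemma abs_wave_le_1: "\<bar>x\<bar> \<le> 1 \<Longrightarrow> \<bar>wave B x\<bar> \<le> 1"
  using wave_le_1[of x B] wave_le_1[of "- x" B] wave_nonneg[of x B] wave_nonneg[of "- x" B]
  by (cases "x \<ge> 0") (auto simp: wave_minus)

lemma has_derivative_wave_primitive:
  "((\<lambda>x. - ((1 - x\<^sup>2) ^ (B + 1)) / (2 * (real B + 1))) has_real_derivative x * (1 - x\<^sup>2) ^ B) (at x)"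
proof -
  have "((\<lambda>x. 1 - x\<^sup>2) has_real_derivative - 2 * x) (at x)"
    by (auto intro!: derivative_eq_intros)
  from DERIV_cdivide[OF DERIV_minus[OF DERIV_power[OF this, of "Suc B"]], of "2 * (real B + 1)"]
  show ?thesis unfolding Suc_eq_plus1[symmetric] by (rule DERIV_cong) (auto simp: field_simps)
qed

lemma wave_lipschitz:
  assumes "0 \<le> x" "x \<le> 1" "0 \<le> y" "y \<le> 1"
  shows "\<bar>wave B x - wave B y\<bar> \<le> (2 * real B + 1) * \<bar>x - y\<bar>"
proof -
  let ?f' = "\<lambda>x::real. (1 - x\<^sup>2) ^ B - x * (real B * (2 * x) * (1 - x\<^sup>2) ^ (B - 1))"
  have "norm ((\<lambda>x. x * (1 - x\<^sup>2) ^ B) x - (\<lambda>x. x * (1 - x\<^sup>2) ^ B) y) \<le> (2 * real B + 1) * norm (x - y)"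
  proof (rule field_differentiable_bound[of "{0..1}" _ ?f'])
    fix z :: real assume z: "z \<in> {0..1}"
    show "((\<lambda>x. x * (1 - x\<^sup>2) ^ B) has_real_derivative ?f' z) (at z within {0..1})"
      by (auto intro!: derivative_eq_intros)
    have "\<bar>(1 - z\<^sup>2) ^ B\<bar> \<le> 1" "\<bar>(1 - z\<^sup>2) ^ (B - 1)\<bar> \<le> 1"
      using z by (auto simp: power_abs intro!: power_le_one simp: abs_square_le_1 power_le_one)
    moreover from this(2) have "\<bar>z * (real B * (2 * z) * (1 - z\<^sup>2) ^ (B - 1))\<bar> \<le> 1 * (real B * (2 * 1) * 1)"
      unfolding abs_mult using z by (intro mult_mono mult_nonneg_nonneg) auto
    ultimately show "norm (?f' z) \<le> 2 * real B + 1"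
      unfolding real_norm_def by linarith
  qed (use assms in auto)
  then show ?thesis using assms by (simp add: wave_unit)
qed

lemma sum_multiples:
  fixes g :: "nat \<Rightarrow> real"
  assumes "s > 0"
  shows "(\<Sum>m=1..n. if s dvd m then g m else 0) = (\<Sum>j=1..n div s. g (s * j))"
proof -
  have "(\<Sum>m=1..n. if s dvd m then g m else 0) = (\<Sum>m\<in>{m\<in>{1..n}. s dvd m}. g m)"
    by (rule sum.inter_filter[symmetric]) simp
  also have "\<dots> = (\<Sum>j=1..n div s. g (s * j))"
    using assms
    by (intro sum.reindex_bij_witness[of _ "\<lambda>j. s * j" "\<lambda>m. m div s"])
       (auto simp: less_eq_div_iff_mult_less_eq mult.commute div_le_mono Suc_le_eq dvd_imp_le div_greater_zero_iff)
  finally show ?thesis .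
qed

text \<open>A Riemann sum with step \<open>t = s / N\<close>. Each step deviates from the primitive
  \<open>H\<close> by at most \<open>(2 B + 1) t^2\<close>, there are at most \<open>1 / t\<close>
  steps, and the incomplete last interval costs at most \<open>t\<close>; division by
  \<open>t\<close> leaves an error bounded uniformly in \<open>s\<close>.\<close>

lemma sum_wave_multiples:
  fixes s N :: nat
  assumes "s > 0" "N > 0"
  shows "\<bar>(\<Sum>m=1..N. if s dvd m then wave B (m / N) else 0) - N / s / (2 * (real B + 1))\<bar> \<le> 2 * real B + 2"
proof -
  define t where "t = real s / real N"
  define M where "M = N div s"
  define H where "H x = - ((1 - x\<^sup>2) ^ (B + 1)) / (2 * (real B + 1))" for x :: real
  let ?D = "\<Sum>m=1..N. if s dvd m then wave B (m / N) else 0"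
  have t: "t > 0" using assms by (simp add: t_def)
  have D: "?D = (\<Sum>j\<in>{1..M}. wave B (t * real j))"
    unfolding M_def by (rule trans[OF sum_multiples[OF assms(1)]], rule sum.cong[OF refl]) (simp add: t_def)
  have Mt: "t * real M \<le> 1" "1 \<le> t * (real M + 1)"
  proof -
    have "real s * real M \<le> N" unfolding M_def by (metis of_nat_le_iff of_nat_mult times_div_less_eq_dividend)
    then show "t * real M \<le> 1" using assms by (simp add: t_def field_simps)
    have "N / s - 1 \<le> M" unfolding M_def by (rule real_div_nat_ge[OF assms(1)])
    then show "1 \<le> t * (real M + 1)" using assms by (simp add: t_def field_simps)
  qed
  have H': "(H has_real_derivative x * (1 - x\<^sup>2) ^ B) (at x)" for x
    using has_derivative_wave_primitive[of B x] unfolding H_def[abs_def] .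
  have step: "\<bar>H x - H y - (x - y) * wave B x\<bar> \<le> (2 * real B + 1) * (x - y)\<^sup>2"
    if xy: "0 \<le> y" "y < x" "x \<le> 1" for x y :: real
  proof -
    from MVT2[of y x H "\<lambda>x. x * (1 - x\<^sup>2) ^ B", OF xy(2) H']
    obtain z where z: "y < z" "z < x" "H x - H y = (x - y) * (z * (1 - z\<^sup>2) ^ B)" by blast
    have "H x - H y - (x - y) * wave B x = (x - y) * (wave B z - wave B x)"
      using z xy by (simp add: wave_unit algebra_simps)
    also have "\<bar>\<dots>\<bar> \<le> (x - y) * ((2 * real B + 1) * \<bar>z - x\<bar>)"
    proof -
      have "\<bar>wave B z - wave B x\<bar> \<le> (2 * real B + 1) * \<bar>z - x\<bar>" using xy z by (intro wave_lipschitz) auto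
      then show ?thesis unfolding abs_mult using xy by (simp add: mult_left_mono)
    qed
    also have "\<dots> \<le> (x - y) * ((2 * real B + 1) * (x - y))"
      using xy z by (intro mult_left_mono) auto
    finally show ?thesis by (simp add: power2_eq_square mult_ac)
  qed
  have ind: "\<bar>t * (\<Sum>j\<in>{1..m}. wave B (t * real j)) - (H (t * m) - H 0)\<bar> \<le> m * ((2 * real B + 1) * t\<^sup>2)" if "m \<le> M" for m :: nat
    using that
  proof (induction m)
    case (Suc m)
    have "t * real (Suc m) \<le> t * real M" using Suc.prems t by (intro mult_left_mono) auto
    then have "t * real (Suc m) \<le> 1" using Mt by linarith
    then have "\<bar>H (t * Suc m) - H (t * m) - t * wave B (t * Suc m)\<bar> \<le> (2 * real B + 1) * t\<^sup>2"
      using step[of "t * m" "t * Suc m"] t by (simp add: algebra_simps)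
    moreover have "\<bar>t * (\<Sum>j\<in>{1..m}. wave B (t * real j)) - (H (t * m) - H 0)\<bar> \<le> m * ((2 * real B + 1) * t\<^sup>2)"
      using Suc by simp
    moreover have "t * (\<Sum>j\<in>{1..Suc m}. wave B (t * real j)) = t * (\<Sum>j\<in>{1..m}. wave B (t * real j)) + t * wave B (t * Suc m)"
      by (simp add: distrib_left)
    moreover have "real (Suc m) * ((2 * real B + 1) * t\<^sup>2) = m * ((2 * real B + 1) * t\<^sup>2) + (2 * real B + 1) * t\<^sup>2"
      by (simp add: algebra_simps)
    ultimately show ?case by linarith
  qed simp
  have "\<bar>t * ?D - (H (t * M) - H 0)\<bar> \<le> M * ((2 * real B + 1) * t\<^sup>2)"
    using ind[of M] D by simp
  also have "\<dots> = (t * M) * ((2 * real B + 1) * t)" by (simp add: power2_eq_square)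
  also have "\<dots> \<le> 1 * ((2 * real B + 1) * t)" using Mt t by (intro mult_right_mono) auto
  finally have 1: "\<bar>t * ?D - (H (t * M) - H 0)\<bar> \<le> (2 * real B + 1) * t" by simp
  have 2: "\<bar>H (t * M)\<bar> \<le> t"
  proof (cases "t * M = 1")
    case True
    then show ?thesis using t by (simp add: H_def)
  next
    case False
    then have l: "t * M < 1" "0 \<le> t * M" using Mt t by auto
    from MVT2[of "t * M" 1 H "\<lambda>x. x * (1 - x\<^sup>2) ^ B", OF l(1) H']
    obtain z where z: "t * M < z" "z < 1" "H 1 - H (t * M) = (1 - t * M) * (z * (1 - z\<^sup>2) ^ B)" by blast
    have "\<bar>H (t * M)\<bar> = \<bar>(1 - t * M) * wave B z\<bar>"
      using z l by (simp add: wave_unit H_def)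
    also have "\<dots> \<le> (1 - t * M) * 1" unfolding abs_mult using z l by (intro mult_mono abs_wave_le_1) auto
    also have "\<dots> \<le> t" using Mt by (simp add: algebra_simps)
    finally show ?thesis .
  qed
  have H0: "H 0 = - (1 / (2 * (real B + 1)))" by (simp add: H_def)
  have "\<bar>t * ?D - 1 / (2 * (real B + 1))\<bar> \<le> (2 * real B + 1) * t + t" using 1 2 unfolding H0 by linarith
  also have "\<dots> = t * (2 * real B + 2)" by (simp add: algebra_simps)
  also have "t * ?D - 1 / (2 * (real B + 1)) = t * (?D - N / s / (2 * (real B + 1)))"
    using assms by (simp add: t_def right_diff_distrib)
  finally show ?thesis using t by (simp add: abs_mult)
qed

text \<open>For \<open>5/8 Q \<le> q \<le> 7/8 Q\<close> both factors of the bump have base at least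
  \<open>1/8\<close>, and for \<open>Q \<ge> 8\<close> there are at least
  \<open>Q / 4 - 1 \<ge> Q / 8\<close> such \<open>q\<close>.\<close>

lemma sum_bump_ge:
  assumes "Q \<ge> 8"
  shows "(1 / 8) ^ (2 * B) / 8 * Q \<le> (\<Sum>q=1..nat \<lfloor>Q\<rfloor>. bump B (q / Q))"
proof -
  let ?S = "{nat \<lceil>5 / 8 * Q\<rceil>..nat \<lfloor>7 / 8 * Q\<rfloor>}"
  have S: "5 / 8 * Q \<le> real q" "real q \<le> 7 / 8 * Q" if "q \<in> ?S" for q
    using that assms by (auto simp: nat_le_iff ceiling_le_iff le_nat_iff le_floor_iff)
  have "Q / 8 \<le> Q / 4 - 1" using assms by simp
  also have "\<dots> \<le> real (card ?S)"
  proof -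
    have "real (nat \<lfloor>7 / 8 * Q\<rfloor>) > 7 / 8 * Q - 1" "real (nat \<lceil>5 / 8 * Q\<rceil>) < 5 / 8 * Q + 1"
      using assms by linarith+
    then show ?thesis by (simp add: of_nat_diff_real)
  qed
  finally have c: "Q / 8 \<le> real (card ?S)" .
  have "(1 / 8) ^ (2 * B) / 8 * Q = (1 / 8) ^ (2 * B) * (Q / 8)" by simp
  also have "\<dots> \<le> (1 / 8) ^ (2 * B) * real (card ?S)" using c by (intro mult_left_mono) auto
  also have "\<dots> = (\<Sum>q\<in>?S. (1 / 8) ^ B * (1 / 8) ^ B)" by (simp add: mult_2 power_add)
  also have "\<dots> \<le> (\<Sum>q\<in>?S. bump B (q / Q))"
  proof (rule sum_mono)
    fix q assume "q \<in> ?S"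
    from S[OF this] have "1 / 8 \<le> q / Q - 1 / 2" "1 / 8 \<le> 1 - q / Q"
      using assms by (auto simp: field_simps)
    then show "(1 / 8) ^ B * (1 / 8) ^ B \<le> bump B (q / Q)"
      unfolding bump_def by (intro mult_mono power_mono) (auto simp: le_max_iff_disj)
  qed
  also have "\<dots> \<le> (\<Sum>q=1..nat \<lfloor>Q\<rfloor>. bump B (q / Q))"
  proof (rule sum_mono2)
    show "?S \<subseteq> {1..nat \<lfloor>Q\<rfloor>}"
    proof
      fix q assume "q \<in> ?S"
      from S[OF this] have "1 \<le> real q" "real q \<le> Q" using assms by auto
      then show "q \<in> {1..nat \<lfloor>Q\<rfloor>}" by (auto simp: le_nat_floor)
    qed
  qed (auto simp: bump_nonneg)
  finally show ?thesis .
qed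

text \<open>The weight is a product of five factors in \<open>q\<close>: one affine, four truncated
  powers of affine functions. All slopes are at most \<open>4 / Q\<close>, by the bound on
  \<open>k\<close>, and all arguments at most \<open>1 + 1 + 8 = 10\<close>. The Leibniz rule adds
  the five scales \<open>4 B / Q\<close> and multiplies the five bounds
  \<open>10 ^ B\<close>.\<close>

lemma diff_bounded_weight:
  fixes Q N :: real and n k :: int
  assumes "Q \<ge> 1" "N > 0" "\<bar>real_of_int n\<bar> \<le> N" "\<bar>real_of_int k\<bar> * Q \<le> 4 * N" "A < B"
  shows "diff_bounded A (10 ^ (5 * B)) (20 * real B / Q) 0 \<lfloor>2 * Q\<rfloor>
           (\<lambda>q. bump B (q / Q) * wave B (real_of_int (n + k * q) / N))"
proof -
  define D where "D F \<longleftrightarrow> diff_bounded A (10 ^ B) (4 * real B / Q) 0 \<lfloor>2 * Q\<rfloor> F" for F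
  have kN: "\<bar>k\<bar> / N \<le> 4 / Q" using assms by (simp add: field_simps)
  have q2: "0 \<le> real_of_int q / Q" "real_of_int q / Q \<le> 2" if "0 \<le> q" "q \<le> \<lfloor>2 * Q\<rfloor>" for q
    using that assms by (auto simp: le_floor_iff field_simps)
  have nkq: "\<bar>real_of_int n / N\<bar> \<le> 1" "\<bar>k / N * real_of_int q\<bar> \<le> 8" if "0 \<le> q" "q \<le> \<lfloor>2 * Q\<rfloor>" for q
  proof -
    show "\<bar>real_of_int n / N\<bar> \<le> 1" using assms by simp
    have "\<bar>k / N * real_of_int q\<bar> = \<bar>k\<bar> / N * real_of_int q" using that assms by (simp add: abs_mult)
    also have "\<dots> \<le> 4 / Q * (2 * Q)"
      using kN that assms by (intro mult_mono) (auto simp: le_floor_iff)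
    also have "\<dots> = 8" using assms by simp
    finally show "\<bar>k / N * real_of_int q\<bar> \<le> 8" .
  qed
  have power: "D (\<lambda>q. max 0 (\<alpha> + t * real_of_int q) ^ B)"
    if "\<And>q. 0 \<le> q \<Longrightarrow> q \<le> \<lfloor>2 * Q\<rfloor> \<Longrightarrow> \<alpha> + t * real_of_int q \<le> 10" "\<bar>t\<bar> \<le> 4 / Q" for \<alpha> t
  proof -
    have "real B * \<bar>t\<bar> \<le> 4 * real B / Q"
      using mult_left_mono[OF that(2), of "real B"] by (simp add: mult.commute)
    then show ?thesis
      unfolding D_def
      by (intro diff_bounded_mono[OF diff_bounded_max_power[of 0 "\<lfloor>2 * Q\<rfloor>" \<alpha> t 10 A B]])
         (use that assms in auto)
  qed
  have 1: "D (\<lambda>q. max 0 (- 1 / 2 + 1 / Q * real_of_int q) ^ B)"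
  proof (rule power)
    show "- 1 / 2 + 1 / Q * real_of_int q \<le> 10" if "0 \<le> q" "q \<le> \<lfloor>2 * Q\<rfloor>" for q
      using q2[OF that] by simp
  qed (use assms in \<open>auto simp: divide_right_mono\<close>)
  have 2: "D (\<lambda>q. max 0 (1 + (- 1 / Q) * real_of_int q) ^ B)"
  proof (rule power)
    show "1 + (- 1 / Q) * real_of_int q \<le> 10" if "0 \<le> q" "q \<le> \<lfloor>2 * Q\<rfloor>" for q
      using q2[OF that] by simp
  qed (use assms in \<open>auto simp: divide_right_mono\<close>)
  have 3: "D (\<lambda>q. n / N + k / N * real_of_int q)"
    unfolding D_def
  proof (rule diff_bounded_linear)
    have B10: "10 \<le> (10 :: real) ^ B" using assms power_increasing[of 1 B "10::real"] by simp
    show "\<bar>n / N + k / N * real_of_int q\<bar> \<le> 10 ^ B" if "0 \<le> q" "q \<le> \<lfloor>2 * Q\<rfloor>" for q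
      using nkq[OF that] B10 by linarith
    have "1 * 1 \<le> 10 ^ B * real B" using B10 assms by (intro mult_mono) auto
    then have "1 * (4 / Q) \<le> (10 ^ B * real B) * (4 / Q)" using assms by (intro mult_right_mono) auto
    moreover have "\<bar>k / N\<bar> \<le> 1 * (4 / Q)" using kN assms by simp
    ultimately have "\<bar>k / N\<bar> \<le> (10 ^ B * real B) * (4 / Q)" by linarith
    then show "\<bar>k / N\<bar> \<le> 10 ^ B * (4 * real B / Q)" by (simp add: mult_ac)
  qed (use assms in auto)
  have 4: "D (\<lambda>q. max 0 ((1 - n / N) + (- k / N) * real_of_int q) ^ B)"
  proof (rule power)
    show "1 - n / N + (- k / N) * real_of_int q \<le> 10" if "0 \<le> q" "q \<le> \<lfloor>2 * Q\<rfloor>" for q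
    proof -
      have "(- k / N) * real_of_int q = - (k / N * real_of_int q)" by simp
      then show ?thesis using nkq[OF that] by linarith
    qed
  qed (use kN assms in auto)
  have 5: "D (\<lambda>q. max 0 ((1 + n / N) + k / N * real_of_int q) ^ B)"
  proof (rule power)
    show "1 + n / N + k / N * real_of_int q \<le> 10" if "0 \<le> q" "q \<le> \<lfloor>2 * Q\<rfloor>" for q
      using nkq[OF that] by linarith
  qed (use kN assms in auto)
  have "diff_bounded A (10 ^ B * 10 ^ B * (10 ^ B * 10 ^ B * 10 ^ B)) ((4 * real B / Q + 4 * real B / Q) + (4 * real B / Q + 4 * real B / Q + 4 * real B / Q)) 0 \<lfloor>2 * Q\<rfloor>
     (\<lambda>q. (max 0 (- 1 / 2 + 1 / Q * real_of_int q) ^ B * max 0 (1 + (- 1 / Q) * real_of_int q) ^ B) *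
          ((n / N + k / N * real_of_int q) * max 0 ((1 - n / N) + (- k / N) * real_of_int q) ^ B *
          max 0 ((1 + n / N) + k / N * real_of_int q) ^ B))"
    by (intro diff_bounded_mult 1[unfolded D_def] 2[unfolded D_def] 3[unfolded D_def] 4[unfolded D_def] 5[unfolded D_def])
       (use assms(1) in simp_all)
  moreover have "(10::real) ^ B * 10 ^ B * (10 ^ B * 10 ^ B * 10 ^ B) = 10 ^ (5 * B)"
    by (simp flip: power_add)
  moreover have "(4 * real B / Q + 4 * real B / Q) + (4 * real B / Q + 4 * real B / Q + 4 * real B / Q) = 20 * real B / Q" by simp
  moreover have "(\<lambda>q. (max 0 (- 1 / 2 + 1 / Q * real_of_int q) ^ B * max 0 (1 + (- 1 / Q) * real_of_int q) ^ B) *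
          ((n / N + k / N * real_of_int q) * max 0 ((1 - n / N) + (- k / N) * real_of_int q) ^ B *
          max 0 ((1 + n / N) + k / N * real_of_int q) ^ B)) = (\<lambda>q. bump B (q / Q) * wave B (real_of_int (n + k * q) / N))"
    by (auto simp: bump_def wave_def add_divide_distrib algebra_simps)
  ultimately show ?thesis by (simp only:)
qed

lemma dvd_affine_iff_residue:
  fixes n k p :: int
  assumes "coprime k p"
  shows "\<exists>c. \<forall>q. p dvd n + k * q \<longleftrightarrow> q mod p = c mod p"
proof -
  obtain x where x: "[k * x = 1] (mod p)" using cong_solve_coprime_int[OF assms] by blast
  have "p dvd n + k * q \<longleftrightarrow> q mod p = (- n * x) mod p" for q
  proof -
    have "[k * (q - (- n * x)) = n + k * q] (mod p)"
      using cong_add[OF cong_refl[of "k * q"] cong_scalar_left[OF x, of n]] by (simp add: algebra_simps)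
    then have "p dvd n + k * q \<longleftrightarrow> p dvd k * (q - (- n * x))" by (simp add: cong_dvd_iff)
    also have "\<dots> \<longleftrightarrow> p dvd q - (- n * x)" using assms by (simp add: coprime_commute coprime_dvd_mult_right_iff)
    finally show ?thesis by (simp add: mod_eq_dvd_iff)
  qed
  then show ?thesis by blast
qed

lemma weighted_prime_indicator_sum:
  fixes Q N :: real and n k :: int and p :: nat
  assumes "Q \<ge> 1" "Q \<ge> 2 * A" "N > 0" "\<bar>real_of_int n\<bar> \<le> N" "\<bar>real_of_int k\<bar> * Q \<le> 4 * N" "A < B"
    and p: "prime p" "real p \<le> Q" "\<not> int p dvd k"
  shows "\<bar>\<Sum>q=1..\<lfloor>Q\<rfloor>. bump B (q / Q) * wave B (real_of_int (n + k * q) / N) * ((if int p dvd n + k * q then 1 else 0) - 1 / p)\<bar>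
         \<le> 4 * 10 ^ (5 * B) * (20 * real B) ^ A * (Q / p * (p / Q) ^ A)"
proof -
  define F where "F q = bump B (real_of_int q / Q) * wave B (real_of_int (n + k * q) / N)" for q :: int
  have p0: "p > 0" "int p \<ge> 1" using p(1) by (auto dest: prime_gt_0_nat)
  have B1: "B \<ge> 1" using assms by simp
  have F0: "F q = 0" if "real_of_int q \<le> Q / 2 \<or> real_of_int q \<ge> Q" for q
    unfolding F_def using that assms(1) bump_eq_0[OF B1, of "q / Q"] by (auto simp: field_simps)
  have "coprime k (int p)"
    using p by (metis coprime_commute prime_imp_coprime prime_int_nat_transfer nat_int prime_nat_int_transfer)
  then obtain c where c: "\<And>q. int p dvd n + k * q \<longleftrightarrow> q mod int p = c mod int p"
    using dvd_affine_iff_residue by blast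
  define K where "K = 10 ^ (5 * B) * (20 * real B / Q) ^ A"
  have K: "\<bar>(fdiff ^^ A) F q\<bar> \<le> K" for q
  proof (cases "0 \<le> q \<and> q + int A \<le> \<lfloor>2 * Q\<rfloor>")
    case True
    have "diff_bounded A (10 ^ (5 * B)) (20 * real B / Q) 0 \<lfloor>2 * Q\<rfloor> F"
      unfolding F_def[abs_def] by (rule diff_bounded_weight[OF assms(1,3-6)])
    from this[unfolded diff_bounded_def, rule_format, of A q] True show ?thesis by (simp add: K_def)
  next
    case False
    \<comment> \<open>Outside the window the difference uses only points outside the support
      \<open>(Q / 2, Q)\<close>: they are at most \<open>A \<le> Q / 2\<close> on the left and
      beyond \<open>2 Q - A \<ge> Q\<close> on the right.\<close>
    have "(fdiff ^^ A) F q = 0"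
    proof (rule fdiff_funpow_eq_0)
      fix j assume j: "j \<le> A"
      have "real_of_int (q + int j) \<le> Q / 2 \<or> real_of_int (q + int j) \<ge> Q"
      proof (cases "q < 0")
        case True
        then have "q + int j \<le> int A" using j by simp
        then have "real_of_int (q + int j) \<le> real A" by linarith
        then show ?thesis using assms(2) by simp
      next
        case False
        with \<open>\<not> (0 \<le> q \<and> q + int A \<le> \<lfloor>2 * Q\<rfloor>)\<close> have "\<lfloor>2 * Q\<rfloor> < q + int A" by simp
        then have "2 * Q < real_of_int q + real A" by linarith
        then show ?thesis using assms(1,2) by simp
      qed
      then show "F (q + int j) = 0" by (rule F0)
    qed
    then show ?thesis using assms(1) by (simp add: K_def)
  qed
  have K0: "K \<ge> 0" using K[of 0] by linarith
  have fl: "0 \<le> \<lfloor>Q\<rfloor>" "real_of_int \<lfloor>Q\<rfloor> \<le> Q" using assms(1) by auto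
  have supp: "F q = 0" if "q < 0 + int A \<or> q > \<lfloor>Q\<rfloor>" for q
  proof -
    have "real_of_int q \<le> Q / 2 \<or> real_of_int q \<ge> Q" using that assms(2) by linarith
    then show ?thesis by (rule F0)
  qed
  have "(\<Sum>q=1..\<lfloor>Q\<rfloor>. F q * ((if int p dvd n + k * q then 1 else 0) - 1 / p)) =
        (\<Sum>q=0..\<lfloor>Q\<rfloor>. F q * ((if int p dvd n + k * q then 1 else 0) - 1 / p))"
  proof -
    have "{0..\<lfloor>Q\<rfloor>} = insert 0 {1..\<lfloor>Q\<rfloor>}" using fl by auto
    then show ?thesis using F0[of 0] assms(1) by simp
  qed
  also have "\<dots> = (\<Sum>q=0..\<lfloor>Q\<rfloor>. if q mod int p = c mod int p then F q else 0) - (\<Sum>q=0..\<lfloor>Q\<rfloor>. F q) / real_of_int (int p)"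
    unfolding sum_divide_distrib c by (subst sum_subtractf[symmetric]) (auto intro!: sum.cong simp: algebra_simps)
  also have "\<bar>\<dots>\<bar> \<le> 2 * real p ^ A * (real_of_int \<lfloor>Q\<rfloor> / real p + 1) * K"
    using sum_residue_class_equidist[OF p0(2) fl(1) supp K, of c] by simp
  also have "\<dots> \<le> 2 * real p ^ A * (2 * (Q / p)) * K"
  proof (intro mult_right_mono mult_left_mono K0)
    have "real_of_int \<lfloor>Q\<rfloor> / real p \<le> Q / p" using fl p0 by (simp add: divide_right_mono)
    moreover have "1 \<le> Q / p" using p p0 by simp
    ultimately show "real_of_int \<lfloor>Q\<rfloor> / real p + 1 \<le> 2 * (Q / p)" by linarith
  qed auto
  also have "\<dots> = 4 * 10 ^ (5 * B) * (20 * real B) ^ A * (Q / p * (p / Q) ^ A)"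
    unfolding K_def by (simp add: power_divide field_simps)
  finally show ?thesis by (simp add: F_def)
qed

section \<open>Correlation with prime divisors\<close>

text \<open>Subtracting \<open>1 / p\<close> makes the mean over residue classes vanish, so that the
  off-diagonal terms have no main term. The argument is an integer because the test function lives
  on \<open>{-N..N}\<close>.\<close>

definition excess :: "nat set \<Rightarrow> int \<Rightarrow> real" where
  "excess S n = (\<Sum>p\<in>S. (if int p dvd n then 1 else 0) - 1 / real p)"

lemma excess_minus: "excess S (- n) = excess S n"
  by (simp add: excess_def)

lemma excess_of_nat: "excess S (int n) = (\<Sum>p\<in>S. (if p dvd n then 1 else 0) - 1 / real p)"
  by (simp add: excess_def)

text \<open>Expand the square. For \<open>p \<noteq> p'\<close> the joint count is at most
  \<open>N / (p p')\<close>, which the cross terms cancel up to rounding errors of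
  \<open>1 / p + 1 / p'\<close>; the diagonal adds \<open>N / p\<close>.\<close>

lemma turan_kubilius:
  assumes S: "finite S" "\<And>p. p \<in> S \<Longrightarrow> prime p"
  shows "(\<Sum>n=1..N. (excess S (int n))\<^sup>2) \<le> N * (\<Sum>p\<in>S. 1 / p) + 2 * (\<Sum>p\<in>S. 1 / p) * card S"
proof -
  define x where "x p n = (if p dvd n then 1 else 0) - 1 / real p" for p n :: nat
  have bound: "(\<Sum>n=1..N. x p n * x p' n) \<le> (if p = p' then N / p else 0) + (1 / p + 1 / p')"
    if "p \<in> S" "p' \<in> S" for p p'
  proof -
    have pr: "prime p" "prime p'" and pos: "p > 0" "p' > 0"
      using S(2)[OF that(1)] S(2)[OF that(2)] by (auto intro: prime_gt_0_nat)
    define J where "J = (\<Sum>n=1..N. if p dvd n \<and> p' dvd n then 1 else (0::real))"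
    have "(\<Sum>n=1..N. x p n * x p' n) = (\<Sum>n=1..N. (if p dvd n \<and> p' dvd n then 1 else 0)
        - (if p dvd n then 1 / real p' else 0) - (if p' dvd n then 1 / real p else 0) + 1 / (real p * real p'))"
      by (intro sum.cong refl) (auto simp: x_def algebra_simps)
    also have "\<dots> = J - real (N div p) * (1 / p') - real (N div p') * (1 / p) + N / (real p * real p')"
      unfolding J_def sum.distrib sum_subtractf sum_indicator_multiples[OF pos(1)] sum_indicator_multiples[OF pos(2)] by simp
    also have "\<dots> \<le> J - (N / p - 1) * (1 / p') - (N / p' - 1) * (1 / p) + N / (real p * real p')"
      using real_div_nat_ge[OF pos(1), of N] real_div_nat_ge[OF pos(2), of N] pos
      by (intro add_mono diff_mono mult_right_mono) auto
    also have "\<dots> = J - N / (real p * real p') + (1 / p + 1 / p')"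
      using pos by (simp add: field_simps)
    also have "\<dots> \<le> (if p = p' then N / p else 0) + (1 / p + 1 / p')"
    proof (cases "p = p'")
      case True
      have "J = real (N div p)" unfolding J_def True using sum_indicator_multiples[OF pos(2), where n = N and c = 1] by simp
      also have "\<dots> \<le> N / p" by (rule of_nat_div_le_of_nat)
      finally have "J \<le> N / p" .
      moreover have "0 \<le> N / (real p * real p')" by simp
      ultimately have "J - N / (real p * real p') \<le> N / p" by linarith
        then show ?thesis using True by simp
    next
      case False
      then have "coprime p p'" using pr by (simp add: primes_coprime)
      then have "(p dvd n \<and> p' dvd n) = (p * p' dvd n)" for n
        by (auto intro: divides_mult dvd_mult_left dvd_mult_right)
      then have "J = real (N div (p * p'))"
        unfolding J_def using sum_indicator_multiples[of "p * p'", where n = N and c = 1] pos by simp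
      also have "\<dots> \<le> N / real (p * p')" by (rule of_nat_div_le_of_nat)
      finally show ?thesis using False by simp
    qed
    finally show ?thesis .
  qed
  have "(\<Sum>n=1..N. (excess S (int n))\<^sup>2) = (\<Sum>n=1..N. \<Sum>p\<in>S. \<Sum>p'\<in>S. x p n * x p' n)"
    unfolding excess_of_nat power2_eq_square sum_product x_def ..
  also have "\<dots> = (\<Sum>p\<in>S. \<Sum>p'\<in>S. \<Sum>n=1..N. x p n * x p' n)"
    by (rule trans[OF sum.swap], rule sum.cong[OF refl], rule sum.swap)
  also have "\<dots> \<le> (\<Sum>p\<in>S. \<Sum>p'\<in>S. (if p = p' then N / p else 0) + (1 / p + 1 / p'))"
    by (intro sum_mono bound)
  also have "\<dots> = (\<Sum>p\<in>S. N / p + (card S * (1 / p) + (\<Sum>p'\<in>S. 1 / p')))"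
    using S(1) by (simp add: sum.distrib)
  also have "\<dots> = N * (\<Sum>p\<in>S. 1 / p) + (card S * (\<Sum>p\<in>S. 1 / p) + card S * (\<Sum>p'\<in>S. 1 / p'))"
    by (simp add: sum.distrib sum_distrib_left)
  finally show ?thesis by (simp add: algebra_simps)
qed

section \<open>Correlation of the prime power expansion with the excess\<close>

lemma sum_inverse_le: "n \<ge> 1 \<Longrightarrow> (\<Sum>m=1..n. 1 / real m) \<le> 1 + ln n"
proof (induction n rule: dec_induct)
  case (step n)
  have "ln (1 + - (1 / real (Suc n))) \<le> - (1 / real (Suc n))"
    using step by (intro ln_add_one_self_le_self2) auto
  moreover have "1 + - (1 / real (Suc n)) = real n / real (Suc n)" using step by (simp add: field_simps)
  moreover have "ln (real n / real (Suc n)) = ln n - ln (real (Suc n))"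
    using step by (intro ln_divide_pos) auto
  ultimately show ?case using step by simp
qed simp

lemma sum_prime_recip_le_ln:
  assumes "N \<ge> 1"
  shows "prime_recip 0 (real N) \<le> 1 + ln N"
proof -
  have "primes_in 0 (real N) \<subseteq> {1..N}" by (auto simp: primes_in_def)
  then have "prime_recip 0 (real N) \<le> (\<Sum>m=1..N. 1 / real m)"
    by (intro sum_mono2) auto
  then show ?thesis using sum_inverse_le[OF assms] by linarith
qed

lemma sum_proper_prime_powers_le:
  fixes N K :: nat
  assumes "N \<ge> 1"
  shows "(\<Sum>p\<in>primes_in 0 N. \<Sum>k=2..K. 1 / sqrt (real p ^ k)) \<le> 4 * (1 + ln N)"
proof -
  have "(\<Sum>p\<in>primes_in 0 N. \<Sum>k=2..K. 1 / sqrt (real p ^ k)) \<le> (\<Sum>p\<in>primes_in 0 N. 4 * (1 / real p))"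
  proof (rule sum_mono)
    fix p assume "p \<in> primes_in 0 N"
    then have p: "2 \<le> real p" by (rule primes_inD)
    define x where "x = 1 / sqrt p"
    have "4 / 3 \<le> sqrt p" using p by (intro real_le_rsqrt) (simp add: power2_eq_square)
    then have x: "0 \<le> x" "x \<le> 3 / 4" using p by (auto simp: x_def field_simps)
    have "(\<Sum>k=2..K. 1 / sqrt (real p ^ k)) = (\<Sum>k=2..K. x ^ k)"
      by (simp add: x_def real_sqrt_power power_one_over)
    also have "\<dots> \<le> 4 * x\<^sup>2" using x by (rule sum_powers_from_2_le)
    also have "x\<^sup>2 = 1 / real p" using p by (simp add: x_def power_divide)
    finally show "(\<Sum>k=2..K. 1 / sqrt (real p ^ k)) \<le> 4 * (1 / real p)" by simp
  qed
  also have "\<dots> = 4 * prime_recip 0 N" by (simp add: sum_distrib_left)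
  also have "\<dots> \<le> 4 * (1 + ln N)" using sum_prime_recip_le_ln[OF assms] by simp
  finally show ?thesis .
qed

text \<open>The diagonal \<open>p' = p\<close> gives the main term. The only other terms that are not negligible
  come from primes \<open>p' > Y\<close>, for which \<open>p p' > N\<close> may occur; these are bounded from below by
  \<open>- 1 / p\<close> times the weighted number of multiples of \<open>p'\<close>.\<close>

lemma correlation_lower_bound:
  fixes N K B :: nat and P R Y C w0 L :: real and f :: "nat \<Rightarrow> real"
  assumes N: "N \<ge> 1" and K: "K \<ge> 1" and B: "B \<ge> 1" and P: "P \<ge> 1" and RY: "R \<le> Y" "Y \<le> N" "0 \<le> Y"
    and f: "\<And>n. n \<in> {1..N} \<Longrightarrow> f n = (\<Sum>p'\<in>primes_in 0 N. \<Sum>k=1..K. if p' ^ k dvd n then 1 else 0)"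
  defines "C \<equiv> 2 * real B + 2" and "w0 \<equiv> 1 / (2 * (real B + 1))"
    and "L \<equiv> prime_recip P R"
  shows "(\<Sum>n=1..N. f n * (excess (primes_in P R) (int n) * wave B (n / N))) \<ge>
    N * w0 * L * (1 - 1 / P - prime_recip Y N)
    - C * card (primes_in P R) - 2 * C * card (primes_in 0 Y) * card (primes_in P R)
    - C * L * card (primes_in 0 N) - 8 * C * card (primes_in P R) * (sqrt N * (1 + ln N))"
proof -
  let ?S = "primes_in P R" and ?A = "primes_in 0 (real N)"
  define W where "W n = wave B (real n / real N)" for n
  have W: "0 \<le> W n" "n \<le> N \<Longrightarrow> W n \<le> 1" for n
    using N by (auto simp: W_def intro!: wave_nonneg wave_le_1)
  have C: "C \<ge> 2" unfolding C_def by simp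
  have w0: "w0 \<ge> 0" unfolding w0_def by simp
  define D where "D s = (\<Sum>n=1..N. if s dvd n then W n else 0)" for s
  have D: "\<bar>D s - N * w0 / s\<bar> \<le> C" "0 \<le> D s" "D s \<le> N / s" if "s > 0" for s
  proof -
    show "\<bar>D s - N * w0 / s\<bar> \<le> C"
    proof -
      have "real N * w0 / real s = real N / real s / (2 * (real B + 1))" by (simp add: w0_def)
      then show ?thesis using sum_wave_multiples[OF that, of N B] N unfolding D_def W_def C_def by simp
    qed
    show "0 \<le> D s" unfolding D_def using W by (intro sum_nonneg) auto
    have "D s \<le> (\<Sum>n=1..N. if s dvd n then 1 else 0)"
      unfolding D_def using W(2) by (intro sum_mono) auto
    also have "\<dots> \<le> N / s" using sum_indicator_multiples[OF that, where n = N and c = 1] of_nat_div_le_of_nat[of N s, where ?'a = real] by simp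
    finally show "D s \<le> N / s" .
  qed
  define T where "T s p = (\<Sum>n=1..N. (if s dvd n then 1 else 0) * (((if p dvd n then 1 else 0) - 1 / real p) * W n))" for s p
  have T_div: "T s p = (1 - 1 / p) * D s" if "p dvd s" for s p
  proof -
    have "T s p = (\<Sum>n=1..N. (1 - 1 / p) * (if s dvd n then W n else 0))"
      unfolding T_def using that by (intro sum.cong refl) (auto dest: dvd_trans)
    then show ?thesis by (simp add: D_def sum_distrib_left)
  qed
  have T_cop: "T s p = D (s * p) - D s / p" if "coprime s p" for s p
  proof -
    have "(s dvd n \<and> p dvd n) = (s * p dvd n)" for n
      using that by (auto intro: divides_mult dvd_mult_left dvd_mult_right)
    then have "T s p = (\<Sum>n=1..N. (if s * p dvd n then W n else 0) - (if s dvd n then W n else 0) / p)"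
      unfolding T_def by (intro sum.cong refl) (auto simp: algebra_simps)
    then show ?thesis by (simp add: D_def sum_subtractf sum_divide_distrib)
  qed
  \<comment> \<open>The first bound serves \<open>p' \<le> Y\<close>, the first two together serve
    the higher prime powers. The third serves \<open>p' > Y\<close>: there \<open>s p\<close> may
    exceed \<open>N\<close>, so \<open>D (s * p)\<close> is only bounded below by 0.\<close>
  have T_cop_bounds: "\<bar>T s p\<bar> \<le> 2 * C" "\<bar>T s p\<bar> \<le> N / s" "T s p \<ge> - (N * w0 / s + C) / p"
    if "coprime s p" "s > 0" "p > 0" for s p
  proof -
    have p1: "1 / real p \<le> 1" "0 \<le> 1 / real p" using that by auto
    have sp: "s * p > 0" using that by simp
    have eq: "N * w0 / real (s * p) = N * w0 / s * (1 / p)" by simp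
    have a: "\<bar>D (s * p) - N * w0 / real (s * p)\<bar> \<le> C" "\<bar>D s - N * w0 / s\<bar> \<le> C" using D(1) that sp by blast+
    have "\<bar>(D s - N * w0 / s) * (1 / p)\<bar> \<le> C * 1"
      unfolding abs_mult using a(2) p1 C by (intro mult_mono) auto
    moreover have "(D s - N * w0 / s) * (1 / p) = D s / p - N * w0 / real (s * p)"
      by (simp add: diff_divide_distrib)
    ultimately have b: "\<bar>D s / p - N * w0 / real (s * p)\<bar> \<le> C" by (simp only: mult_1_right)
    show "\<bar>T s p\<bar> \<le> 2 * C" 
      unfolding T_cop[OF that(1)]
      using abs_triangle_ineq4[of "D (s * p) - N * w0 / real (s * p)" "D s / p - N * w0 / real (s * p)"] a(1) b
      by simp
    have "D s / p = D s * (1 / p)" by simp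
    also have "\<dots> \<le> N / s * 1" using D(2,3)[OF that(2)] p1 by (intro mult_mono) auto
    finally have b: "D s / p \<le> N / s" by simp
    have "N / real (s * p) = N / s * (1 / p)" by simp
    also have "\<dots> \<le> N / s * 1" using p1 by (intro mult_left_mono) auto
    finally have c: "D (s * p) \<le> N / s" using D(3)[OF sp] by simp
    have "0 \<le> D s / p" using D(2)[OF that(2)] by simp
    then show "\<bar>T s p\<bar> \<le> N / s" unfolding T_cop[OF that(1)] using b c D(2)[OF sp] by linarith
    have "D s / p \<le> (N * w0 / s + C) / p" using a(2) by (intro divide_right_mono) auto
    moreover have "- (N * w0 / s + C) / p = - ((N * w0 / s + C) / p)" by (rule minus_divide_left[symmetric])
    ultimately show "T s p \<ge> - (N * w0 / s + C) / p" unfolding T_cop[OF that(1)] using D(2)[OF sp] by linarith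
  qed
  have high: "(\<Sum>p'\<in>?A. \<Sum>k=2..K. T (p' ^ k) p) \<ge> - 8 * C * (sqrt N * (1 + ln N))" if p: "p \<in> ?S" for p
  proof -
    have "T (p' ^ k) p \<ge> - (2 * C * (sqrt N * (1 / sqrt (real p' ^ k))))" if p': "p' \<in> ?A" and k: "k \<in> {2..K}" for p' k
    proof (cases "p' = p")
      case True
      then have "T (p' ^ k) p = (1 - 1 / p) * D (p' ^ k)" using k by (intro T_div) auto
      moreover have "0 \<le> (1 - 1 / p) * D (p' ^ k)"
        using primes_inD[OF p] primes_inD[OF p'] D(2)[of "p' ^ k"] by (intro mult_nonneg_nonneg) auto
      moreover have "0 \<le> 2 * C * (sqrt N * (1 / sqrt (real p' ^ k)))" using C by simp
      ultimately show ?thesis by linarith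
    next
      case False
      have "coprime p' p" using False primes_inD(1)[OF p] primes_inD(1)[OF p'] by (simp add: primes_coprime)
      then have cop: "coprime (p' ^ k) p" by simp
      have pos: "p' ^ k > 0" "p > 0" using primes_inD(4)[OF p] primes_inD(4)[OF p'] by auto
      \<comment> \<open>Geometric mean of the two bounds: \<open>2 C\<close> alone would be
        multiplied by the number of all pairs \<open>(p', k)\<close>, while \<open>N / s\<close>
        alone would add up to size \<open>N\<close> for each \<open>p\<close>.\<close>
      have "\<bar>T (p' ^ k) p\<bar> = sqrt (\<bar>T (p' ^ k) p\<bar> * \<bar>T (p' ^ k) p\<bar>)" by simp
      also have "\<dots> \<le> sqrt ((2 * C) * (N / real (p' ^ k)))"
        using T_cop_bounds(1,2)[OF cop pos] C by (intro real_sqrt_le_mono mult_mono) auto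
      also have "\<dots> = sqrt (2 * C) * (sqrt N * (1 / sqrt (real p' ^ k)))"
        by (simp add: real_sqrt_mult real_sqrt_divide)
      also have "\<dots> \<le> 2 * C * (sqrt N * (1 / sqrt (real p' ^ k)))"
        using C by (intro mult_right_mono real_le_lsqrt) (auto simp: power2_eq_square)
      finally show ?thesis by linarith
    qed
    then have "(\<Sum>p'\<in>?A. \<Sum>k=2..K. T (p' ^ k) p) \<ge> (\<Sum>p'\<in>?A. \<Sum>k=2..K. - (2 * C * (sqrt N * (1 / sqrt (real p' ^ k)))))"
      by (intro sum_mono) auto
    also have "(\<Sum>p'\<in>?A. \<Sum>k=2..K. - (2 * C * (sqrt N * (1 / sqrt (real p' ^ k))))) =
      - (2 * C * sqrt N * (\<Sum>p'\<in>?A. \<Sum>k=2..K. 1 / sqrt (real p' ^ k)))"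
      by (simp add: sum_negf sum_distrib_left mult_ac)
    finally have *: "- (2 * C * sqrt N * (\<Sum>p'\<in>?A. \<Sum>k=2..K. 1 / sqrt (real p' ^ k))) \<le> (\<Sum>p'\<in>?A. \<Sum>k=2..K. T (p' ^ k) p)" .
    have "2 * C * sqrt N * (\<Sum>p'\<in>?A. \<Sum>k=2..K. 1 / sqrt (real p' ^ k)) \<le> 2 * C * sqrt N * (4 * (1 + ln N))"
      using C by (intro mult_left_mono sum_proper_prime_powers_le N) auto
    also have "2 * C * sqrt N * (4 * (1 + ln N)) = 8 * C * (sqrt N * (1 + ln N))" by simp
    finally show ?thesis using * by linarith
  qed
  have low: "(\<Sum>p'\<in>?A. T p' p) \<ge> (1 - 1 / P) * (N * w0 / p) - C - 2 * C * card (primes_in 0 Y)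
      - (N * w0 * prime_recip Y N + C * card ?A) / p" if p: "p \<in> ?S" for p
  proof -
    note pD = primes_inD[OF p]
    have pY: "p \<in> primes_in 0 Y" using p pD RY by (auto simp: primes_in_def)
    have main: "T p p \<ge> (1 - 1 / P) * (N * w0 / p) - C"
    proof -
      have "1 / p \<le> 1 / P" using pD P by (simp add: frac_le)
      then have p1: "1 - 1 / P \<le> 1 - 1 / p" "0 \<le> 1 - 1 / p" "1 - 1 / p \<le> 1" using pD by auto
      have "(1 - 1 / P) * (N * w0 / p) - C \<le> (1 - 1 / p) * (N * w0 / p) - (1 - 1 / p) * C"
        using p1 w0 C by (intro diff_mono mult_right_mono) (auto simp: mult_left_le_one_le)
      also have "\<dots> = (1 - 1 / p) * (N * w0 / p - C)" by (simp add: right_diff_distrib)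
      also have "\<dots> \<le> (1 - 1 / p) * D p" using p1 D(1)[of p] pD by (intro mult_left_mono) auto
      finally show ?thesis using T_div[of p p] by simp
    qed
    have cop: "coprime p' p" "p' > 0" "p > 0" if "p' \<in> primes_in x y" "p' \<noteq> p" for x y p'
      using primes_inD[OF that(1)] pD that(2) by (auto simp: primes_coprime)
    have "(\<Sum>p'\<in>primes_in 0 Y - {p}. T p' p) \<ge> (\<Sum>p'\<in>primes_in 0 Y - {p}. - 2 * C)"
    proof (rule sum_mono)
      fix p' assume "p' \<in> primes_in 0 Y - {p}"
      then have "\<bar>T p' p\<bar> \<le> 2 * C" using cop[of p' 0 Y] by (intro T_cop_bounds(1)) auto
      then show "- 2 * C \<le> T p' p" by linarith
    qed
    moreover have "(\<Sum>p'\<in>primes_in 0 Y - {p}. - 2 * C) \<ge> - 2 * C * card (primes_in 0 Y)"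
      using C card_mono[OF finite_primes_in, of "primes_in 0 Y - {p}" 0 Y] by simp
    moreover have "(\<Sum>p'\<in>primes_in 0 Y. T p' p) = T p p + (\<Sum>p'\<in>primes_in 0 Y - {p}. T p' p)"
      using pY by (intro sum.remove) auto
    ultimately have small: "(\<Sum>p'\<in>primes_in 0 Y. T p' p) \<ge> (1 - 1 / P) * (N * w0 / p) - C - 2 * C * card (primes_in 0 Y)"
      using main by linarith
    have "(\<Sum>p'\<in>primes_in Y N. T p' p) \<ge> (\<Sum>p'\<in>primes_in Y N. - (N * w0 / p' + C) / p)"
    proof (rule sum_mono)
      fix p' assume p': "p' \<in> primes_in Y N"
      then have "p' \<noteq> p" using pD RY by (auto simp: primes_in_def)
      then show "- (N * w0 / p' + C) / p \<le> T p' p" using cop[OF p'] by (intro T_cop_bounds(3)) auto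
    qed
    moreover have "(\<Sum>p'\<in>primes_in Y N. - (N * w0 / p' + C) / p)
        = - (N * w0 * prime_recip Y N + C * card (primes_in Y N)) / p"
      by (simp add: sum_divide_distrib[symmetric] sum_negf sum.distrib sum_distrib_left sum_subtractf)
    moreover have "- (N * w0 * prime_recip Y N + C * card (primes_in Y N)) / p
        = - ((N * w0 * prime_recip Y N + C * card (primes_in Y N)) / p)"
      by (rule minus_divide_left[symmetric])
    moreover have "(N * w0 * prime_recip Y N + C * card (primes_in Y N)) / p
        \<le> (N * w0 * prime_recip Y N + C * card ?A) / p"
      using C RY card_mono[OF finite_primes_in primes_in_mono[of 0 Y "real N" "real N"]]
      by (intro divide_right_mono add_left_mono mult_left_mono) auto
    moreover have "(\<Sum>p'\<in>?A. T p' p) = (\<Sum>p'\<in>primes_in 0 Y. T p' p) + (\<Sum>p'\<in>primes_in Y N. T p' p)"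
      using RY by (intro sum_primes_in_split) auto
    ultimately show ?thesis using small by linarith
  qed
  have split1: "(\<Sum>k=1..K. T (p' ^ k) p) = T p' p + (\<Sum>k=2..K. T (p' ^ k) p)" for p' p
    using K sum.atLeast_Suc_atMost[of 1 K "\<lambda>k. T (p' ^ k) p"] by (simp add: numeral_2_eq_2)
  have "(\<Sum>n=1..N. f n * (excess ?S (int n) * W n)) =
      (\<Sum>n=1..N. \<Sum>p\<in>?S. \<Sum>p'\<in>?A. \<Sum>k=1..K. (if p' ^ k dvd n then 1 else 0) * (((if p dvd n then 1 else 0) - 1 / real p) * W n))"
  proof (rule sum.cong[OF refl])
    fix n assume n: "n \<in> {1..N}"
    show "f n * (excess ?S (int n) * W n) =
      (\<Sum>p\<in>?S. \<Sum>p'\<in>?A. \<Sum>k=1..K. (if p' ^ k dvd n then 1 else 0) * (((if p dvd n then 1 else 0) - 1 / real p) * W n))"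
      unfolding f[OF n] excess_of_nat sum_distrib_right sum_distrib_left ..
  qed
  also have "\<dots> = (\<Sum>p\<in>?S. \<Sum>p'\<in>?A. \<Sum>k=1..K. T (p' ^ k) p)"
    unfolding T_def
    by (rule trans[OF sum.swap], rule sum.cong[OF refl], rule trans[OF sum.swap], rule sum.cong[OF refl], rule sum.swap)
  also have "\<dots> = (\<Sum>p\<in>?S. (\<Sum>p'\<in>?A. T p' p) + (\<Sum>p'\<in>?A. \<Sum>k=2..K. T (p' ^ k) p))"
    unfolding split1 by (simp add: sum.distrib)
  also have "\<dots> \<ge> (\<Sum>p\<in>?S. ((1 - 1 / P) * (N * w0 / p) - C - 2 * C * card (primes_in 0 Y)
      - (N * w0 * prime_recip Y N + C * card ?A) / p) + (- 8 * C * (sqrt N * (1 + ln N))))"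
    by (intro sum_mono add_mono low high)
  also have "(\<Sum>p\<in>?S. ((1 - 1 / P) * (N * w0 / p) - C - 2 * C * card (primes_in 0 Y)
      - (N * w0 * prime_recip Y N + C * card ?A) / p) + (- 8 * C * (sqrt N * (1 + ln N)))) =
      (\<Sum>p\<in>?S. (N * w0 * (1 - 1 / P - prime_recip Y N) - C * card ?A) * (1 / p)
        + (- C - 2 * C * card (primes_in 0 Y) - 8 * C * (sqrt N * (1 + ln N))))"
    by (intro sum.cong refl) (simp add: add_divide_distrib diff_divide_distrib algebra_simps)
  also have "\<dots> = (N * w0 * (1 - 1 / P - prime_recip Y N) - C * card ?A) * L
        + card ?S * (- C - 2 * C * card (primes_in 0 Y) - 8 * C * (sqrt N * (1 + ln N)))"
    by (simp add: sum.distrib L_def sum_distrib_left)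
  finally show ?thesis unfolding W_def by (simp add: algebra_simps)
qed

section \<open>The test function made of class sums\<close>

lemma V_nonneg: "0 \<le> V N Q f"
  unfolding V_def by (intro sum_nonneg) simp

text \<open>\<open>g\<close> is constant on residue classes, so only one factor of the square is
  expanded into its defining sum; summing over the classes then runs through all of
  \<open>I\<close>.\<close>

lemma sum_squares_classes:
  fixes \<beta> :: "int \<Rightarrow> real" and q :: nat
  assumes "q \<ge> 1" "finite I"
  defines "g \<equiv> \<lambda>n. \<Sum>m\<in>{m\<in>I. int q dvd m - n}. \<beta> m"
  shows "(\<Sum>a=1..q. (g (int a))\<^sup>2) = (\<Sum>n\<in>I. \<beta> n * g n)"
proof -
  \<comment> \<open>The shift by 1 puts the representative into \<open>{1..q}\<close> instead of
    \<open>{0..q-1}\<close>.\<close>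
  define r where "r n = nat ((n - 1) mod int q) + 1" for n
  have r: "int q dvd n - int a \<longleftrightarrow> r n = a" if "a \<in> {1..q}" for n a
  proof -
    have "int q dvd n - int a \<longleftrightarrow> int q dvd (n - 1) - (int a - 1)" by simp
    also have "\<dots> \<longleftrightarrow> (n - 1) mod int q = (int a - 1) mod int q" by (simp add: mod_eq_dvd_iff)
    also have "(int a - 1) mod int q = int a - 1" using that by (intro mod_pos_pos_trivial) auto
    also have "(n - 1) mod int q = int a - 1 \<longleftrightarrow> r n = a" using that assms(1) by (auto simp: r_def nat_eq_iff)
    finally show ?thesis .
  qed
  have rI: "r n \<in> {1..q}" for n
  proof -
    have "(n - 1) mod int q < int q" "0 \<le> (n - 1) mod int q" using assms(1) by simp_all
    then show ?thesis by (simp add: r_def nat_less_iff Suc_le_eq)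
  qed
  have per: "g n = g m" if "int q dvd n - m" for n m
  proof -
    have "int q dvd k - n \<longleftrightarrow> int q dvd k - m" for k
      using that dvd_add_left_iff[of "int q" "n - m" "k - n"] by (simp add: add.commute)
    then show ?thesis unfolding g_def by simp
  qed
  have "(\<Sum>a=1..q. (g (int a))\<^sup>2) = (\<Sum>a=1..q. \<Sum>n\<in>{n\<in>I. r n = a}. \<beta> n * g n)"
  proof (rule sum.cong[OF refl])
    fix a assume a: "a \<in> {1..q}"
    have "(g (int a))\<^sup>2 = (\<Sum>n\<in>{n\<in>I. int q dvd n - int a}. \<beta> n * g (int a))"
      by (simp add: power2_eq_square g_def sum_distrib_right)
    also have "\<dots> = (\<Sum>n\<in>{n\<in>I. r n = a}. \<beta> n * g n)"
    proof (rule sum.cong)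
      show "{n\<in>I. int q dvd n - int a} = {n\<in>I. r n = a}" using r[OF a] by simp
      show "\<beta> n * g (int a) = \<beta> n * g n" if "n \<in> {n\<in>I. r n = a}" for n
        using r[OF a, of n] per[of n "int a"] that by simp
    qed
    finally show "(g (int a))\<^sup>2 = (\<Sum>n\<in>{n\<in>I. r n = a}. \<beta> n * g n)" .
  qed
  also have "\<dots> = (\<Sum>n\<in>I. \<beta> n * g n)"
    using rI assms(2) by (intro sum.group) auto
  finally show ?thesis .
qed

lemma sum_class_neg:
  fixes \<beta> :: "int \<Rightarrow> real" and c :: int
  assumes odd: "\<And>n. \<beta> (- n) = - \<beta> n"
  shows "(\<Sum>m\<in>{m\<in>{-M..M}. q dvd m - c}. \<beta> m) = - (\<Sum>m\<in>{m\<in>{-M..M}. q dvd m + c}. \<beta> m)"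
proof -
  have "q dvd - m - c \<longleftrightarrow> q dvd m + c" "q dvd - m + c \<longleftrightarrow> q dvd m - c" for m
  proof -
    have "- m - c = - (m + c)" "- m + c = - (m - c)" by auto
    then show "q dvd - m - c \<longleftrightarrow> q dvd m + c" "q dvd - m + c \<longleftrightarrow> q dvd m - c"
      by (simp_all only: dvd_minus_iff)
  qed
  then have "(\<Sum>m\<in>{m\<in>{-M..M}. q dvd m - c}. \<beta> m) = (\<Sum>m\<in>{m\<in>{-M..M}. q dvd m + c}. - \<beta> m)"
    by (intro sum.reindex_bij_witness[of _ uminus uminus]) (auto simp: odd)
  then show ?thesis by (simp add: sum_negf)
qed

text \<open>Take \<open>g(q, n)\<close> to be the sum of \<beta> over the class of \<open>n\<close>.
  Its weighted sum over \<open>q\<close> is \<open>W \<beta>(n)\<close> from \<open>m = n\<close>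
  plus an off-diagonal part of size at most 1. In the pairing that part costs the sum of
  \<open>f\<close>; in the norm, by \<open>\<bar>\<beta>\<bar> \<le> \<beta>^2 + 1\<close>, it costs
  one further sum of \<open>\<beta>^2\<close> and the number \<open>2 N + 1\<close> of
  terms.\<close>

lemma V_ge_odd_test:
  fixes N :: nat and Q :: real and w :: "nat \<Rightarrow> real" and \<beta> :: "int \<Rightarrow> real" and f :: "nat \<Rightarrow> real"
  assumes w: "\<And>q. 0 \<le> w q" "\<And>q. w q \<le> 1" and odd: "\<And>n. \<beta> (- n) = - \<beta> n"
    and off: "\<And>n. n \<in> {- int N..int N} \<Longrightarrow>
      \<bar>\<Sum>q=1..nat \<lfloor>Q\<rfloor>. w q * (\<Sum>m\<in>{m\<in>{- int N..int N}. int q dvd m - n} - {n}. \<beta> m)\<bar> \<le> 1"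
    and Q: "Q \<ge> 1" and f0: "\<And>n. 0 \<le> f n"
  defines "W \<equiv> \<Sum>q=1..nat \<lfloor>Q\<rfloor>. w q"
  assumes pos: "0 \<le> W * (\<Sum>n=1..N. f n * \<beta> (int n)) - (\<Sum>n=1..N. f n)"
  shows "(W * (\<Sum>n=1..N. f n * \<beta> (int n)) - (\<Sum>n=1..N. f n))\<^sup>2
     \<le> V N Q (\<lambda>n. of_real (f n)) * ((W + 1) * (\<Sum>n=- int N..int N. (\<beta> n)\<^sup>2) + (2 * real N + 1))"
proof -
  let ?I = "{- int N..int N}" and ?Qs = "{1..nat \<lfloor>Q\<rfloor>}"
  define g where "g q n = (\<Sum>m\<in>{m\<in>?I. int q dvd m - n}. \<beta> m)" for q :: nat and n :: int
  define off where "off n = (\<Sum>q\<in>?Qs. w q * (\<Sum>m\<in>{m\<in>?I. int q dvd m - n} - {n}. \<beta> m))" for n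
  have G: "(\<Sum>q\<in>?Qs. w q * g q n) = W * \<beta> n + off n" if n: "n \<in> ?I" for n
  proof -
    have "g q n = \<beta> n + (\<Sum>m\<in>{m\<in>?I. int q dvd m - n} - {n}. \<beta> m)" for q
    proof -
      have "finite {m\<in>?I. int q dvd m - n}" by (rule finite_subset[of _ ?I]) auto
      then show ?thesis unfolding g_def using n by (intro sum.remove) auto
    qed
    then show ?thesis unfolding off_def W_def by (simp add: distrib_left sum.distrib sum_distrib_right)
  qed
  have off1: "\<bar>off n\<bar> \<le> 1" if "n \<in> ?I" for n using off[OF that] unfolding off_def .
  have neg: "g q n = - (\<Sum>m\<in>{m\<in>?I. int q dvd m + n}. \<beta> m)" for q n
    unfolding g_def by (rule sum_class_neg[of \<beta>, OF odd])
  have dual: "(\<Sum>n=1..N. f n * (\<Sum>q\<in>?Qs. w q * g q (int n)))\<^sup>2 \<le>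
         V N Q (\<lambda>n. of_real (f n)) * (\<Sum>q\<in>?Qs. w q * (\<Sum>a=1..q. (g q (int a))\<^sup>2))"
  proof (rule V_duality)
    show "1 \<le> q \<and> real q \<le> Q" if "q \<in> ?Qs" for q
      using that Q by (auto simp: le_nat_iff le_floor_iff)
    show "g q (int n) = g q (int a)" if "[n = a] (mod q)" for q n a
    proof -
      have "int q dvd int n - int a" using that by (simp add: cong_iff_dvd_diff flip: cong_int_iff)
      then have "int q dvd k - int n \<longleftrightarrow> int q dvd k - int a" for k
        using dvd_add_left_iff[of "int q" "int n - int a" "k - int n"] by (simp add: add.commute)
      then show ?thesis unfolding g_def by simp
    qed
    show "(\<Sum>a | a \<in> {1..q} \<and> gcd a q = h. g q (int a)) = 0" if "q \<in> ?Qs" for q h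
    proof (rule sum_class_odd)
      show "g q (int (q - a)) = - g q (int a)" if "1 \<le> a" "a < q" for a
      proof -
        have "int q dvd m + int (q - a) \<longleftrightarrow> int q dvd m - int a" for m
          using that dvd_add_left_iff[of "int q" "int q" "m - int a"] by (simp add: of_nat_diff algebra_simps)
        then show ?thesis unfolding neg[of q "int (q - a)"] by (simp add: g_def)
      qed
      have "int q dvd m + int q \<longleftrightarrow> int q dvd m - int q" for m
        using dvd_add_left_iff[of "int q" "int q" m] dvd_diff_left_iff[of "int q" "int q" m] by simp
      then have "g q (int q) = - g q (int q)" using neg[of q "int q"] by (simp add: g_def)
      then show "g q (int q) = 0" by simp
    qed (use that in auto)
  qed (use w in auto)
  have num: "(\<Sum>n=1..N. f n * (\<Sum>q\<in>?Qs. w q * g q (int n))) \<ge> W * (\<Sum>n=1..N. f n * \<beta> (int n)) - (\<Sum>n=1..N. f n)"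
  proof -
    have "W * (\<Sum>n=1..N. f n * \<beta> (int n)) - (\<Sum>n=1..N. f n) = (\<Sum>n=1..N. f n * (W * \<beta> (int n) - 1))"
      by (simp add: sum_distrib_left right_diff_distrib sum_subtractf mult_ac)
    also have "\<dots> \<le> (\<Sum>n=1..N. f n * (\<Sum>q\<in>?Qs. w q * g q (int n)))"
    proof (intro sum_mono mult_left_mono f0)
      fix n assume "n \<in> {1..N}"
      then have n: "int n \<in> ?I" by auto
      show "W * \<beta> (int n) - 1 \<le> (\<Sum>q\<in>?Qs. w q * g q (int n))"
        unfolding G[OF n] using off1[OF n] by linarith
    qed
    finally show ?thesis .
  qed
  have den: "(\<Sum>q\<in>?Qs. w q * (\<Sum>a=1..q. (g q (int a))\<^sup>2)) \<le> (W + 1) * (\<Sum>n\<in>?I. (\<beta> n)\<^sup>2) + (2 * real N + 1)"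
  proof -
    have "(\<Sum>q\<in>?Qs. w q * (\<Sum>a=1..q. (g q (int a))\<^sup>2)) = (\<Sum>q\<in>?Qs. w q * (\<Sum>n\<in>?I. \<beta> n * g q n))"
      unfolding g_def by (intro sum.cong refl arg_cong2[of _ _ _ _ "(*)"] sum_squares_classes) auto
    also have "\<dots> = (\<Sum>q\<in>?Qs. \<Sum>n\<in>?I. \<beta> n * (w q * g q n))"
      by (simp add: sum_distrib_left mult_ac)
    also have "\<dots> = (\<Sum>n\<in>?I. \<beta> n * (\<Sum>q\<in>?Qs. w q * g q n))"
      by (subst sum.swap) (simp add: sum_distrib_left)
    also have "\<dots> \<le> (\<Sum>n\<in>?I. (W + 1) * (\<beta> n)\<^sup>2 + 1)"
    proof (rule sum_mono)
      fix n assume n: "n \<in> ?I"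
      have "\<bar>\<beta> n * off n\<bar> \<le> \<bar>\<beta> n\<bar> * 1"
        unfolding abs_mult using off1[OF n] by (intro mult_left_mono) auto
      moreover have "\<bar>\<beta> n\<bar> \<le> (\<beta> n)\<^sup>2 + 1"
        using zero_le_power2[of "\<bar>\<beta> n\<bar> - 1"] zero_le_power2[of "\<beta> n"] by (simp add: power2_diff power2_eq_square[of "\<beta> n"])
      ultimately have "\<beta> n * off n \<le> (\<beta> n)\<^sup>2 + 1" by linarith
      then show "\<beta> n * (\<Sum>q\<in>?Qs. w q * g q n) \<le> (W + 1) * (\<beta> n)\<^sup>2 + 1"
        unfolding G[OF n] by (simp add: algebra_simps power2_eq_square)
    qed
    also have "\<dots> = (W + 1) * (\<Sum>n\<in>?I. (\<beta> n)\<^sup>2) + (2 * real N + 1)"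
      by (simp add: sum.distrib sum_distrib_left)
    finally show ?thesis .
  qed
  have "(W * (\<Sum>n=1..N. f n * \<beta> (int n)) - (\<Sum>n=1..N. f n))\<^sup>2 \<le> (\<Sum>n=1..N. f n * (\<Sum>q\<in>?Qs. w q * g q (int n)))\<^sup>2"
    using num pos by (intro power_mono) auto
  also note dual
  also have "V N Q (\<lambda>n. of_real (f n)) * (\<Sum>q\<in>?Qs. w q * (\<Sum>a=1..q. (g q (int a))\<^sup>2)) \<le>
    V N Q (\<lambda>n. of_real (f n)) * ((W + 1) * (\<Sum>n\<in>?I. (\<beta> n)\<^sup>2) + (2 * real N + 1))"
    by (intro mult_left_mono den V_nonneg)
  finally show ?thesis .
qed

lemma card_primes_in_le_self:
  assumes "0 \<le> y"
  shows "real (card (primes_in x y)) \<le> y"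
proof -
  have "primes_in x y \<subseteq> {1..nat \<lfloor>y\<rfloor>}"
  proof
    fix p assume "p \<in> primes_in x y"
    from primes_inD(3,4)[OF this] show "p \<in> {1..nat \<lfloor>y\<rfloor>}" by (simp add: le_nat_floor)
  qed
  then have "card (primes_in x y) \<le> nat \<lfloor>y\<rfloor>" using card_mono[of "{1..nat \<lfloor>y\<rfloor>}"] by fastforce
  also have "real \<dots> \<le> y" using assms by (rule of_nat_floor)
  finally show ?thesis by simp
qed

text \<open>Writing \<open>m = n + k q\<close>, the primes involved exceed \<open>\<bar>k\<bar>\<close>, so for fixed \<open>k\<close> the condition
  \<open>p dvd m\<close> is a residue class condition on \<open>q\<close>, and the smooth weights cancel its mean.\<close>

lemma off_diagonal_bound:
  fixes N A B :: nat and Q P R :: real and n :: int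
  assumes Q: "Q \<ge> 1" "Q \<ge> 2 * A" and AB: "1 \<le> A" "A < B" and N: "N \<ge> 1" and n: "n \<in> {- int N..int N}"
    and P: "4 * N / Q \<le> P" and R: "0 \<le> R" "R \<le> Q"
  defines "\<beta> \<equiv> \<lambda>m. excess (primes_in P R) m * wave B (m / N)"
  shows "\<bar>\<Sum>q=1..nat \<lfloor>Q\<rfloor>. bump B (q / Q) * (\<Sum>m\<in>{m\<in>{- int N..int N}. int q dvd m - n} - {n}. \<beta> m)\<bar>
     \<le> 8 * (4 * 10 ^ (5 * B) * (20 * real B) ^ A) * (N * (R / Q) ^ A)"
proof -
  let ?I = "{- int N..int N}" and ?S = "primes_in P R"
  define K where "K = \<lfloor>4 * N / Q\<rfloor>"
  define C where "C = 4 * 10 ^ (5 * B) * (20 * real B) ^ A"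
  have C0: "C \<ge> 0" by (simp add: C_def)
  have K: "0 \<le> K" "real_of_int K \<le> 4 * N / Q" using Q by (auto simp: K_def)
  have B1: "B \<ge> 1" using AB by simp
  have beta0: "\<beta> m = 0" if "m \<notin> ?I" for m
  proof -
    have "\<bar>real_of_int m / real N\<bar> \<ge> 1" using that N by (auto simp: abs_if field_simps)
    then show ?thesis unfolding \<beta>_def using wave_eq_0[OF B1] by simp
  qed
  have inner: "bump B (q / Q) * (\<Sum>m\<in>{m\<in>?I. int q dvd m - n} - {n}. \<beta> m)
     = (\<Sum>k\<in>{-K..K}-{0}. bump B (q / Q) * \<beta> (n + k * int q))" if q: "q \<in> {1..nat \<lfloor>Q\<rfloor>}" for q
  proof (cases "real q \<le> Q / 2")
    case True
    then show ?thesis using bump_eq_0[OF B1, of "q / Q"] Q by (simp add: field_simps)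
  next
    case False
    have "(\<Sum>m\<in>{m\<in>?I. int q dvd m - n} - {n}. \<beta> m) = (\<Sum>k\<in>{k\<in>{-K..K}-{0}. n + k * int q \<in> ?I}. \<beta> (n + k * int q))"
    proof (rule sum.reindex_bij_witness[of _ "\<lambda>k. n + k * int q" "\<lambda>m. (m - n) div int q"])
      fix m assume m: "m \<in> {m\<in>?I. int q dvd m - n} - {n}"
      then obtain k where k: "m - n = int q * k" by (auto elim: dvdE)
      have q0: "int q \<noteq> 0" using q by auto
      show *: "n + (m - n) div int q * int q = m" using k q0 by (simp add: algebra_simps)
      \<comment> \<open>Here the support of \<open>bump\<close> enters: \<open>q > Q / 2\<close> and
        \<open>\<bar>m - n\<bar> \<le> 2 N\<close> leave only
        \<open>\<bar>k\<bar> \<le> 4 N / Q\<close>, which is below every prime of the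
        excess.\<close>
      have "\<bar>real_of_int k\<bar> * (Q / 2) \<le> \<bar>real_of_int k\<bar> * real q" using False by (intro mult_left_mono) auto
      also have "\<dots> = real_of_int \<bar>m - n\<bar>" unfolding k by (simp add: abs_mult)
      also have "\<dots> \<le> real_of_int (2 * int N)" using m n by (intro of_int_le_iff[THEN iffD2]) auto
      finally have "\<bar>real_of_int k\<bar> \<le> 4 * N / Q" using Q by (simp add: field_simps)
      then have "\<bar>k\<bar> \<le> K" unfolding K_def by (simp add: le_floor_iff)
      moreover have "k \<noteq> 0" using m k by auto
      moreover have "(m - n) div int q = k" using k q0 by simp
      ultimately show "(m - n) div int q \<in> {k\<in>{-K..K}-{0}. n + k * int q \<in> ?I}"
        using m * by auto
      show "\<beta> (n + (m - n) div int q * int q) = \<beta> m" unfolding * ..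
    qed (use q in auto)
    also have "\<dots> = (\<Sum>k\<in>{-K..K}-{0}. \<beta> (n + k * int q))"
      using beta0 by (intro sum.mono_neutral_left) auto
    finally show ?thesis by (simp add: sum_distrib_left)
  qed
  have each_k: "\<bar>\<Sum>q=1..nat \<lfloor>Q\<rfloor>. bump B (q / Q) * \<beta> (n + k * int q)\<bar> \<le> R * (C * (R / Q) ^ (A - 1))"
    if k: "k \<in> {-K..K}-{0}" for k
  proof -
    have kb: "\<bar>real_of_int k\<bar> \<le> 4 * N / Q" using k K by (auto simp: abs_le_iff) 
    have kQ: "\<bar>real_of_int k\<bar> * Q \<le> 4 * real N" using kb Q by (simp add: field_simps)
    have each: "\<bar>\<Sum>q=1..nat \<lfloor>Q\<rfloor>. bump B (q / Q) * wave B (real_of_int (n + k * int q) / N) * ((if int p dvd n + k * int q then 1 else 0) - 1 / p)\<bar>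
        \<le> C * (R / Q) ^ (A - 1)" if p: "p \<in> ?S" for p
    proof -
      have p0: "real p > 0" "real p \<le> Q" using primes_inD[OF p] R by auto
      have "\<not> int p dvd k"
      proof
        assume "int p dvd k"
        then have "int p \<le> \<bar>k\<bar>" using k by (intro zdvd_imp_le) auto
        then have "real p \<le> \<bar>real_of_int k\<bar>" by (metis of_int_abs of_int_le_iff of_int_of_nat_eq)
        then show False using kb P primes_inD(2)[OF p] by linarith
      qed
      then have "\<bar>\<Sum>q=1..\<lfloor>Q\<rfloor>. bump B (q / Q) * wave B (real_of_int (n + k * q) / N) * ((if int p dvd n + k * q then 1 else 0) - 1 / p)\<bar>
         \<le> C * (Q / p * (p / Q) ^ A)"
        unfolding C_def using p0 Q N n kQ AB primes_inD(1)[OF p]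
        by (intro weighted_prime_indicator_sum) auto
      also have "(\<Sum>q=1..\<lfloor>Q\<rfloor>. bump B (q / Q) * wave B (real_of_int (n + k * q) / N) * ((if int p dvd n + k * q then 1 else 0) - 1 / p))
        = (\<Sum>q=1..nat \<lfloor>Q\<rfloor>. bump B (q / Q) * wave B (real_of_int (n + k * int q) / N) * ((if int p dvd n + k * int q then 1 else 0) - 1 / p))"
        by (rule sum.reindex_bij_witness[of _ int nat]) auto
      \<comment> \<open>The size \<open>Q / p\<close> of a residue class costs one power of
        \<open>p / Q\<close>.\<close>
      also have "Q / p * (p / Q) ^ A = (p / Q) ^ (A - 1)"
        using AB(1) p0 Q by (cases A) auto
      also have "C * (p / Q) ^ (A - 1) \<le> C * (R / Q) ^ (A - 1)"
        using C0 p0 Q primes_inD(3)[OF p] by (intro mult_left_mono power_mono divide_right_mono) auto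
      finally show ?thesis .
    qed
    have "(\<Sum>q=1..nat \<lfloor>Q\<rfloor>. bump B (q / Q) * \<beta> (n + k * int q)) =
      (\<Sum>p\<in>?S. \<Sum>q=1..nat \<lfloor>Q\<rfloor>. bump B (q / Q) * wave B (real_of_int (n + k * int q) / N) * ((if int p dvd n + k * int q then 1 else 0) - 1 / p))"
      unfolding \<beta>_def excess_def by (subst sum.swap) (simp add: sum_distrib_left sum_distrib_right mult_ac)
    also have "\<bar>\<dots>\<bar> \<le> (\<Sum>p\<in>?S. C * (R / Q) ^ (A - 1))"
      by (rule order.trans[OF sum_abs]) (intro sum_mono each)
    also have "\<dots> = real (card ?S) * (C * (R / Q) ^ (A - 1))" by simp
    also have "\<dots> \<le> R * (C * (R / Q) ^ (A - 1))"
      using card_primes_in_le_self[OF R(1)] C0 R Q by (intro mult_right_mono) auto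
    finally show ?thesis .
  qed
  have "(\<Sum>q=1..nat \<lfloor>Q\<rfloor>. bump B (q / Q) * (\<Sum>m\<in>{m\<in>?I. int q dvd m - n} - {n}. \<beta> m)) =
     (\<Sum>k\<in>{-K..K}-{0}. \<Sum>q=1..nat \<lfloor>Q\<rfloor>. bump B (q / Q) * \<beta> (n + k * int q))"
    by (rule trans[OF sum.cong[OF refl inner] sum.swap])
  also have "\<bar>\<dots>\<bar> \<le> (\<Sum>k\<in>{-K..K}-{0}. R * (C * (R / Q) ^ (A - 1)))"
    by (rule order.trans[OF sum_abs]) (intro sum_mono each_k)
  also have "\<dots> = real (card ({-K..K}-{0})) * (R * (C * (R / Q) ^ (A - 1)))" by simp
  also have "real (card ({-K..K}-{0})) = 2 * real_of_int K" using K(1) by (simp add: card_Diff_subset)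
  \<comment> \<open>The lost power is regained: at most \<open>R\<close> primes and
    \<open>8 N / Q\<close> values of \<open>k\<close> together contribute \<open>8 N\<close> times
    \<open>R / Q\<close>.\<close>
  also have "2 * real_of_int K * (R * (C * (R / Q) ^ (A - 1))) \<le> (8 * N / Q) * (R * (C * (R / Q) ^ (A - 1)))"
    using K C0 R Q by (intro mult_right_mono) auto
  also have "\<dots> = 8 * C * (N * (R / Q) ^ A)"
    using AB(1) Q by (cases A) auto
  finally show ?thesis by (simp only: C_def)
qed

section \<open>Lower bound from medium primes\<close>

lemma omega_le_Omega: "n \<ge> 1 \<Longrightarrow> omega n \<le> Omega n"
proof -
  assume n: "n \<ge> 1"
  have "(\<Sum>p\<in>prime_factors n. 1) \<le> (\<Sum>p\<in>prime_factors n. count (prime_factorization n) p)"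
    by (intro sum_mono) (auto simp: Suc_le_eq)
  then show ?thesis by (simp add: omega_def Omega_def size_multiset_overloaded_eq)
qed

lemma Omega_le_ln:
  assumes "n \<ge> 1"
  shows "real (Omega n) \<le> 2 * ln n"
proof -
  have "- ln (2::real) = ln (1 / 2)" by (simp add: ln_div)
  also have "\<dots> \<le> 1 / 2 - 1" by (intro ln_le_minus_one) simp
  finally have ln2: "1 / 2 \<le> ln (2::real)" by simp
  have "real (Omega n) * (1 / 2) = (\<Sum>p\<in>primes_in 0 n. \<Sum>k=1..n. if p ^ k dvd n then 1 / 2 else 0)"
    unfolding Omega_eq_sum[OF assms order.refl] sum_distrib_right by (intro sum.cong refl) auto
  also have "\<dots> \<le> (\<Sum>p\<in>primes_in 0 n. \<Sum>k=1..n. if p ^ k dvd n then ln p else 0)"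
  proof (intro sum_mono)
    fix p k assume "p \<in> primes_in 0 n"
    then have "ln 2 \<le> ln (real p)" by (intro ln_mono) (auto dest: primes_inD(5))
    then show "(if p ^ k dvd n then 1 / 2 else 0) \<le> (if p ^ k dvd n then ln (real p) else 0)"
      using ln2 by auto
  qed
  also have "\<dots> = ln n" by (rule ln_eq_sum_primes[OF assms order.refl, symmetric])
  finally show ?thesis by simp
qed

text \<open>Treats both functions at once: \<open>K = 1\<close> counts prime divisors without
  multiplicity, \<open>K = N\<close> with multiplicity.\<close>

lemma prime_power_representation:
  assumes "w \<in> {omega, Omega}" "N \<ge> 1"
  shows "\<exists>K\<ge>1. \<forall>n\<in>{1..N}. real (w n) = (\<Sum>p\<in>primes_in 0 N. \<Sum>k=1..K. if p ^ k dvd n then 1 else 0)"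
proof (cases "w = omega")
  case True
  then show ?thesis using omega_eq_sum[of _ N] by (intro exI[of _ 1]) auto
next
  case False
  then have "w = Omega" using assms(1) by auto
  then show ?thesis using Omega_eq_sum[of _ N] assms(2) by (intro exI[of _ N]) auto
qed

lemma eventually_le_of_tendsto_0:
  fixes g :: "real \<Rightarrow> real"
  assumes "((\<lambda>x. g x / x) \<longlongrightarrow> 0) at_top" "e > 0"
  shows "eventually (\<lambda>x. g x \<le> e * x) at_top"
  using order_tendstoD(2)[OF assms] eventually_gt_at_top[of 0]
proof eventually_elim
  case (elim x)
  then show ?case by (simp add: divide_less_eq less_imp_le)
qed

text \<open>All error terms of \<open>correlation_lower_bound\<close> are small multiples of
  \<open>N\<close>, or of \<open>N\<close> times the reciprocal sum, as soon as that sum is at least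
  \<open>c\<close>. The threshold for \<open>N\<close> depends neither on \<open>P\<close> nor on
  \<open>f\<close>, so it will hold for all \<open>Q\<close> at once.\<close>

lemma eventually_correlation_lower_bound:
  assumes \<delta>: "0 < \<delta>" "\<delta> \<le> 1 / 4" and c: "c > 0" and B: "B \<ge> 1"
  shows "eventually (\<lambda>N. \<forall>P K f. 16 \<le> P \<longrightarrow> K \<ge> 1 \<longrightarrow>
    (\<forall>n\<in>{1..N}. f n = (\<Sum>p\<in>primes_in 0 N. \<Sum>k=1..K. if p ^ k dvd n then 1 else 0)) \<longrightarrow>
    c \<le> prime_recip P (N powr (1 / 2 - \<delta> / 2)) \<longrightarrow>
    N * prime_recip P (N powr (1 / 2 - \<delta> / 2)) / (64 * (real B + 1))
      \<le> (\<Sum>n=1..N. f n * (excess (primes_in P (N powr (1 / 2 - \<delta> / 2))) (int n) * wave B (n / N)))) sequentially"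
proof -
  define C where "C = 2 * real B + 2"
  define w0 where "w0 = 1 / (2 * (real B + 1))"
  have C: "C > 0" by (simp add: C_def add_pos_pos)
  have w0: "w0 > 0" by (simp add: w0_def)
  define \<eta> where "\<eta> = w0 * c / 128"
  have \<eta>: "\<eta> > 0" using w0 c by (simp add: \<eta>_def)
  define \<epsilon> where "\<epsilon> = min 1 (min (w0 / (128 * C)) (\<eta> / (2 * C)))"
  have \<epsilon>: "\<epsilon> > 0" "\<epsilon> \<le> 1" "C * \<epsilon> \<le> w0 / 128" "2 * C * \<epsilon> \<le> \<eta>"
  proof -
    show "\<epsilon> > 0" "\<epsilon> \<le> 1" using w0 C \<eta> by (auto simp: \<epsilon>_def)
    have "\<epsilon> \<le> w0 / (128 * C)" "\<epsilon> \<le> \<eta> / (2 * C)" by (auto simp: \<epsilon>_def)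
    then show "C * \<epsilon> \<le> w0 / 128" "2 * C * \<epsilon> \<le> \<eta>" using C by (auto simp: field_simps)
  qed
  have R_top: "filterlim (\<lambda>x::real. x powr (1 / 2 - \<delta> / 2)) at_top at_top"
    using \<delta> by real_asymp
  have E: "eventually (\<lambda>x::real. real (card (primes_in 0 x)) \<le> \<epsilon> * x \<and>
      real (card (primes_in 0 (x powr (1 / 2 - \<delta> / 2)))) \<le> \<epsilon> * x powr (1 / 2 - \<delta> / 2) \<and>
      prime_recip (sqrt x) x \<le> 7 / 8 \<and>
      C * sqrt x \<le> \<eta> * x \<and> 8 * C * (x powr (1 - \<delta> / 2) * (1 + ln x)) \<le> \<eta> * x) at_top"
  proof (intro eventually_conj)
    show "eventually (\<lambda>x::real. real (card (primes_in 0 x)) \<le> \<epsilon> * x) at_top"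
      by (rule eventually_card_primes_in_le[OF \<epsilon>(1)])
    show "eventually (\<lambda>x::real. real (card (primes_in 0 (x powr (1 / 2 - \<delta> / 2)))) \<le> \<epsilon> * x powr (1 / 2 - \<delta> / 2)) at_top"
      using eventually_compose_filterlim[OF eventually_card_primes_in_le[OF \<epsilon>(1)] R_top] .
    show "eventually (\<lambda>x::real. prime_recip (sqrt x) x \<le> 7 / 8) at_top"
      by (rule eventually_sum_large_prime_recip_le)
    have "((\<lambda>x::real. sqrt x / x) \<longlongrightarrow> 0) at_top" by real_asymp
    from tendsto_mult_right[OF this, of C] have "((\<lambda>x::real. C * sqrt x / x) \<longlongrightarrow> 0) at_top"
      by (simp add: mult.commute)
    then show "eventually (\<lambda>x::real. C * sqrt x \<le> \<eta> * x) at_top"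
      by (rule eventually_le_of_tendsto_0[OF _ \<eta>])
    have "((\<lambda>x::real. x powr (1 - \<delta> / 2) * (1 + ln x) / x) \<longlongrightarrow> 0) at_top" using \<delta> by real_asymp
    from tendsto_mult_right[OF this, of "8 * C"]
    have "((\<lambda>x::real. 8 * C * (x powr (1 - \<delta> / 2) * (1 + ln x)) / x) \<longlongrightarrow> 0) at_top" by (simp add: mult_ac)
    then show "eventually (\<lambda>x::real. 8 * C * (x powr (1 - \<delta> / 2) * (1 + ln x)) \<le> \<eta> * x) at_top"
      by (rule eventually_le_of_tendsto_0[OF _ \<eta>])
  qed
  from eventually_compose_filterlim[OF this filterlim_real_sequentially] eventually_ge_at_top[of 1]
  show ?thesis
  proof eventually_elim
    case (elim N)
    define R where "R = real N powr (1 / 2 - \<delta> / 2)"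
    \<comment> \<open>\<open>Y = N / R\<close>, so that \<open>p \<le> R\<close> and
      \<open>p' \<le> Y\<close> imply \<open>p p' \<le> N\<close>.\<close>
    define Y where "Y = real N powr (1 / 2 + \<delta> / 2)"
    have N: "N \<ge> 1" using elim by simp
    have RY: "R \<le> Y" "Y \<le> N" "0 \<le> Y" "sqrt N \<le> Y" "R * Y = N" "R \<le> sqrt N" "R * sqrt N = N powr (1 - \<delta> / 2)" "0 \<le> R"
      using N \<delta> powr_mono[of "1 / 2 - \<delta> / 2" "1 / 2 + \<delta> / 2" "real N"] powr_mono[of "1 / 2 + \<delta> / 2" 1 "real N"]
        powr_mono[of "1 / 2" "1 / 2 + \<delta> / 2" "real N"] powr_mono[of "1 / 2 - \<delta> / 2" "1 / 2" "real N"]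
      by (auto simp: R_def Y_def powr_half_sqrt[symmetric] powr_add[symmetric])
    show ?case unfolding R_def[symmetric]
    proof (intro allI impI)
      fix P :: real and K :: nat and f :: "nat \<Rightarrow> real"
      assume P: "16 \<le> P" and K: "K \<ge> 1"
        and f: "\<forall>n\<in>{1..N}. f n = (\<Sum>p\<in>primes_in 0 N. \<Sum>k=1..K. if p ^ k dvd n then 1 else 0)"
        and cL: "c \<le> prime_recip P R"
      define L where "L = prime_recip P R"
      define S where "S = real (card (primes_in P R))"
      define \<Lambda> where "\<Lambda> = prime_recip Y N"
      have L: "c \<le> L" "0 \<le> L" using cL c by (auto simp: L_def)
      have "\<Lambda> \<le> prime_recip (sqrt N) N"
        unfolding \<Lambda>_def using RY by (intro sum_mono2 primes_in_mono) auto
      then have \<Lambda>: "\<Lambda> \<le> 7 / 8" using elim by simp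
      have "S \<le> real (card (primes_in 0 R))"
        unfolding S_def using P by (intro of_nat_mono card_mono primes_in_mono) auto
      then have S: "S \<le> \<epsilon> * R" "0 \<le> S" using elim by (auto simp: R_def S_def)
      have SR: "S \<le> R" using S(1) \<epsilon>(2) RY(8) mult_right_mono[of \<epsilon> 1 R] by simp
      have cY: "real (card (primes_in 0 Y)) \<le> Y" using RY(3) by (rule card_primes_in_le_self)
      have e1: "C * S \<le> \<eta> * N"
      proof -
        have "C * S \<le> C * sqrt N" using C SR RY(6) by (intro mult_left_mono) auto
        then show ?thesis using elim by simp
      qed
      \<comment> \<open>Trivial bounds for both counts would give \<open>R Y = N\<close>, the order
        of the main term. The zero density of the primes, applied up to \<open>R\<close>, supplies
        the small factor \<epsilon>.\<close>
      have e2: "2 * C * real (card (primes_in 0 Y)) * S \<le> \<eta> * N"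
      proof -
        have "2 * C * real (card (primes_in 0 Y)) * S \<le> 2 * C * Y * (\<epsilon> * R)"
          using C S cY RY(3) by (intro mult_mono) auto
        also have "\<dots> = 2 * C * \<epsilon> * (R * Y)" by simp
        also have "\<dots> \<le> \<eta> * N" unfolding RY(5) using \<epsilon>(4) by (intro mult_right_mono) auto
        finally show ?thesis .
      qed
      have e3: "C * L * real (card (primes_in 0 N)) \<le> N * w0 * L / 128"
      proof -
        have "C * L * real (card (primes_in 0 N)) \<le> C * L * (\<epsilon> * N)"
          using C L elim by (intro mult_left_mono) auto
        also have "\<dots> = C * \<epsilon> * (L * N)" by simp
        also have "\<dots> \<le> w0 / 128 * (L * N)" using \<epsilon>(3) L by (intro mult_right_mono) auto
        finally show ?thesis by (simp add: mult_ac)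
      qed
      have e4: "8 * C * S * (sqrt N * (1 + ln N)) \<le> \<eta> * N"
      proof -
        have "8 * C * S * (sqrt N * (1 + ln N)) \<le> 8 * C * R * (sqrt N * (1 + ln N))"
          using C SR N by (intro mult_right_mono mult_left_mono) auto
        also have "\<dots> = 8 * C * ((R * sqrt N) * (1 + ln N))" by simp
        also have "\<dots> \<le> \<eta> * N" unfolding RY(7) using elim by simp
        finally show ?thesis .
      qed
      have e5: "\<eta> * N \<le> N * w0 * L / 128"
      proof -
        have "w0 * c / 128 * N \<le> w0 * L / 128 * N" using L w0 by (intro mult_right_mono divide_right_mono mult_left_mono) auto
        then show ?thesis by (simp add: \<eta>_def mult_ac)
      qed
      \<comment> \<open>The main term keeps the factor \<open>1 - 1/16 - 7/8 = 1/16\<close>; the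
        four errors take at most \<open>4/128\<close> of \<open>N w0 L\<close>, which leaves
        \<open>1/32\<close>.\<close>
      have "1 / P \<le> 1 / 16" using P by (intro divide_left_mono) auto
      then have "1 / 16 \<le> 1 - 1 / P - \<Lambda>" using \<Lambda> by linarith
      then have e6: "N * w0 * L * (1 / 16) \<le> N * w0 * L * (1 - 1 / P - \<Lambda>)"
        using w0 L by (intro mult_left_mono) auto
      have "N * w0 * L * (1 - 1 / P - \<Lambda>) - C * S - 2 * C * real (card (primes_in 0 Y)) * S
          - C * L * real (card (primes_in 0 N)) - 8 * C * S * (sqrt N * (1 + ln N))
         \<le> (\<Sum>n=1..N. f n * (excess (primes_in P R) (int n) * wave B (n / N)))"
        using correlation_lower_bound[OF N K B _ RY(1,2,3), of P f] P f
        unfolding C_def w0_def L_def S_def \<Lambda>_def by simp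
      then have "N * w0 * L / 32 \<le> (\<Sum>n=1..N. f n * (excess (primes_in P R) (int n) * wave B (n / N)))"
        using e1 e2 e3 e4 e5 e6 by linarith
      moreover have "N * w0 * L / 32 = N * L / (64 * (real B + 1))"
        by (simp add: w0_def)
      ultimately show "N * prime_recip P R / (64 * (real B + 1))
        \<le> (\<Sum>n=1..N. f n * (excess (primes_in P R) (int n) * wave B (n / N)))"
        unfolding L_def by simp
    qed
  qed
qed

lemma sum_even_symmetric:
  fixes h :: "int \<Rightarrow> real"
  assumes "\<And>n. h (- n) = h n" "h 0 = 0"
  shows "(\<Sum>n=- int N..int N. h n) = 2 * (\<Sum>n=1..N. h (int n))"
proof (induction N)
  case (Suc N)
  have "{- int (Suc N)..int (Suc N)} = insert (- int (Suc N)) (insert (int (Suc N)) {- int N..int N})"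
    by auto
  then have "(\<Sum>n=- int (Suc N)..int (Suc N). h n) = h (- int (Suc N)) + (h (int (Suc N)) + (\<Sum>n=- int N..int N. h n))"
    by simp
  then show ?case using Suc by (simp add: assms(1) del: of_nat_Suc)
qed (simp add: assms)

text \<open>With \<open>L\<close> the reciprocal sum and \<open>W\<close> the total weight, of size
  at least \<open>b Q\<close>, the pairing has size at least \<open>W N L\<close> and the norm at
  most \<open>W N L\<close>, up to constants. Squaring the first and dividing by the second leaves
  \<open>W N L\<close>.\<close>

lemma variance_lower_bound_primes:
  assumes \<delta>: "0 < \<delta>" "\<delta> \<le> 1 / 4" and c: "c > 0" and w: "w \<in> {omega, Omega}"
  shows "\<exists>\<kappa>>0. eventually (\<lambda>N. \<forall>Q. real N powr (1 / 2 + \<delta>) \<le> Q \<longrightarrow> Q \<le> real N \<longrightarrow> 16 \<le> 8 * real N / Q \<longrightarrow>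
    c \<le> prime_recip (8 * real N / Q) (real N powr (1 / 2 - \<delta> / 2)) \<longrightarrow>
    \<kappa> * (Q * real N * prime_recip (8 * real N / Q) (real N powr (1 / 2 - \<delta> / 2))) \<le> V N Q (\<lambda>n. of_nat (w n))) sequentially"
    (is "\<exists>\<kappa>>0. eventually (?E \<kappa>) sequentially")
proof -
  \<comment> \<open>Since \<open>R / Q \<le> N powr (- 3/2 \<delta>)\<close>,
    \<open>A \<delta> \<ge> 2\<close> pushes \<open>(R / Q) ^ A\<close> below
    \<open>N powr (-2)\<close>, which beats the factor \<open>N\<close> in
    \<open>off_diagonal_bound\<close>.\<close>
  define A where "A = nat \<lceil>2 / \<delta>\<rceil>"
  define B where "B = A + 1"
  have A\<delta>: "2 \<le> real A * \<delta>"
  proof -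
    have "2 / \<delta> \<le> real A" unfolding A_def by (rule real_nat_ceiling_ge)
    then show ?thesis using \<delta> by (simp add: field_simps)
  qed
  have AB: "1 \<le> A" "A < B" "B \<ge> 1" using A\<delta> by (auto simp: B_def Suc_le_eq intro: ccontr)
  define D where "D = 8 * (4 * 10 ^ (5 * B) * (20 * real B) ^ A)"
  have D: "D \<ge> 0" by (simp add: D_def)
  define b where "b = (1 / 8 :: real) ^ (2 * B) / 8"
  have b: "b > 0" by (simp add: b_def)
  define d where "d = 1 / (64 * (real B + 1))"
  have d: "d > 0" by (simp add: d_def)
  \<comment> \<open>\<open>12 = 2 * 6\<close> comes from \<open>W + 1 \<le> 2 W\<close> and the
    bound \<open>6 N L\<close> for the sum of \<open>\<beta>^2\<close>; \<open>3 / c\<close> comes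
    from \<open>2 N + 1 \<le> 3 N\<close> and \<open>L \<ge> c\<close>.\<close>
  define \<kappa>' where "\<kappa>' = 12 + 3 / c"
  have \<kappa>': "\<kappa>' > 0" using c by (simp add: \<kappa>'_def add_pos_pos)
  have ev: "eventually (\<lambda>x::real. D \<le> x \<and> 2 * A \<le> sqrt x \<and> 8 \<le> sqrt x \<and> 1 \<le> b * sqrt x \<and>
      2 * ln x \<le> b * c * d / 2 * sqrt x) at_top"
  proof (intro eventually_conj)
    have "b * c * d / 2 > 0" using b c d by simp
    then show "eventually (\<lambda>x::real. 2 * ln x \<le> b * c * d / 2 * sqrt x) at_top" by real_asymp
    show "eventually (\<lambda>x::real. 1 \<le> b * sqrt x) at_top" using b by real_asymp
  qed real_asymp+
  have "eventually (?E (b * d\<^sup>2 / (4 * \<kappa>'))) sequentially"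
    using eventually_correlation_lower_bound[OF \<delta> c AB(3)]
      eventually_compose_filterlim[OF ev filterlim_real_sequentially] eventually_ge_at_top[of 1]
  proof eventually_elim
    case (elim N)
    define R where "R = real N powr (1 / 2 - \<delta> / 2)"
    have N: "N \<ge> 1" "real N \<ge> 1" using elim by auto
    note big = elim(2)
    show ?case unfolding R_def[symmetric]
    proof (intro allI impI)
      fix Q :: real
      assume Q1: "real N powr (1 / 2 + \<delta>) \<le> Q" and Q2: "Q \<le> real N" and P16: "16 \<le> 8 * real N / Q"
        and cL: "c \<le> prime_recip (8 * real N / Q) R"
      define P where "P = 8 * real N / Q"
      define L where "L = prime_recip P R"
      define f where "f n = real (w n)" for n
      define \<beta> where "\<beta> m = excess (primes_in P R) m * wave B (real_of_int m / real N)" for m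
      define W where "W = (\<Sum>q=1..nat \<lfloor>Q\<rfloor>. bump B (real q / Q))"
      have L: "c \<le> L" "0 < L" using cL c by (auto simp: L_def P_def)
      have sQ: "sqrt N \<le> Q"
        using Q1 powr_mono[of "1 / 2" "1 / 2 + \<delta>" "real N"] N \<delta> by (simp add: powr_half_sqrt)
      have "b * sqrt N \<le> b * Q" using sQ b by (intro mult_left_mono) auto
      with sQ big have Q: "Q \<ge> 8" "Q \<ge> real (2 * A)" "Q \<ge> 1" "b * Q \<ge> 1" by auto
      have R: "0 \<le> R" "R \<le> Q" "R \<le> N"
        using Q1 Q2 powr_mono[of "1 / 2 - \<delta> / 2" "1 / 2 + \<delta>" "real N"] N \<delta> by (auto simp: R_def)
      have bW: "b * Q \<le> W" unfolding W_def b_def using sum_bump_ge[OF Q(1), of B] by simp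
      have W1: "W \<ge> 1" using bW Q by simp
      have off_small: "D * (N * (R / Q) ^ A) \<le> 1"
      proof -
        have "R / Q \<le> R / real N powr (1 / 2 + \<delta>)" using Q1 R N Q by (intro divide_left_mono) auto
        also have "\<dots> = real N powr (- (3 / 2 * \<delta>))"
          unfolding R_def using N by (simp add: powr_diff[symmetric] algebra_simps)
        finally have "(R / Q) ^ A \<le> (real N powr (- (3 / 2 * \<delta>))) ^ A"
          using R Q by (intro power_mono) auto
        also have "\<dots> = real N powr (- (3 / 2 * \<delta>) * A)"
          using N by (simp add: powr_realpow[symmetric] powr_powr)
        also have "\<dots> \<le> real N powr (- 2)" using N A\<delta> by (intro powr_mono) (auto simp: algebra_simps)
        also have "\<dots> = 1 / (real N)\<^sup>2" using N by (simp add: powr_minus powr_numeral divide_inverse)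
        finally have "D * (N * (R / Q) ^ A) \<le> D * (N * (1 / (real N)\<^sup>2))"
          using D N by (intro mult_left_mono) auto
        also have "\<dots> = D / N" using N by (simp add: power2_eq_square)
        also have "\<dots> \<le> 1" using big N by simp
        finally show ?thesis .
      qed
      have off: "\<bar>\<Sum>q=1..nat \<lfloor>Q\<rfloor>. bump B (real q / Q) * (\<Sum>m\<in>{m\<in>{- int N..int N}. int q dvd m - n} - {n}. \<beta> m)\<bar> \<le> 1"
        if n: "n \<in> {- int N..int N}" for n
      proof -
        have "real (4 * N) / Q \<le> P" using N Q by (simp add: P_def divide_right_mono)
        from off_diagonal_bound[OF Q(3,2) AB(1,2) N(1) n this R(1,2)]
        show ?thesis using off_small unfolding \<beta>_def D_def by linarith
      qed
      obtain K where K: "K \<ge> 1" "\<forall>n\<in>{1..N}. f n = (\<Sum>p\<in>primes_in 0 N. \<Sum>k=1..K. if p ^ k dvd n then 1 else 0)"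
        using prime_power_representation[OF w N(1)] unfolding f_def by blast
      have corr: "real N * L * d \<le> (\<Sum>n=1..N. f n * \<beta> (int n))"
        using elim(1)[rule_format, of P K f] P16 K cL unfolding \<beta>_def d_def L_def P_def R_def by simp
      have f_le: "0 \<le> f n" "n \<in> {1..N} \<Longrightarrow> f n \<le> 2 * ln N" for n
      proof -
        show "0 \<le> f n" by (simp add: f_def)
        assume n: "n \<in> {1..N}"
        then have "f n \<le> real (Omega n)" using w omega_le_Omega[of n] by (auto simp: f_def)
        also have "\<dots> \<le> 2 * ln n" using n by (intro Omega_le_ln) auto
        also have "\<dots> \<le> 2 * ln N" using n by simp
        finally show "f n \<le> 2 * ln N" .
      qed
      \<comment> \<open>The off-diagonal loss is at most \<open>2 N ln N\<close>, negligible against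
        \<open>W N L\<close> because \<open>W \<ge> b Q \<ge> b sqrt N\<close> and
        \<open>L \<ge> c\<close>.\<close>
      have "(\<Sum>n=1..N. f n) \<le> (\<Sum>n=1..N. 2 * ln N)" using f_le by (intro sum_mono) auto
      also have "\<dots> = real N * (2 * ln N)" by simp
      also have "\<dots> \<le> real N * (b * c * d / 2 * Q)"
      proof (intro mult_left_mono)
        have "b * c * d / 2 * sqrt N \<le> b * c * d / 2 * Q" using sQ b c d by (intro mult_left_mono) auto
        then show "2 * ln (real N) \<le> b * c * d / 2 * Q" using big by linarith
      qed auto
      also have "\<dots> = (b * Q) * (real N * (c * d / 2))" by simp
      also have "\<dots> \<le> W * (real N * (L * d / 2))"
        using bW L c d N Q W1 by (intro mult_mono) auto
      finally have sumf: "(\<Sum>n=1..N. f n) \<le> W * (real N * (L * d / 2))" .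
      have "W * (real N * L * d) \<le> W * (\<Sum>n=1..N. f n * \<beta> (int n))"
        using corr W1 by (intro mult_left_mono) auto
      then have num: "W * N * L * d / 2 \<le> W * (\<Sum>n=1..N. f n * \<beta> (int n)) - (\<Sum>n=1..N. f n)"
        using sumf by (simp add: algebra_simps)
      have num0: "0 \<le> W * N * L * d / 2" using W1 L d by simp
      have \<beta>_odd: "\<beta> (- n) = - \<beta> n" for n by (simp add: \<beta>_def excess_minus wave_minus)
      have "(\<Sum>n=- int N..int N. (\<beta> n)\<^sup>2) = 2 * (\<Sum>n=1..N. (\<beta> (int n))\<^sup>2)"
        by (rule sum_even_symmetric) (auto simp: \<beta>_odd, simp add: \<beta>_def)
      also have "(\<Sum>n=1..N. (\<beta> (int n))\<^sup>2) \<le> (\<Sum>n=1..N. (excess (primes_in P R) (int n))\<^sup>2)"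
      proof (rule sum_mono)
        fix n assume "n \<in> {1..N}"
        then have "\<bar>wave B (real n / real N)\<bar> \<le> 1" by (intro abs_wave_le_1) auto
        then show "(\<beta> (int n))\<^sup>2 \<le> (excess (primes_in P R) (int n))\<^sup>2"
          unfolding \<beta>_def by (intro abs_le_square_iff[THEN iffD1]) (simp add: abs_mult mult_left_le)
      qed
      also have "\<dots> \<le> N * L + 2 * L * card (primes_in P R)"
        unfolding L_def by (rule turan_kubilius) (auto dest: primes_inD)
      also have "\<dots> \<le> N * L + 2 * L * N"
      proof -
        have "real (card (primes_in P R)) \<le> N" using card_primes_in_le_self[OF R(1)] R(3) by (rule order.trans)
        then show ?thesis using L by (intro add_left_mono mult_left_mono) auto
      qed
      finally have b2: "(\<Sum>n=- int N..int N. (\<beta> n)\<^sup>2) \<le> 6 * (N * L)" by (simp add: mult.commute)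
      have den: "(W + 1) * (\<Sum>n=- int N..int N. (\<beta> n)\<^sup>2) + (2 * real N + 1) \<le> W * N * L * \<kappa>'"
      proof -
        have "(W + 1) * (\<Sum>n=- int N..int N. (\<beta> n)\<^sup>2) \<le> (2 * W) * (6 * (N * L))"
          using b2 W1 L by (intro mult_mono sum_nonneg) auto
        moreover have "2 * real N + 1 \<le> W * N * L * (3 / c)"
        proof -
          have "1 * (3 * real N) \<le> W * (L / c) * (3 * real N)"
            using W1 L c mult_mono[of 1 W 1 "L / c"] by (intro mult_right_mono) auto
          then show ?thesis using N by (simp add: mult_ac)
        qed
        ultimately show ?thesis unfolding \<kappa>'_def by (simp add: algebra_simps)
      qed
      have "(W * N * L * d / 2)\<^sup>2 \<le> (W * (\<Sum>n=1..N. f n * \<beta> (int n)) - (\<Sum>n=1..N. f n))\<^sup>2"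
        using num num0 by (intro power_mono) auto
      also have "\<dots> \<le> V N Q (\<lambda>n. of_real (f n)) * ((W + 1) * (\<Sum>n=- int N..int N. (\<beta> n)\<^sup>2) + (2 * real N + 1))"
        unfolding W_def
        by (rule V_ge_odd_test) (use off \<beta>_odd num num0 Q f_le AB in \<open>auto simp: bump_nonneg bump_le_1 W_def\<close>)
      also have "\<dots> \<le> V N Q (\<lambda>n. of_real (f n)) * (W * N * L * \<kappa>')"
        by (intro mult_left_mono den V_nonneg)
      finally have main: "(W * N * L * d / 2)\<^sup>2 \<le> V N Q (\<lambda>n. of_real (f n)) * (W * N * L * \<kappa>')" .
      have WNL: "W * N * L > 0" using W1 N L by simp
      have "(W * N * L) * (W * N * L * d\<^sup>2 / 4) \<le> (W * N * L) * (V N Q (\<lambda>n. of_real (f n)) * \<kappa>')"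
        using main by (simp add: power2_eq_square mult_ac)
      then have "W * N * L * d\<^sup>2 / 4 \<le> V N Q (\<lambda>n. of_real (f n)) * \<kappa>'"
        using WNL by (simp only: mult_le_cancel_left_pos)
      then have Vge: "W * N * L * d\<^sup>2 / (4 * \<kappa>') \<le> V N Q (\<lambda>n. of_real (f n))"
        using \<kappa>' by (simp add: field_simps)
      have "b * d\<^sup>2 / (4 * \<kappa>') * (Q * real N * L) = (b * Q) * (N * L * d\<^sup>2 / (4 * \<kappa>'))" by simp
      also have "\<dots> \<le> W * (N * L * d\<^sup>2 / (4 * \<kappa>'))"
        using bW L \<kappa>' by (intro mult_right_mono) auto
      also have "\<dots> = W * N * L * d\<^sup>2 / (4 * \<kappa>')" by simp
      finally have "b * d\<^sup>2 / (4 * \<kappa>') * (Q * real N * L) \<le> V N Q (\<lambda>n. of_real (f n))"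
        using Vge by linarith
      then show "b * d\<^sup>2 / (4 * \<kappa>') * (Q * real N * prime_recip (8 * real N / Q) R) \<le> V N Q (\<lambda>n. of_nat (w n))"
        unfolding L_def P_def f_def by simp
    qed
  qed
  moreover have "b * d\<^sup>2 / (4 * \<kappa>') > 0" using b d \<kappa>' by simp
  ultimately show ?thesis by blast
qed

section \<open>Sine sums\<close>

lemma sin_pi_mult_ge:
  assumes "0 \<le> x" "x \<le> 1 / 2"
  shows "x \<le> sin (pi * x)"
proof (cases "x \<ge> 1 / 6")
  case True
  have "sin (pi / 6) \<le> sin (pi * x)"
    using True assms by (intro sin_monotone_2pi_le) (auto simp: field_simps)
  then show ?thesis using assms by (simp add: sin_30)
next
  case False
  show ?thesis
  proof (cases "x = 0")
    case False
    then have pos: "0 < pi * x" using assms by simp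
    have "\<exists>z>0. z < pi * x \<and> sin (pi * x) - sin 0 = (pi * x - 0) * cos z"
      by (rule MVT2[OF pos]) (auto intro: derivative_eq_intros)
    then obtain z where z: "0 < z" "z < pi * x" "sin (pi * x) = pi * x * cos z" by auto
    have "pi * x \<le> pi * (1 / 6)" using \<open>\<not> x \<ge> 1 / 6\<close> by (intro mult_left_mono) auto
    then have "z \<le> pi / 3" using z(2) pi_gt_zero by linarith
    then have "cos (pi / 3) \<le> cos z" using z(1) by (intro cos_monotone_0_pi_le) auto
    then have "1 / 2 \<le> cos z" by (simp add: cos_60)
    then have "pi * x * (1 / 2) \<le> sin (pi * x)" unfolding z(3) using assms by (intro mult_left_mono) auto
    moreover have "2 * x \<le> pi * x" using pi_ge_two assms by (intro mult_right_mono) auto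
    ultimately show ?thesis by linarith
  qed simp
qed

text \<open>Geometric sum with ratio \<open>z = cis (2 pi x)\<close>, where
  \<open>norm (1 - z) = 2 \<bar>sin (pi x)\<bar>\<close> is at least
  \<open>2 \<bar>x\<bar>\<close>.\<close>

lemma norm_sum_cis_le:
  assumes "x \<noteq> 0" "\<bar>x\<bar> \<le> 1 / 2"
  shows "norm (\<Sum>u<m. cis (real u * (2 * pi * x))) \<le> 1 / \<bar>x\<bar>"
proof -
  define z where "z = cis (2 * pi * x)"
  have "\<bar>x\<bar> \<le> sin (pi * \<bar>x\<bar>)" using assms by (intro sin_pi_mult_ge) auto
  also have "\<dots> = \<bar>sin (pi * x)\<bar>"
  proof -
    have "0 \<le> sin (pi * \<bar>x\<bar>)" using \<open>\<bar>x\<bar> \<le> sin (pi * \<bar>x\<bar>)\<close> by linarith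
    then show ?thesis by (cases "x \<ge> 0") auto
  qed
  finally have s: "\<bar>x\<bar> \<le> \<bar>sin (pi * x)\<bar>" .
  have "(norm (1 - z))\<^sup>2 = (1 - cos (2 * (pi * x)))\<^sup>2 + (sin (2 * (pi * x)))\<^sup>2"
    unfolding cmod_power2 z_def by (simp add: mult.assoc)
  also have "\<dots> = (2 * sin (pi * x))\<^sup>2 * ((sin (pi * x))\<^sup>2 + (cos (pi * x))\<^sup>2)"
  proof -
    have "(1 - (1 - 2 * s\<^sup>2))\<^sup>2 + (2 * s * c)\<^sup>2 = (2 * s)\<^sup>2 * (s\<^sup>2 + c\<^sup>2)" for s c :: real
      by (simp add: power2_eq_square algebra_simps)
    then show ?thesis unfolding cos_double_sin sin_double .
  qed
  also have "\<dots> = (2 * sin (pi * x))\<^sup>2" by simp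
  finally have "norm (1 - z) = \<bar>2 * sin (pi * x)\<bar>"
    by (metis norm_ge_zero abs_of_nonneg real_sqrt_abs)
  then have n1: "2 * \<bar>x\<bar> \<le> norm (1 - z)" using s by (simp add: abs_mult)
  then have z1: "z \<noteq> 1" using assms by auto
  have "cis (real u * (2 * pi * x)) = z ^ u" for u
    unfolding z_def by (rule Complex.DeMoivre[symmetric])
  then have "(\<Sum>u<m. cis (real u * (2 * pi * x))) = (\<Sum>u<m. z ^ u)"
    by (simp only:)
  also have "\<dots> = (1 - z ^ m) / (1 - z)" using z1 by (simp add: sum_gp_strict)
  also have "norm \<dots> = norm (1 - z ^ m) / norm (1 - z)" by (rule norm_divide)
  also have "\<dots> \<le> 2 / (2 * \<bar>x\<bar>)"
  proof (rule frac_le)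
    have "norm (1 - z ^ m) \<le> norm (1::complex) + norm (z ^ m)" by (rule norm_triangle_ineq4)
    then show "norm (1 - z ^ m) \<le> 2" by (simp add: z_def norm_power)
  qed (use n1 assms in auto)
  finally show ?thesis using assms by simp
qed

lemma sum_cos_sin_squared:
  "(\<Sum>i\<in>I. cos (x i))\<^sup>2 + (\<Sum>i\<in>I. sin (x i))\<^sup>2 = (\<Sum>i\<in>I. \<Sum>j\<in>I. cos (x i - x j :: real))"
  by (simp add: power2_eq_square sum_product cos_diff sum.distrib)

lemma norm_sum_cis_squared:
  "(norm (\<Sum>u\<in>I. cis (x u)))\<^sup>2 = (\<Sum>u\<in>I. \<Sum>v\<in>I. cos (x u - x v))"
  unfolding sum_cos_sin_squared[symmetric] by (simp add: cmod_power2)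

lemma sum_inverse_squares_le:
  assumes "D \<ge> 1"
  shows "(\<Sum>d=D+1..M. 1 / (real d)\<^sup>2) \<le> 1 / real D"
proof -
  have "(\<Sum>d=D+1..M. 1 / (real d)\<^sup>2) \<le> 1 / real D - 1 / real M" if "D \<le> M"
    using that
  proof (induction M rule: dec_induct)
    case (step M)
    have "1 / (real (Suc M))\<^sup>2 \<le> 1 / (real M * real (Suc M))"
      using step assms by (intro divide_left_mono) (auto simp: power2_eq_square)
    also have "\<dots> = 1 / real M - 1 / real (Suc M)" using step assms by (simp add: field_simps)
    finally show ?case using step by simp
  qed simp
  moreover have "0 \<le> 1 / real M" "0 \<le> 1 / real D" by auto
  ultimately show ?thesis by (cases "D \<le> M") (linarith, simp)
qed

text \<open>A given distance from \<open>q\<close> occurs at most once on each side. The conditional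
  is the absolute difference, written so as to avoid truncated subtraction.\<close>

lemma sum_distances_le:
  fixes h :: "nat \<Rightarrow> real"
  assumes "\<And>d. 0 \<le> h d" "q \<in> {2..M}"
  shows "(\<Sum>q'=2..M. h (if q' \<le> q then q - q' else q' - q)) \<le> 2 * (\<Sum>d\<le>M. h d)"
proof -
  have "(\<Sum>q'=2..M. h (if q' \<le> q then q - q' else q' - q)) =
     (\<Sum>q'=2..q. h (if q' \<le> q then q - q' else q' - q)) + (\<Sum>q'=q+1..M. h (if q' \<le> q then q - q' else q' - q))"
    using assms(2) by (subst sum.union_disjoint[symmetric]) (auto intro!: sum.cong)
  also have "(\<Sum>q'=2..q. h (if q' \<le> q then q - q' else q' - q)) = (\<Sum>d\<in>(\<lambda>q'. q - q') ` {2..q}. h d)"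
    by (subst sum.reindex) (auto simp: inj_on_def intro!: sum.cong)
  also have "\<dots> \<le> (\<Sum>d\<le>M. h d)" using assms by (intro sum_mono2) auto
  also have "(\<Sum>q'=q+1..M. h (if q' \<le> q then q - q' else q' - q)) = (\<Sum>d\<in>(\<lambda>q'. q' - q) ` {q+1..M}. h d)"
    by (subst sum.reindex) (auto simp: inj_on_def intro!: sum.cong)
  also have "\<dots> \<le> (\<Sum>d\<le>M. h d)" using assms by (intro sum_mono2) auto
  finally show ?thesis by simp
qed

text \<open>A large sieve estimate for the frequencies \<open>1 / q\<close>, whose gaps are at least \<open>1 / M\<^sup>2\<close>.\<close>

lemma sine_sum_second_moment:
  fixes N M :: nat
  assumes N: "N \<ge> 1" and MN: "real N \<le> (real M)\<^sup>2"
  shows "(\<Sum>n=1..N. (\<Sum>q=2..M. sin (2 * pi * real n / real q))\<^sup>2) \<le> 34 * real M ^ 3"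
proof -
  define a where "a q = 2 * pi / real q" for q :: nat
  \<comment> \<open>The squared modulus of the full exponential sum at \<open>t\<close>: with the
    cosine part added, the square expands into cosines of frequency differences.\<close>
  define H where "H t = (\<Sum>q=2..M. cos (t * a q))\<^sup>2 + (\<Sum>q=2..M. sin (t * a q))\<^sup>2" for t :: real
  have H0: "0 \<le> H t" for t by (simp add: H_def)
  \<comment> \<open>Frequencies with \<open>\<bar>q - q'\<bar> \<le> D\<close> may be closer than
    about \<open>1 / N\<close>, and for these the kernel is bounded trivially by \<open>2 N\<close>.
    Beyond \<open>D\<close> the geometric sum gives \<open>M^2 / \<bar>q - q'\<bar>\<close>.\<close>
  define D where "D = nat \<lceil>(real M)\<^sup>2 / N\<rceil>"
  define h where "h d = (if d \<le> D then 4 * (real N)\<^sup>2 else real M ^ 4 / (real d)\<^sup>2)" for d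
  have h0: "0 \<le> h d" for d by (simp add: h_def)
  have M1: "real M \<ge> 1" using N MN by (cases M) auto
  have MN1: "1 \<le> (real M)\<^sup>2 / N" using N MN by simp
  have D: "(real M)\<^sup>2 / N \<le> real D" "real D \<le> 2 * ((real M)\<^sup>2 / N)" "D \<ge> 1"
  proof -
    show 1: "(real M)\<^sup>2 / N \<le> real D" unfolding D_def by (rule real_nat_ceiling_ge)
    have "real D = real_of_int \<lceil>(real M)\<^sup>2 / N\<rceil>" unfolding D_def using MN1 by simp
    also have "\<dots> \<le> (real M)\<^sup>2 / N + 1" by linarith
    finally show "real D \<le> 2 * ((real M)\<^sup>2 / N)" using MN1 by linarith
    show "D \<ge> 1" using 1 MN1 by linarith
  qed
  have pair: "(norm (\<Sum>u<2 * N. cis (real u * (a q - a q'))))\<^sup>2 \<le> h (if q' \<le> q then q - q' else q' - q)"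
    if q: "q \<in> {2..M}" "q' \<in> {2..M}" for q q'
  proof -
    define e where "e = (if q' \<le> q then q - q' else q' - q)"
    show ?thesis
    proof (cases "e \<le> D")
      case True
      have "norm (\<Sum>u<2 * N. cis (real u * (a q - a q'))) \<le> (\<Sum>u<2 * N. 1)"
        by (rule order.trans[OF norm_sum]) simp
      also have "\<dots> = 2 * real N" by simp
      finally have "(norm (\<Sum>u<2 * N. cis (real u * (a q - a q'))))\<^sup>2 \<le> (2 * real N)\<^sup>2" by (intro power_mono) auto
      then show ?thesis using True unfolding e_def[symmetric] by (simp add: h_def power2_eq_square)
    next
      case False
      then have e0: "real e > 0" by simp
      define x where "x = 1 / real q - 1 / real q'"
      have xe: "\<bar>x\<bar> = real e / (real q * real q')"
        using q by (auto simp: x_def e_def field_simps abs_if of_nat_diff)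
      have "1 / real q \<le> 1 / 2" "1 / real q' \<le> 1 / 2" "0 \<le> 1 / real q" "0 \<le> 1 / real q'" using q by auto
      then have x2: "\<bar>x\<bar> \<le> 1 / 2" unfolding x_def by linarith
      have x0: "\<bar>x\<bar> > 0" unfolding xe using e0 q by simp
      have "real e / (real M)\<^sup>2 \<le> \<bar>x\<bar>"
        unfolding xe power2_eq_square using q by (intro divide_left_mono mult_mono) auto
      then have "1 / \<bar>x\<bar> \<le> 1 / (real e / (real M)\<^sup>2)" using e0 M1 x0
        by (intro divide_left_mono mult_pos_pos divide_pos_pos) auto
      moreover have "norm (\<Sum>u<2 * N. cis (real u * (2 * pi * x))) \<le> 1 / \<bar>x\<bar>"
        using x0 x2 by (intro norm_sum_cis_le) auto
      moreover have "a q - a q' = 2 * pi * x" by (simp add: a_def x_def right_diff_distrib)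
      ultimately have "norm (\<Sum>u<2 * N. cis (real u * (a q - a q'))) \<le> (real M)\<^sup>2 / real e" by simp
      then have "(norm (\<Sum>u<2 * N. cis (real u * (a q - a q'))))\<^sup>2 \<le> ((real M)\<^sup>2 / real e)\<^sup>2"
        by (intro power_mono) auto
      then show ?thesis using False unfolding e_def[symmetric] by (simp add: h_def power_divide flip: power_mult)
    qed
  qed
  have sumh: "(\<Sum>d\<le>M. h d) \<le> 17 * ((real M)\<^sup>2 * N)"
  proof -
    have "(\<Sum>d\<le>M. h d) \<le> (\<Sum>d\<in>{..D} \<union> {D+1..M}. h d)" using h0 by (intro sum_mono2) auto
    also have "\<dots> = (\<Sum>d\<le>D. h d) + (\<Sum>d=D+1..M. h d)" by (rule sum.union_disjoint) auto
    also have "(\<Sum>d\<le>D. h d) = (real D + 1) * (4 * (real N)\<^sup>2)" by (simp add: h_def)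
    also have "\<dots> \<le> (2 * (2 * ((real M)\<^sup>2 / N))) * (4 * (real N)\<^sup>2)"
      using D by (intro mult_right_mono) auto
    also have "\<dots> = 16 * ((real M)\<^sup>2 * N)" using N by (simp add: power2_eq_square)
    also have "(\<Sum>d=D+1..M. h d) = real M ^ 4 * (\<Sum>d=D+1..M. 1 / (real d)\<^sup>2)"
      by (simp add: h_def sum_distrib_left)
    also have "\<dots> \<le> real M ^ 4 * (1 / real D)"
      using sum_inverse_squares_le[OF D(3)] by (intro mult_left_mono) auto
    also have "\<dots> \<le> real M ^ 4 * (1 / ((real M)\<^sup>2 / N))"
      using D M1 N by (intro mult_left_mono divide_left_mono) auto
    also have "\<dots> = (real M)\<^sup>2 * N" using M1 by (simp add: power2_eq_square power4_eq_xxxx)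
    finally show ?thesis by (simp add: mult.commute)
  qed
  \<comment> \<open>Averaging over shifts: every \<open>n\<close> in \<open>{1..N}\<close> is
    \<open>u - v\<close> for at least \<open>N\<close> pairs with \<open>u, v < 2 N\<close>, and
    \<open>H\<close> is nonnegative. The double sum yields the square of a geometric sum, a Fejer
    kernel, whose decay like \<open>1 / d^2\<close> is summable over \<open>d\<close>.\<close>
  have "real N * (\<Sum>n=1..N. (\<Sum>q=2..M. sin (2 * pi * real n / real q))\<^sup>2) \<le> real N * (\<Sum>n=1..N. H (real n))"
    by (intro mult_left_mono sum_mono) (auto simp: H_def a_def mult.commute)
  also have "\<dots> = (\<Sum>v<N. \<Sum>n=1..N. H (real n))" by simp
  also have "\<dots> \<le> (\<Sum>v<2 * N. \<Sum>u<2 * N. H (real u - real v))"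
  proof -
    have "(\<Sum>n=1..N. H (real n)) \<le> (\<Sum>u<2 * N. H (real u - real v))" if v: "v < N" for v
    proof -
      have "(\<Sum>n=1..N. H (real n)) = (\<Sum>u=v+1..v+N. H (real u - real v))"
        by (rule sum.reindex_bij_witness[of _ "\<lambda>u. u - v" "\<lambda>n. n + v"]) (auto simp: of_nat_diff)
      also have "\<dots> \<le> (\<Sum>u<2 * N. H (real u - real v))"
        using v H0 by (intro sum_mono2) auto
      finally show ?thesis .
    qed
    then have "(\<Sum>v<N. \<Sum>n=1..N. H (real n)) \<le> (\<Sum>v<N. \<Sum>u<2 * N. H (real u - real v))"
      by (intro sum_mono) auto
    also have "\<dots> \<le> (\<Sum>v<2 * N. \<Sum>u<2 * N. H (real u - real v))"
      using H0 by (intro sum_mono2 sum_nonneg) auto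
    finally show ?thesis .
  qed
  also have "\<dots> = (\<Sum>v<2 * N. \<Sum>u<2 * N. \<Sum>q=2..M. \<Sum>q'=2..M. cos ((real u - real v) * (a q - a q')))"
    unfolding H_def sum_cos_sin_squared by (simp add: right_diff_distrib)
  also have "\<dots> = (\<Sum>v<2 * N. \<Sum>q=2..M. \<Sum>q'=2..M. \<Sum>u<2 * N. cos ((real u - real v) * (a q - a q')))"
    by (rule sum.cong[OF refl], rule trans[OF sum.swap], rule sum.cong[OF refl], rule sum.swap)
  also have "\<dots> = (\<Sum>q=2..M. \<Sum>q'=2..M. \<Sum>v<2 * N. \<Sum>u<2 * N. cos ((real u - real v) * (a q - a q')))"
    by (rule trans[OF sum.swap], rule sum.cong[OF refl], rule sum.swap)
  also have "\<dots> = (\<Sum>q=2..M. \<Sum>q'=2..M. \<Sum>u<2 * N. \<Sum>v<2 * N. cos ((real u - real v) * (a q - a q')))"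
    by (rule sum.cong[OF refl], rule sum.cong[OF refl], rule sum.swap)
  also have "\<dots> = (\<Sum>q=2..M. \<Sum>q'=2..M. (norm (\<Sum>u<2 * N. cis (real u * (a q - a q'))))\<^sup>2)"
    unfolding norm_sum_cis_squared by (simp add: left_diff_distrib)
  also have "\<dots> \<le> (\<Sum>q=2..M. \<Sum>q'=2..M. h (if q' \<le> q then q - q' else q' - q))"
    by (intro sum_mono pair)
  also have "\<dots> \<le> (\<Sum>q=2..M. 2 * (\<Sum>d\<le>M. h d))"
    by (intro sum_mono sum_distances_le h0)
  also have "\<dots> \<le> real M * (2 * (\<Sum>d\<le>M. h d))"
    using h0 by (simp add: mult_right_mono sum_nonneg)
  also have "\<dots> \<le> real M * (2 * (17 * ((real M)\<^sup>2 * N)))"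
    using sumh by (intro mult_left_mono) auto
  also have "\<dots> = real N * (34 * real M ^ 3)" by (simp add: power2_eq_square power3_eq_cube)
  finally show ?thesis using N by simp
qed

section \<open>First moment of the sine sums\<close>

lemma sum_sin_eq:
  fixes q :: real and N :: nat
  shows "2 * sin (pi / q) * (\<Sum>n=1..N. sin (2 * pi * n / q)) = cos (pi / q) - cos ((2 * real N + 1) * pi / q)"
proof (induction N)
  case (Suc N)
  have "2 * sin (pi / q) * sin (2 * pi * Suc N / q) = cos (2 * pi * Suc N / q - pi / q) - cos (2 * pi * Suc N / q + pi / q)"
    by (simp add: cos_add cos_diff)
  also have "2 * pi * Suc N / q - pi / q = (2 * real N + 1) * pi / q"
    by (simp add: diff_divide_distrib[symmetric] algebra_simps)
  also have "2 * pi * Suc N / q + pi / q = (2 * real (Suc N) + 1) * pi / q"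
    by (simp add: add_divide_distrib[symmetric] algebra_simps)
  finally show ?case using Suc by (simp add: distrib_left del: of_nat_Suc)
qed simp

lemma cos_plus_nat_2pi: "cos (x + real i * (2 * pi)) = cos x"
proof (induction i)
  case (Suc i)
  have "x + real (Suc i) * (2 * pi) = (x + real i * (2 * pi)) + 2 * pi" by (simp add: algebra_simps)
  then show ?case using Suc by (simp only: cos_periodic)
qed simp

lemma sin_pi_div_pos: "q \<ge> 2 \<Longrightarrow> 0 < sin (pi / real q)"
  by (intro sin_gt_zero) (auto simp: field_simps)

text \<open>Full periods cancel, so only \<open>r = N mod q\<close> matters. The end angle
  \<open>y = (2 r + 1) pi / q\<close> then lies between \<open>pi / q\<close> and
  \<open>2 pi - pi / q\<close>, where the cosine is at most \<open>cos (pi / q)\<close>. This allows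
  unwanted moduli to be dropped from lower bounds.\<close>

lemma sum_sin_nonneg:
  fixes N q :: nat
  assumes q: "q \<ge> 2"
  shows "0 \<le> (\<Sum>n=1..N. sin (2 * pi * n / real q))"
proof -
  define r where "r = N mod q"
  define y where "y = (2 * real r + 1) * pi / q"
  have r: "r < q" "N = q * (N div q) + r" using q by (auto simp: r_def)
  have "(2 * real N + 1) * pi / q = y + real (N div q) * (2 * pi)"
    by (subst r(2)) (use q in \<open>simp add: y_def field_simps\<close>)
  then have cosN: "cos ((2 * real N + 1) * pi / q) = cos y" by (simp only: cos_plus_nat_2pi)
  have "cos y \<le> cos (pi / q)"
  proof (cases "y \<le> pi")
    case True
    have "pi / q \<le> y" unfolding y_def by (intro divide_right_mono) auto
    then show ?thesis using True q by (intro cos_monotone_0_pi_le) auto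
  next
    case False
    have "2 * real r + 2 \<le> 2 * real q" using r(1) by linarith
    then have "(2 * real r + 2) * pi \<le> 2 * real q * pi" by (intro mult_right_mono) auto
    then have "pi / q \<le> 2 * pi - y" using q by (simp add: y_def field_simps)
    then have "cos (2 * pi - y) \<le> cos (pi / q)" using False q by (intro cos_monotone_0_pi_le) auto
    then show ?thesis by (simp add: cos_diff)
  qed
  then have "0 \<le> 2 * sin (pi / q) * (\<Sum>n=1..N. sin (2 * pi * n / real q))"
    unfolding sum_sin_eq cosN by simp
  then show ?thesis using sin_pi_div_pos[OF q] by (simp add: zero_le_mult_iff)
qed

text \<open>If the fractional part of \<open>N / q\<close> lies between \<open>1/4\<close> and
  \<open>1/2\<close>, the end angle falls where the cosine is not positive, while
  \<open>cos (pi / q) \<ge> 1/2\<close>. Division by \<open>2 sin (pi / q) \<le> 8 / q\<close>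
  produces the size \<open>q\<close>.\<close>

lemma sum_sin_ge:
  fixes N q i :: nat
  assumes q: "q \<ge> 3" and i: "real i + 1 / 4 \<le> N / real q" "N / real q \<le> real i + 1 / 2"
  shows "real q / 16 \<le> (\<Sum>n=1..N. sin (2 * pi * n / real q))"
proof -
  define y where "y = 2 * pi * (N / q - real i) + pi / q"
  have q0: "0 \<le> pi / q" by simp
  have q3: "pi / q \<le> pi / 3" using q by (intro divide_left_mono) auto
  note q0 = q0 q3
  have "(2 * real N + 1) * pi / q = y + real i * (2 * pi)"
    using q by (simp add: y_def field_simps)
  then have cosN: "cos ((2 * real N + 1) * pi / q) = cos y" by (simp only: cos_plus_nat_2pi)
  have "2 * pi * (1 / 4) \<le> 2 * pi * (N / q - real i)" "2 * pi * (N / q - real i) \<le> 2 * pi * (1 / 2)"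
    using i by (auto intro!: mult_left_mono)
  then have y: "pi / 2 \<le> y" "y \<le> pi + pi / 3" unfolding y_def using q0 by linarith+
  have "0 \<le> cos (y - pi)" using y pi_gt_zero by (intro cos_ge_zero) linarith+
  then have "cos y \<le> 0" by (simp add: cos_diff)
  moreover have "cos (pi / 3) \<le> cos (pi / q)" using q0 by (intro cos_monotone_0_pi_le) auto
  then have "1 / 2 \<le> cos (pi / q)" by (simp add: cos_60)
  ultimately have "1 / 2 \<le> 2 * sin (pi / q) * (\<Sum>n=1..N. sin (2 * pi * n / real q))"
    unfolding sum_sin_eq cosN by simp
  also have "\<dots> \<le> 2 * (4 / q) * (\<Sum>n=1..N. sin (2 * pi * n / real q))"
  proof (intro mult_right_mono mult_left_mono)
    have "sin (pi / q) \<le> pi / q" using q0 by (intro sin_x_le_x) auto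
    also have "\<dots> \<le> 4 / q" using pi_less_4 by (intro divide_right_mono) auto
    finally show "sin (pi / q) \<le> 4 / q" .
  qed (use q sum_sin_nonneg[of q N] in auto)
  finally show ?thesis using q by (simp add: field_simps)
qed

text \<open>Only moduli satisfying the condition of \<open>sum_sin_ge\<close> are kept. For each
  integer part \<open>i\<close> in \<open>{J..2 * J - 1}\<close> they fill an interval of length at
  least \<open>N / (16 J^2)\<close>; the hypothesis \<open>128 N \<le> Q^2\<close> makes this length
  at least 2, so that rounding loses at most half.\<close>

lemma sine_sum_first_moment:
  fixes N :: nat and Q :: real
  assumes Q: "Q \<ge> 12" "Q \<le> N" "128 * real N \<le> Q\<^sup>2"
  shows "Q\<^sup>2 / 4096 \<le> (\<Sum>n=1..N. \<Sum>q=2..nat \<lfloor>Q\<rfloor>. sin (2 * pi * n / q))"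
proof -
  \<comment> \<open>\<open>J > N / Q\<close> keeps the chosen moduli below \<open>Q\<close>, and
    \<open>J \<le> 2 N / Q\<close> keeps them above \<open>Q / 4\<close>.\<close>
  define J where "J = nat \<lfloor>N / Q\<rfloor> + 1"
  have NQ: "1 \<le> N / Q" using Q by simp
  have J: "N / Q < real J" "real J \<le> 2 * (N / Q)" "J \<ge> 1" using NQ unfolding J_def by linarith+
  have N0: "real N > 0" using Q by linarith
  have J0: "real J > 0" using J by simp
  have QJ: "Q / 2 \<le> N / real J"
    using J(2) J0 Q by (simp add: field_simps)
  have J32: "1 \<le> N / (32 * (real J)\<^sup>2)"
  proof -
    have "(real J)\<^sup>2 \<le> (2 * (N / Q))\<^sup>2" using J by (intro power_mono) auto
    also have "\<dots> = 4 * (real N * real N) / Q\<^sup>2" by (simp add: power2_eq_square)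
    also have "\<dots> \<le> 4 * (real N * real N) / (128 * N)" using Q N0 by (intro divide_left_mono) auto
    also have "\<dots> = N / 32" using N0 by simp
    finally show ?thesis using J0 by (simp add: field_simps)
  qed
  define S where "S i = {nat \<lceil>N / (real i + 1 / 2)\<rceil>..nat \<lfloor>N / (real i + 1 / 4)\<rfloor>}" for i :: nat
  have S: "real i + 1 / 4 \<le> N / real q" "N / real q \<le> real i + 1 / 2" "3 \<le> q" "real q \<le> Q" "N / (2 * real J) \<le> real q"
    if i: "i \<in> {J..2 * J - 1}" and q: "q \<in> S i" for i q
  proof -
    have i2: "real i + 1 / 2 \<le> 2 * real J" "real J \<le> real i" using i J by (auto simp: of_nat_diff)
    have a: "N / (real i + 1 / 2) \<le> real q" "real q \<le> N / (real i + 1 / 4)"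
      using q N0 by (auto simp: S_def nat_le_iff ceiling_le_iff le_nat_iff le_floor_iff)
    have "N / (2 * real J) \<le> N / (real i + 1 / 2)" using i2 N0 by (intro divide_left_mono) auto
    then show b: "N / (2 * real J) \<le> real q" using a by linarith
    moreover have "3 \<le> N / (2 * real J)"
    proof -
      have "N / (2 * real J) = N / real J / 2" by simp
      then show ?thesis using QJ Q by linarith
    qed
    ultimately have q3: "3 \<le> real q" by linarith
    then show "3 \<le> q" by simp
    show "real i + 1 / 4 \<le> N / real q" "N / real q \<le> real i + 1 / 2"
      using a q3 by (auto simp: field_simps)
    have "N / (real i + 1 / 4) \<le> N / real J" using i2 J0 N0 by (intro divide_left_mono) auto
    also have "\<dots> \<le> N / (N / Q)" using J N0 Q by (intro divide_left_mono) auto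
    also have "\<dots> = Q" using N0 by simp
    finally show "real q \<le> Q" using a by linarith
  qed
  have cardS: "N / (32 * (real J)\<^sup>2) \<le> real (card (S i))" if i: "i \<in> {J..2 * J - 1}" for i
  proof -
    have i2: "real i + 1 / 2 \<le> 2 * real J" "real J \<le> real i" using i J by (auto simp: of_nat_diff)
    have "N / (16 * (real J)\<^sup>2) = N / 4 / ((2 * real J) * (2 * real J))" by (simp add: power2_eq_square)
    also have "\<dots> \<le> N / 4 / ((real i + 1 / 4) * (real i + 1 / 2))"
      using i2 J0 by (intro divide_left_mono mult_mono mult_pos_pos) auto
    also have "\<dots> = N / (real i + 1 / 4) - N / (real i + 1 / 2)"
    proof -
      have "real i + 1 / 4 > 0" "real i + 1 / 2 > 0" by auto
      then show ?thesis by (simp add: diff_frac_eq field_simps)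
    qed
    finally have len: "N / (16 * (real J)\<^sup>2) \<le> N / (real i + 1 / 4) - N / (real i + 1 / 2)" .
    have fl: "real (nat \<lfloor>N / (real i + 1 / 4)\<rfloor>) > N / (real i + 1 / 4) - 1"
      "real (nat \<lceil>N / (real i + 1 / 2)\<rceil>) < N / (real i + 1 / 2) + 1"
    proof -
      have "0 < N / (real i + 1 / 4)" "0 < N / (real i + 1 / 2)"
        using N0 by (auto intro!: divide_pos_pos add_nonneg_pos)
      then show "real (nat \<lfloor>N / (real i + 1 / 4)\<rfloor>) > N / (real i + 1 / 4) - 1"
        "real (nat \<lceil>N / (real i + 1 / 2)\<rceil>) < N / (real i + 1 / 2) + 1" by linarith+
    qed
    have "N / (real i + 1 / 4) - N / (real i + 1 / 2) - 1 \<le> real (card (S i))"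
    proof -
      have "real b + 1 - real a \<le> real (card {a..b})" for a b :: nat by (cases "a \<le> Suc b") auto
      from this[of "nat \<lfloor>N / (real i + 1 / 4)\<rfloor>" "nat \<lceil>N / (real i + 1 / 2)\<rceil>"]
      show ?thesis using fl unfolding S_def by linarith
    qed
    moreover have "N / (16 * (real J)\<^sup>2) = 2 * (N / (32 * (real J)\<^sup>2))" by simp
    ultimately show ?thesis using len J32 by linarith
  qed
  define I where "I = {J..2 * J - 1}"
  let ?g = "\<lambda>q::nat. \<Sum>n=1..N. sin (2 * pi * n / real q)"
  \<comment> \<open>There are \<open>J\<close> values of \<open>i\<close>, each with at least
    \<open>N / (32 J^2)\<close> moduli, each of these contributing at least
    \<open>N / (32 J)\<close>; the product is \<open>(N / J)^2 / 1024\<close> with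
    \<open>N / J \<ge> Q / 2\<close>.\<close>
  have "Q\<^sup>2 / 4096 = (Q / 2)\<^sup>2 / 1024" by (simp add: power_divide)
  also have "\<dots> \<le> (N / real J)\<^sup>2 / 1024" using QJ Q by (intro divide_right_mono power_mono) auto
  also have "\<dots> = real J * (N / (32 * (real J)\<^sup>2) * (N / (2 * real J) / 16))"
    using J0 by (simp add: power2_eq_square)
  also have "\<dots> = (\<Sum>i\<in>I. N / (32 * (real J)\<^sup>2) * (N / (2 * real J) / 16))"
    using J by (simp add: I_def of_nat_diff)
  also have "\<dots> \<le> (\<Sum>i\<in>I. \<Sum>q\<in>S i. ?g q)"
  proof (rule sum_mono)
    fix i assume i: "i \<in> I"
    have "N / (32 * (real J)\<^sup>2) * (N / (2 * real J) / 16) \<le> real (card (S i)) * (N / (2 * real J) / 16)"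
      using cardS i N0 by (intro mult_right_mono) (auto simp: I_def)
    also have "\<dots> = (\<Sum>q\<in>S i. N / (2 * real J) / 16)" by simp
    also have "\<dots> \<le> (\<Sum>q\<in>S i. ?g q)"
    proof (rule sum_mono)
      fix q assume q: "q \<in> S i"
      note s = S[OF i[unfolded I_def] q]
      have "N / (2 * real J) / 16 \<le> real q / 16" using s by simp
      also have "\<dots> \<le> ?g q" using s by (intro sum_sin_ge) auto
      finally show "N / (2 * real J) / 16 \<le> ?g q" .
    qed
    finally show "N / (32 * (real J)\<^sup>2) * (N / (2 * real J) / 16) \<le> (\<Sum>q\<in>S i. ?g q)" .
  qed
  also have "\<dots> = (\<Sum>q\<in>(\<Union>i\<in>I. S i). ?g q)"
  proof (rule sum.UNION_disjoint[symmetric])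
    show "\<forall>i\<in>I. \<forall>j\<in>I. i \<noteq> j \<longrightarrow> S i \<inter> S j = {}"
    proof (intro ballI impI, rule ccontr)
      fix i j assume ij: "i \<in> I" "j \<in> I" "i \<noteq> j" "S i \<inter> S j \<noteq> {}"
      then obtain q where q: "q \<in> S i" "q \<in> S j" by auto
      have "real i < real j + 1" "real j < real i + 1"
        using S(1,2)[OF ij(1)[unfolded I_def] q(1)] S(1,2)[OF ij(2)[unfolded I_def] q(2)] by linarith+
      then show False using ij(3) by linarith
    qed
  qed (auto simp: I_def S_def)
  also have "\<dots> \<le> (\<Sum>q=2..nat \<lfloor>Q\<rfloor>. ?g q)"
  proof (rule sum_mono2)
    show "(\<Union>i\<in>I. S i) \<subseteq> {2..nat \<lfloor>Q\<rfloor>}"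
    proof
      fix q assume "q \<in> (\<Union>i\<in>I. S i)"
      then obtain i where "i \<in> I" "q \<in> S i" by auto
      from S(3,4)[OF this(1)[unfolded I_def] this(2)] show "q \<in> {2..nat \<lfloor>Q\<rfloor>}" by (simp add: le_nat_floor)
    qed
    show "0 \<le> ?g q" if "q \<in> {2..nat \<lfloor>Q\<rfloor>} - (\<Union>i\<in>I. S i)" for q
      using that by (intro sum_sin_nonneg) auto
  qed auto
  also have "\<dots> = (\<Sum>n=1..N. \<Sum>q=2..nat \<lfloor>Q\<rfloor>. sin (2 * pi * n / q))" by (rule sum.swap)
  finally show ?thesis .
qed

section \<open>Mean square deviation of the prime divisor counts\<close>

lemma Omega_mult: "m > 0 \<Longrightarrow> n > 0 \<Longrightarrow> Omega (m * n) = Omega m + Omega n"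
  by (simp add: Omega_def prime_factorization_mult)

lemma Omega_squarefree:
  assumes "squarefree n" "n > 0"
  shows "Omega n = omega n"
proof -
  have "(\<Sum>p\<in>prime_factors n. count (prime_factorization n) p) = (\<Sum>p\<in>prime_factors n. 1)"
  proof (intro sum.cong refl)
    fix p assume p: "p \<in> prime_factors n"
    then have "multiplicity p n = 1" using assms squarefree_factorial_semiring'[of n] by auto
    then show "count (prime_factorization n) p = 1"
      using p by (simp add: count_prime_factorization_prime in_prime_factors_imp_prime)
  qed
  then show ?thesis by (simp add: Omega_def omega_def size_multiset_overloaded_eq)
qed

text \<open>Write \<open>n = u d^2\<close> with \<open>u\<close> squarefree: both counts agree on
  \<open>u\<close>, and every prime divisor of \<open>u\<close> divides \<open>n\<close>.\<close>

lemma Omega_le_omega_square_part: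
  assumes "n \<ge> (1::nat)"
  shows "Omega n \<le> omega n + 2 * Omega (square_part n)"
proof -
  define u where "u = squarefree_part n"
  define d where "d = square_part n"
  have n: "n = u * (d * d)" unfolding u_def d_def by (metis power2_eq_square squarefree_decompose)
  have pos: "u > 0" "d > 0" using n assms by (auto intro: Nat.gr0I)
  have "Omega n = Omega u + (Omega d + Omega d)"
    unfolding n using pos by (simp add: Omega_mult)
  also have "Omega u = omega u" using pos by (intro Omega_squarefree) (simp_all add: u_def)
  also have "omega u \<le> omega n"
    unfolding omega_def using n assms by (intro card_mono dvd_prime_factors) auto
  finally show ?thesis by (simp add: d_def)
qed

text \<open>The difference is at most twice \<open>Omega d\<close> for the square part
  \<open>d\<close>. Summing instead over all \<open>d\<close> with \<open>d^2\<close> dividing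
  \<open>n\<close> gives \<open>N\<close> times a series with terms \<open>Omega(d)^2 / d^2\<close>,
  which converges because \<open>Omega d \<le> 8 d powr (1 / 4)\<close>.\<close>

lemma sum_Omega_minus_omega_squared:
  "\<exists>C\<ge>0. \<forall>N. (\<Sum>n=1..N. (real (Omega n) - real (omega n))\<^sup>2) \<le> C * real N"
proof -
  have s: "summable (\<lambda>d. 256 * real d powr (-3/2))"
    by (intro summable_mult) (simp add: summable_real_powr_iff)
  define C where "C = (\<Sum>d. 256 * real d powr (-3/2))"
  have "(\<Sum>n=1..N. (real (Omega n) - real (omega n))\<^sup>2) \<le> C * real N" for N
  proof -
    have "(\<Sum>n=1..N. (real (Omega n) - real (omega n))\<^sup>2) \<le>
      (\<Sum>n=1..N. \<Sum>d=1..N. if d\<^sup>2 dvd n then 4 * (real (Omega d))\<^sup>2 else 0)"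
    proof (rule sum_mono)
      fix n assume n: "n \<in> {1..N}"
      have pos: "square_part n > 0" using n by (intro Nat.gr0I) auto
      have "square_part n \<le> (square_part n)\<^sup>2" by (simp add: power2_eq_square)
      also have "\<dots> \<le> n" using n by (intro dvd_imp_le) auto
      finally have d: "square_part n \<in> {1..N}" using n pos by auto
      have "(real (Omega n) - real (omega n))\<^sup>2 \<le> (2 * real (Omega (square_part n)))\<^sup>2"
        using Omega_le_omega_square_part[of n] omega_le_Omega[of n] n by (intro power_mono) auto
      also have "\<dots> = (if (square_part n)\<^sup>2 dvd n then 4 * (real (Omega (square_part n)))\<^sup>2 else 0)"
        by (simp add: power_mult_distrib)
      also have "\<dots> \<le> (\<Sum>d=1..N. if d\<^sup>2 dvd n then 4 * (real (Omega d))\<^sup>2 else 0)"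
        using d by (intro member_le_sum) auto
      finally show "(real (Omega n) - real (omega n))\<^sup>2 \<le> (\<Sum>d=1..N. if d\<^sup>2 dvd n then 4 * (real (Omega d))\<^sup>2 else 0)" .
    qed
    also have "\<dots> = (\<Sum>d=1..N. \<Sum>n=1..N. if d\<^sup>2 dvd n then 4 * (real (Omega d))\<^sup>2 else 0)"
      by (rule sum.swap)
    also have "\<dots> = (\<Sum>d=1..N. real (N div d\<^sup>2) * (4 * (real (Omega d))\<^sup>2))"
      by (intro sum.cong refl sum_indicator_multiples) auto
    also have "\<dots> \<le> (\<Sum>d=1..N. real N * (256 * real d powr (-3/2)))"
    proof (rule sum_mono)
      fix d assume d: "d \<in> {1..N}"
      have "ln (real d) = 4 * ln (real d powr (1 / 4))" using d by (simp add: ln_powr)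
      also have "\<dots> \<le> 4 * (real d powr (1 / 4) - 1)" using d by (intro mult_left_mono ln_le_minus_one) auto
      finally have "real (Omega d) \<le> 8 * real d powr (1 / 4)" using Omega_le_ln[of d] d by simp
      then have "(real (Omega d))\<^sup>2 \<le> (8 * real d powr (1 / 4))\<^sup>2" by (intro power_mono) auto
      also have "\<dots> = 64 * real d powr (1 / 2)"
        using d by (simp add: power_mult_distrib power2_eq_square powr_add[symmetric])
      finally have O: "(real (Omega d))\<^sup>2 \<le> 64 * real d powr (1 / 2)" .
      have "real (N div d\<^sup>2) * (4 * (real (Omega d))\<^sup>2) \<le> (real N / real (d\<^sup>2)) * (4 * (64 * real d powr (1 / 2)))"
        using O by (intro mult_mono of_nat_div_le_of_nat) auto
      also have "\<dots> = real N * (256 * (real d powr (1 / 2) / real d powr 2))"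
        using d by (simp add: powr_numeral)
      also have "real d powr (1 / 2) / real d powr 2 = real d powr (-3/2)"
        by (subst powr_diff[symmetric]) simp
      finally show "real (N div d\<^sup>2) * (4 * (real (Omega d))\<^sup>2) \<le> real N * (256 * real d powr (-3/2))" .
    qed
    also have "\<dots> = real N * (\<Sum>d=1..N. 256 * real d powr (-3/2))" by (simp add: sum_distrib_left)
    also have "\<dots> \<le> real N * C"
      unfolding C_def by (intro mult_left_mono sum_le_suminf s) auto
    finally show ?thesis by (simp add: mult.commute)
  qed
  moreover have "C \<ge> 0" unfolding C_def by (intro suminf_nonneg s) auto
  ultimately show ?thesis by blast
qed

text \<open>Up to the fourth root of \<open>N\<close> the deviation is \<open>excess\<close>,
  controlled by \<open>turan_kubilius\<close>. Larger primes contribute a bounded amount, and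
  repeated prime factors have bounded mean square; both are absorbed since the mean is at least
  \<open>1/2\<close>.\<close>

lemma mean_square_deviation:
  assumes w: "w \<in> {omega, Omega}"
  shows "\<exists>C>0. \<forall>N\<ge>16. (\<Sum>n=1..N. (real (w n) - prime_recip 0 (real N powr (1 / 4)))\<^sup>2)
     \<le> C * real N * prime_recip 0 (real N powr (1 / 4))"
proof -
  obtain C0 where C0: "C0 \<ge> 0" "\<And>N. (\<Sum>n=1..N. (real (Omega n) - real (omega n))\<^sup>2) \<le> C0 * real N"
    using sum_Omega_minus_omega_squared by blast
  have "(\<Sum>n=1..N. (real (w n) - prime_recip 0 (real N powr (1 / 4)))\<^sup>2)
     \<le> (134 + 8 * C0) * real N * prime_recip 0 (real N powr (1 / 4))" if N: "N \<ge> 16" for N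
  proof -
    define z where "z = real N powr (1 / 4)"
    define \<mu> where "\<mu> = prime_recip 0 z"
    have z2: "2 \<le> z"
    proof -
      have "(2::real) = (2 powr 4) powr (1 / 4)" by (simp only: powr_powr) simp
      also have "\<dots> \<le> z" unfolding z_def using N by (intro powr_mono2) auto
      finally show ?thesis .
    qed
    have zN: "z \<le> N" unfolding z_def using N powr_mono[of "1 / 4" 1 "real N"] by simp
    have lnz: "ln N = 4 * ln z" "ln z > 0" using z2 N by (auto simp: z_def ln_powr)
    have "2 \<in> primes_in 0 z" using z2 by (simp add: primes_in_def)
    then have \<mu>: "1 / 2 \<le> \<mu>" unfolding \<mu>_def using member_le_sum[of 2 "primes_in 0 z" "\<lambda>p. 1 / real p"] by simp
    have dev: "(real (w n) - \<mu>)\<^sup>2 \<le> 2 * (excess (primes_in 0 z) (int n))\<^sup>2 + (64 + 4 * (real (Omega n) - real (omega n))\<^sup>2)"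
      if n: "n \<in> {1..N}" for n
    proof -
      define a where "a = excess (primes_in 0 z) (int n)"
      define t where "t = (\<Sum>p\<in>primes_in z N. if p dvd n then 1 else (0::real))"
      define e where "e = real (Omega n) - real (omega n)"
      have e: "0 \<le> e" using omega_le_Omega[of n] n by (simp add: e_def)
      have om: "real (omega n) = (\<Sum>p\<in>primes_in 0 z. if p dvd n then 1 else 0) + t"
        unfolding t_def using omega_eq_sum[of n N] n z2 zN by (subst sum_primes_in_split[symmetric]) auto
      \<comment> \<open>At most four prime divisors of \<open>n\<close> exceed \<open>z\<close>:
        each contributes at least \<open>ln z\<close> to
        \<open>ln n \<le> ln N = 4 ln z\<close>.\<close>
      have "t * ln z = (\<Sum>p\<in>primes_in z N. if p dvd n then ln z else 0)"
        unfolding t_def sum_distrib_right by (intro sum.cong refl) auto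
      also have "\<dots> \<le> (\<Sum>p\<in>primes_in z N. \<Sum>k=1..N. if p ^ k dvd n then ln p else 0)"
      proof (rule sum_mono)
        fix p assume p: "p \<in> primes_in z N"
        have lnp: "ln z \<le> ln (real p)" "0 \<le> ln (real p)" using primes_inD(2,5)[OF p] z2 by (auto intro: ln_mono)
        have "(if p dvd n then ln z else 0) \<le> (if p ^ 1 dvd n then ln (real p) else 0)" using lnp by simp
        also have "\<dots> \<le> (\<Sum>k=1..N. if p ^ k dvd n then ln p else 0)"
          using lnp N by (intro member_le_sum[of 1 _ "\<lambda>k. if p ^ k dvd n then ln (real p) else 0"]) auto
        finally show "(if p dvd n then ln z else 0) \<le> (\<Sum>k=1..N. if p ^ k dvd n then ln p else 0)" .
      qed
      also have "\<dots> \<le> (\<Sum>p\<in>primes_in 0 N. \<Sum>k=1..N. if p ^ k dvd n then ln p else 0)"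
        using z2 by (intro sum_mono2 primes_in_mono sum_nonneg) (auto dest: primes_inD(5))
      also have "\<dots> = ln n" using n by (intro ln_eq_sum_primes[symmetric]) auto
      also have "\<dots> \<le> 4 * ln z" unfolding lnz(1)[symmetric] using n by simp
      finally have t4: "t \<le> 4" using lnz(2) by simp
      have t0: "0 \<le> t" unfolding t_def by (intro sum_nonneg) auto
      have om2: "real (omega n) - \<mu> = a + t"
        unfolding om a_def excess_of_nat \<mu>_def sum_subtractf by simp
      have "\<exists>b. real (w n) - \<mu> = a + b \<and> 0 \<le> b \<and> b \<le> 4 + e"
      proof (cases "w = omega")
        case True
        then show ?thesis using om2 t0 t4 e by (intro exI[of _ t]) auto
      next
        case False
        then have "real (w n) = real (omega n) + e" using w by (auto simp: e_def)
        then show ?thesis using om2 t0 t4 e by (intro exI[of _ "t + e"]) auto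
      qed
      then obtain b where b: "real (w n) - \<mu> = a + b" "0 \<le> b" "b \<le> 4 + e" by blast
      have "b\<^sup>2 \<le> (4 + e)\<^sup>2" using b by (intro power_mono) auto
      moreover have "0 \<le> (a - b)\<^sup>2" "0 \<le> (4 - e)\<^sup>2" by auto
      ultimately show ?thesis unfolding b(1) a_def[symmetric] e_def[symmetric]
        by (simp add: power2_sum power2_diff)
    qed
    have "(\<Sum>n=1..N. (real (w n) - \<mu>)\<^sup>2) \<le>
      (\<Sum>n=1..N. 2 * (excess (primes_in 0 z) (int n))\<^sup>2 + (64 + 4 * (real (Omega n) - real (omega n))\<^sup>2))"
      by (intro sum_mono dev)
    also have "\<dots> = 2 * (\<Sum>n=1..N. (excess (primes_in 0 z) (int n))\<^sup>2)
        + (64 * real N + 4 * (\<Sum>n=1..N. (real (Omega n) - real (omega n))\<^sup>2))"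
      by (simp add: sum.distrib sum_distrib_left)
    also have "\<dots> \<le> 2 * (3 * (real N * \<mu>)) + (64 * real N + 4 * (C0 * real N))"
    proof (intro add_mono mult_left_mono C0(2))
      have "(\<Sum>n=1..N. (excess (primes_in 0 z) (int n))\<^sup>2) \<le> N * \<mu> + 2 * \<mu> * card (primes_in 0 z)"
        unfolding \<mu>_def by (rule turan_kubilius) (auto dest: primes_inD)
      also have "\<dots> \<le> N * \<mu> + 2 * \<mu> * N"
        using card_primes_in_le_self[of z 0] z2 zN \<mu> by (intro add_left_mono mult_left_mono) auto
      finally show "(\<Sum>n=1..N. (excess (primes_in 0 z) (int n))\<^sup>2) \<le> 3 * (real N * \<mu>)" by (simp add: mult.commute)
    qed auto
    also have "\<dots> = 6 * (real N * \<mu>) + (128 + 8 * C0) * (real N * (1 / 2))" by (simp add: algebra_simps)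
    also have "\<dots> \<le> 6 * (real N * \<mu>) + (128 + 8 * C0) * (real N * \<mu>)"
      using \<mu> C0(1) by (intro add_left_mono mult_left_mono) auto
    also have "\<dots> = (134 + 8 * C0) * real N * \<mu>" by (simp add: algebra_simps)
    finally show ?thesis unfolding \<mu>_def z_def .
  qed
  then show ?thesis using C0(1) by (intro exI[of _ "134 + 8 * C0"]) auto
qed

section \<open>Lower bound from the sine test\<close>

lemma sin_plus_nat_2pi: "sin (x + real i * (2 * pi)) = sin x"
proof (induction i)
  case (Suc i)
  have "x + real (Suc i) * (2 * pi) = (x + real i * (2 * pi)) + 2 * pi" by (simp add: algebra_simps)
  then show ?case using Suc by (simp only: sin_periodic)
qed simp

lemma sin_mod_eq:
  assumes "q > 0"
  shows "sin (2 * pi * real (n mod q) / real q) = sin (2 * pi * real n / real q)"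
proof -
  have "real n = real q * real (n div q) + real (n mod q)" by (simp flip: of_nat_mult of_nat_add)
  then have "2 * pi * real n / real q = 2 * pi * real (n mod q) / real q + real (n div q) * (2 * pi)"
    using assms by (simp add: field_simps)
  then show ?thesis by (simp only: sin_plus_nat_2pi)
qed

text \<open>The odd functions \<open>a \<mapsto> sin (2 \<pi> a / q)\<close> detect that the classes \<open>a \<le> N mod q\<close> contain one
  more integer up to \<open>N\<close> than the others.\<close>

lemma variance_lower_bound_sine:
  assumes w: "w \<in> {omega, Omega}"
  shows "\<exists>C>0. \<exists>c>0. eventually (\<lambda>N. \<forall>Q. C * real N \<le> Q * prime_recip 0 (real N powr (1 / 4)) \<longrightarrow> Q \<le> real N \<longrightarrow>
     c * (Q\<^sup>2 * (prime_recip 0 (real N powr (1 / 4)))\<^sup>2) \<le> V N Q (\<lambda>n. of_nat (w n))) sequentially"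
    (is "\<exists>C>0. \<exists>c>0. eventually (?E C c) sequentially")
proof -
  obtain C1 where C1: "C1 > 0" "\<And>N. N \<ge> 16 \<Longrightarrow>
     (\<Sum>n=1..N. (real (w n) - prime_recip 0 (real N powr (1 / 4)))\<^sup>2)
     \<le> C1 * real N * prime_recip 0 (real N powr (1 / 4))"
    using mean_square_deviation[OF w] by blast
  \<comment> \<open>Chosen so that the Cauchy--Schwarz bound \<open>C1 N \<mu> * 34 Q^3\<close> is
    at most the square of \<open>\<mu> Q^2 / 8192\<close>, half of the main term.\<close>
  define C where "C = 34 * C1 * 8192\<^sup>2"
  have C: "C > 0" using C1(1) by (simp add: C_def)
  \<comment> \<open>Since \<open>\<mu> \<le> 1 + ln N\<close>, the assumption
    \<open>C N \<le> Q \<mu>\<close> forces \<open>Q\<close> above this quotient, hence above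
    \<open>12 + 12 sqrt N\<close>, as both moment estimates require.\<close>
  have ev: "eventually (\<lambda>x::real. 12 + 12 * sqrt x \<le> C * x / (1 + ln x)) at_top"
    using C by real_asymp
  have "eventually (?E C (1 / 8192\<^sup>2)) sequentially"
    using eventually_compose_filterlim[OF ev filterlim_real_sequentially] eventually_ge_at_top[of 16]
  proof eventually_elim
    case (elim N)
    define \<mu> where "\<mu> = prime_recip 0 (real N powr (1 / 4))"
    show ?case unfolding \<mu>_def[symmetric]
    proof (intro allI impI)
      fix Q :: real assume CQ: "C * real N \<le> Q * \<mu>" and QN: "Q \<le> real N"
      define M where "M = nat \<lfloor>Q\<rfloor>"
      define G where "G n = (\<Sum>q=2..M. sin (2 * pi * real n / real q))" for n :: nat
      have N: "N \<ge> 16" using elim by simp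
      have "real N powr (1 / 4) \<le> real N" using N powr_mono[of "1 / 4" 1 "real N"] by simp
      then have "\<mu> \<le> prime_recip 0 (real N)"
        unfolding \<mu>_def by (intro sum_mono2 primes_in_mono) auto
      also have "\<dots> \<le> 1 + ln N" using N by (intro sum_prime_recip_le_ln) auto
      finally have \<mu>1: "\<mu> \<le> 1 + ln N" .
      have \<mu>0: "\<mu> \<ge> 0" unfolding \<mu>_def by (intro sum_nonneg) auto
      have Q\<mu>: "Q * \<mu> > 0" using CQ C N by (auto intro: less_le_trans[OF _ CQ])
      then have Qpos: "Q > 0" "\<mu> > 0" using \<mu>0 by (auto simp: zero_less_mult_iff)
      have "C * real N \<le> Q * (1 + ln N)" using CQ mult_left_mono[OF \<mu>1, of Q] Qpos by linarith
      then have "C * real N / (1 + ln N) \<le> Q" using N by (subst pos_divide_le_eq) (auto simp: add_pos_nonneg)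
      then have Q12: "12 + 12 * sqrt N \<le> Q" using elim by linarith
      have sq0: "0 \<le> sqrt N" by simp
      have Q: "Q \<ge> 12" "128 * real N \<le> Q\<^sup>2"
      proof -
        show "Q \<ge> 12" using Q12 sq0 by linarith
        have "128 * real N \<le> (12 * sqrt N)\<^sup>2" by (simp add: power_mult_distrib)
        also have "\<dots> \<le> Q\<^sup>2" using Q12 by (intro power_mono) auto
        finally show "128 * real N \<le> Q\<^sup>2" .
      qed
      have M: "real M \<le> Q" "Q / 2 \<le> real M" unfolding M_def using Q by linarith+
      have "real N \<le> (Q / 2)\<^sup>2" using Q by (simp add: power_divide)
      also have "\<dots> \<le> (real M)\<^sup>2" using M Q by (intro power_mono) auto
      finally have NM: "real N \<le> (real M)\<^sup>2" .
      have "(\<Sum>n=1..N. (G n)\<^sup>2) \<le> 34 * real M ^ 3"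
        unfolding G_def using N by (intro sine_sum_second_moment NM) auto
      also have "\<dots> \<le> 34 * Q ^ 3" using M by (intro mult_left_mono power_mono) auto
      finally have G2: "(\<Sum>n=1..N. (G n)\<^sup>2) \<le> 34 * Q ^ 3" .
      have G1: "Q\<^sup>2 / 4096 \<le> (\<Sum>n=1..N. G n)"
        unfolding G_def M_def using Q QN by (intro sine_sum_first_moment) auto
      have "(\<Sum>n=1..N. (real (w n) - \<mu>) * G n)\<^sup>2 \<le> (\<Sum>n=1..N. (real (w n) - \<mu>)\<^sup>2) * (\<Sum>n=1..N. (G n)\<^sup>2)"
        by (rule Cauchy_Schwarz_ineq_sum)
      also have "\<dots> \<le> (C1 * real N * \<mu>) * (34 * Q ^ 3)"
        using C1 N G2 \<mu>0 unfolding \<mu>_def by (intro mult_mono sum_nonneg) auto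
      also have "\<dots> = C * real N * (\<mu> * Q ^ 3 / 8192\<^sup>2)" by (simp add: C_def)
      also have "\<dots> \<le> Q * \<mu> * (\<mu> * Q ^ 3 / 8192\<^sup>2)"
        using CQ Qpos by (intro mult_right_mono) auto
      also have "\<dots> = (\<mu> * Q\<^sup>2 / 8192)\<^sup>2"
        by (simp add: power2_eq_square power3_eq_cube)
      finally have "\<bar>\<Sum>n=1..N. (real (w n) - \<mu>) * G n\<bar> \<le> \<mu> * Q\<^sup>2 / 8192"
        using \<mu>0 by (intro power2_le_imp_le[of "\<bar>_\<bar>"]) auto
      moreover have "\<mu> * (Q\<^sup>2 / 4096) \<le> \<mu> * (\<Sum>n=1..N. G n)" using G1 \<mu>0 by (intro mult_left_mono)
      moreover have "(\<Sum>n=1..N. real (w n) * G n) = \<mu> * (\<Sum>n=1..N. G n) + (\<Sum>n=1..N. (real (w n) - \<mu>) * G n)"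
        by (simp add: sum_distrib_left left_diff_distrib sum_subtractf)
      ultimately have cov: "\<mu> * Q\<^sup>2 / 8192 \<le> (\<Sum>n=1..N. real (w n) * G n)" by (simp add: abs_le_iff)
      have dual: "(\<Sum>n=1..N. real (w n) * (\<Sum>q\<in>{2..M}. 1 * sin (2 * pi * real n / real q)))\<^sup>2 \<le>
         V N Q (\<lambda>n. of_real (real (w n))) * (\<Sum>q\<in>{2..M}. 1 * (\<Sum>a=1..q. (sin (2 * pi * real a / real q))\<^sup>2))"
      proof (rule V_duality)
        show "1 \<le> q \<and> real q \<le> Q" if "q \<in> {2..M}" for q
          using that M by auto
        show "sin (2 * pi * real n / real q) = sin (2 * pi * real a / real q)"
          if "q \<in> {2..M}" "[n = a] (mod q)" for q n a
          using that sin_mod_eq[of q n] sin_mod_eq[of q a] by (simp add: cong_def)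
        show "(\<Sum>a | a \<in> {1..q} \<and> gcd a q = h. sin (2 * pi * real a / real q)) = 0" if q: "q \<in> {2..M}" for q h
        proof (rule sum_class_odd)
          show "sin (2 * pi * real (q - a) / real q) = - sin (2 * pi * real a / real q)" if a: "1 \<le> a" "a < q" for a
          proof -
            have "2 * pi * real (q - a) / real q = 2 * pi - 2 * pi * real a / real q"
              using a by (simp add: of_nat_diff field_simps)
            then show ?thesis by (simp add: sin_diff)
          qed
        qed (use q in auto)
      qed auto
      have den: "(\<Sum>q\<in>{2..M}. 1 * (\<Sum>a=1..q. (sin (2 * pi * real a / real q))\<^sup>2)) \<le> Q\<^sup>2"
      proof -
        have "(\<Sum>q\<in>{2..M}. 1 * (\<Sum>a=1..q. (sin (2 * pi * real a / real q))\<^sup>2)) \<le> (\<Sum>q\<in>{2..M}. real M)"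
        proof (rule sum_mono)
          fix q assume q: "q \<in> {2..M}"
          have "(\<Sum>a=1..q. (sin (2 * pi * real a / real q))\<^sup>2) \<le> (\<Sum>a=1..q. 1)"
            by (intro sum_mono) (simp add: abs_square_le_1)
          then show "1 * (\<Sum>a=1..q. (sin (2 * pi * real a / real q))\<^sup>2) \<le> real M" using q by simp
        qed
        also have "\<dots> \<le> real M * real M" by (simp add: mult_right_mono)
        also have "\<dots> \<le> Q\<^sup>2" unfolding power2_eq_square using M Qpos by (intro mult_mono) auto
        finally show ?thesis .
      qed
      have "(\<mu> * Q\<^sup>2 / 8192)\<^sup>2 \<le> (\<Sum>n=1..N. real (w n) * G n)\<^sup>2"
        using cov \<mu>0 by (intro power_mono) auto
      also have "\<dots> \<le> V N Q (\<lambda>n. of_real (real (w n))) * (\<Sum>q\<in>{2..M}. 1 * (\<Sum>a=1..q. (sin (2 * pi * real a / real q))\<^sup>2))"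
        using dual by (simp add: G_def)
      also have "\<dots> \<le> V N Q (\<lambda>n. of_real (real (w n))) * Q\<^sup>2"
        by (intro mult_left_mono den V_nonneg)
      finally have fin: "(\<mu> * Q\<^sup>2 / 8192)\<^sup>2 \<le> V N Q (\<lambda>n. of_real (real (w n))) * Q\<^sup>2" .
      have "(\<mu> * Q\<^sup>2 / 8192)\<^sup>2 = 1 / 8192\<^sup>2 * (Q\<^sup>2 * \<mu>\<^sup>2) * Q\<^sup>2" by (simp add: power2_eq_square)
      with fin have "1 / 8192\<^sup>2 * (Q\<^sup>2 * \<mu>\<^sup>2) * Q\<^sup>2 \<le> V N Q (\<lambda>n. of_real (real (w n))) * Q\<^sup>2" by simp
      then have "1 / 8192\<^sup>2 * (Q\<^sup>2 * \<mu>\<^sup>2) \<le> V N Q (\<lambda>n. of_real (real (w n)))"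
        using Qpos by (simp only: mult_le_cancel_right_pos zero_less_power)
      then show "1 / 8192\<^sup>2 * (Q\<^sup>2 * \<mu>\<^sup>2) \<le> V N Q (\<lambda>n. of_nat (w n))" by simp
    qed
  qed
  moreover have "(1 :: real) / 8192\<^sup>2 > 0" by simp
  ultimately show ?thesis using C by blast
qed

section \<open>Combination of the two lower bounds\<close>

theorem theorem1p5:
  shows "\<exists>\<delta>\<^sub>0::real. \<delta>\<^sub>0 > 0 \<and>
    (\<forall>\<delta>::real. 0 < \<delta> \<and> \<delta> \<le> \<delta>\<^sub>0 \<longrightarrow>
      (\<forall>w \<in> {omega, Omega}.
        \<exists>\<kappa>::real. \<kappa> > 0 \<and>
          (\<exists>N\<^sub>0::nat. \<forall>N::nat. N \<ge> N\<^sub>0 \<longrightarrow>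
            (\<forall>Q::real. real N powr (1/2 + \<delta>) \<le> Q \<and> Q \<le> real N \<longrightarrow>
              V N Q (\<lambda>n. of_nat (w n)) \<ge>
                \<kappa> * (Q\<^sup>2 * (ln (ln (real N)))\<^sup>2
                     + Q * real N * ln (ln (real N) / ln (2 * real N / Q)))))))"
proof (rule exI[of _ "1 / 4"], intro conjI allI impI ballI)
  show "(0::real) < 1 / 4" by simp
next
  fix \<delta> :: real and w
  assume "0 < \<delta> \<and> \<delta> \<le> 1 / 4" and w: "w \<in> {omega, Omega}"
  then have \<delta>: "0 < \<delta>" "\<delta> \<le> 1 / 4" by auto
  define \<mu> where "\<mu> N = prime_recip 0 (real N powr (1 / 4))" for N
  obtain C2 c1 N1 where C2: "C2 > 0" and c1: "c1 > 0" and sine: "\<And>N Q. N \<ge> N1 \<Longrightarrow> C2 * real N \<le> Q * \<mu> N \<Longrightarrow> Q \<le> real N \<Longrightarrow>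
       c1 * (Q\<^sup>2 * (\<mu> N)\<^sup>2) \<le> V N Q (\<lambda>n. of_nat (w n))"
    using variance_lower_bound_sine[OF w] unfolding \<mu>_def eventually_sequentially by metis
  obtain c3 P0 where c3: "c3 > 0" and P0: "P0 > 1" and recip1: "\<And>P R. P \<ge> P0 \<Longrightarrow> R \<ge> P powr (1 + 1) \<Longrightarrow>
           c3 * ln (ln R / ln P) \<le> prime_recip P R"
    using sum_prime_recip_ge[of 1] by (metis zero_less_one)
  \<comment> \<open>\<open>P = 8 N / Q\<close> is at most \<open>8 N powr (1/2 - \<delta>)\<close>,
    hence at most \<open>N powr (1/2 - 3/4 \<delta>)\<close> for large \<open>N\<close>. Raising
    this to the power \<open>1 + \<eta>\<close> gives exactly \<open>R\<close>.\<close>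
  define \<eta> where "\<eta> = (1 / 2 - \<delta> / 2) / (1 / 2 - 3 / 4 * \<delta>) - 1"
  have \<eta>: "\<eta> > 0" "(1 / 2 - 3 / 4 * \<delta>) * (1 + \<eta>) = 1 / 2 - \<delta> / 2"
    using \<delta> by (auto simp: \<eta>_def field_simps)
  obtain c4 P4 where c4: "c4 > 0" and P4: "P4 > 1" and recip2: "\<And>P R. P \<ge> P4 \<Longrightarrow> R \<ge> P powr (1 + \<eta>) \<Longrightarrow>
           c4 * ln (ln R / ln P) \<le> prime_recip P R"
    using sum_prime_recip_ge[OF \<eta>(1)] by metis
  define \<rho> where "\<rho> = ln (1 + \<eta>)"
  have \<rho>: "\<rho> > 0" using \<eta> by (simp add: \<rho>_def)
  have "c4 * \<rho> > 0" using c4 \<rho> by simp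
  then obtain \<kappa>2 N2 where \<kappa>2: "\<kappa>2 > 0" and primes: "\<And>N Q. N \<ge> N2 \<Longrightarrow> real N powr (1 / 2 + \<delta>) \<le> Q \<Longrightarrow> Q \<le> real N \<Longrightarrow>
     16 \<le> 8 * real N / Q \<Longrightarrow> c4 * \<rho> \<le> prime_recip (8 * real N / Q) (real N powr (1 / 2 - \<delta> / 2)) \<Longrightarrow>
    \<kappa>2 * (Q * real N * prime_recip (8 * real N / Q) (real N powr (1 / 2 - \<delta> / 2))) \<le> V N Q (\<lambda>n. of_nat (w n))"
    using variance_lower_bound_primes[OF \<delta> _ w] unfolding eventually_sequentially by metis
  define c\<mu> where "c\<mu> = c3 / 2"
  have c\<mu>: "c\<mu> > 0" using c3 by (simp add: c\<mu>_def)
  \<comment> \<open>When the sine bound does not apply, \<open>Q c\<mu> l \<le> C2 N\<close>, so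
    \<open>P \<ge> t l\<close>. Thus \<open>P\<close> tends to infinity and passes both 16 and
    \<open>P4\<close>.\<close>
  define t where "t = 8 * c\<mu> / C2"
  have t: "t > 0" using c\<mu> C2 by (simp add: t_def)
  \<comment> \<open>Makes \<open>a ln N\<close> the ratio of \<open>ln (N powr (1 / 4))\<close> to
    \<open>ln P0\<close>.\<close>
  define a where "a = 1 / (4 * ln P0)"
  have a: "a > 0" using P0 by (simp add: a_def)
  define big where "big x \<longleftrightarrow> 1 \<le> ln (ln x) \<and> ln (ln x) / 2 \<le> ln (a * ln x) \<and> P0 powr 2 \<le> x powr (1 / 4) \<and>
      8 \<le> x powr (\<delta> / 4) \<and> max 16 P4 \<le> t * ln (ln x) \<and>
      ln (ln x) / 2 \<le> ln (3 / 8 * ln x / ln (8 * (ln (ln x))\<^sup>2)) \<and> ln (ln x / ln 2) \<le> 2 * ln (ln x)" for x :: real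
  have "eventually big at_top"
    unfolding big_def
  proof (intro eventually_conj)
    show "eventually (\<lambda>x::real. ln (ln x) / 2 \<le> ln (a * ln x)) at_top" using a by real_asymp
    show "eventually (\<lambda>x::real. P0 powr 2 \<le> x powr (1 / 4)) at_top" by real_asymp
    show "eventually (\<lambda>x::real. 8 \<le> x powr (\<delta> / 4)) at_top" using \<delta>(1) by real_asymp
    show "eventually (\<lambda>x::real. max 16 P4 \<le> t * ln (ln x)) at_top" using t by real_asymp
    show "eventually (\<lambda>x::real. ln (ln x) / 2 \<le> ln (3 / 8 * ln x / ln (8 * (ln (ln x))\<^sup>2))) at_top" by real_asymp
  qed real_asymp+
  from eventually_compose_filterlim[OF this filterlim_real_sequentially]
  obtain N3 where ev: "\<And>N. N \<ge> N3 \<Longrightarrow> big (real N)"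
    unfolding eventually_sequentially by blast
  \<comment> \<open>The two claimed terms measured in units of \<open>Q^2 m^2\<close>: the first
    through \<open>l \<le> m / c\<mu>\<close>, the second through \<open>N \<le> Q m / C2\<close>
    and \<open>\<Lambda> \<le> 2 l\<close>.\<close>
  define KI where "KI = 1 / c\<mu>\<^sup>2 + 2 / (C2 * c\<mu>)"
  have KI: "KI > 0" using c\<mu> C2 by (simp add: KI_def add_pos_pos)
  \<comment> \<open>The same in units of \<open>Q N X\<close>: the first two summands pay for
    \<open>Q^2 l^2\<close> (see \<open>QlX\<close>), the bracket for \<open>Q N \<Lambda>\<close>
    (see \<open>\<Lambda>X\<close>).\<close>
  define KII where "KII = 2 * C2 / c\<mu> + 1 / \<rho> + (1 + ln 8 / \<rho>)"
  have KII: "KII > 0" using c\<mu> C2 \<rho> by (simp add: KII_def add_pos_pos)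
  define \<kappa> where "\<kappa> = min (c1 / KI) (\<kappa>2 * c4 / KII)"
  have \<kappa>: "\<kappa> > 0" "\<kappa> * KI \<le> c1" "\<kappa> * KII \<le> \<kappa>2 * c4"
  proof -
    show "\<kappa> > 0" using c1 KI \<kappa>2 c4 KII by (simp add: \<kappa>_def)
    have "\<kappa> \<le> c1 / KI" "\<kappa> \<le> \<kappa>2 * c4 / KII" by (auto simp: \<kappa>_def)
    then show "\<kappa> * KI \<le> c1" "\<kappa> * KII \<le> \<kappa>2 * c4" using KI KII by (auto simp: pos_le_divide_eq)
  qed
  show "\<exists>\<kappa>::real. \<kappa> > 0 \<and>
          (\<exists>N\<^sub>0::nat. \<forall>N::nat. N \<ge> N\<^sub>0 \<longrightarrow>
            (\<forall>Q::real. real N powr (1/2 + \<delta>) \<le> Q \<and> Q \<le> real N \<longrightarrow>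
              V N Q (\<lambda>n. of_nat (w n)) \<ge>
                \<kappa> * (Q\<^sup>2 * (ln (ln (real N)))\<^sup>2
                     + Q * real N * ln (ln (real N) / ln (2 * real N / Q)))))"
  proof (rule exI[of _ \<kappa>], rule conjI[OF \<kappa>(1)], rule exI[of _ "max 3 (max N1 (max N2 N3))"], intro allI impI)
    fix N :: nat and Q :: real
    assume N: "max 3 (max N1 (max N2 N3)) \<le> N" and "real N powr (1/2 + \<delta>) \<le> Q \<and> Q \<le> real N"
    then have Q1: "real N powr (1/2 + \<delta>) \<le> Q" and QN: "Q \<le> real N" by auto
    have N': "N \<ge> 3" "N \<ge> N1" "N \<ge> N2" "N \<ge> N3" using N by auto
    define l where "l = ln (ln (real N))"
    define \<Lambda> where "\<Lambda> = ln (ln (real N) / ln (2 * real N / Q))"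
    define m where "m = \<mu> N"
    note big = ev[OF N'(4), unfolded big_def, folded l_def]
    have l1: "l \<ge> 1" using big by simp
    have "0 < real N powr (1/2 + \<delta>)" using N' by simp
    then have Q0: "Q > 0" using Q1 by linarith
    have NQ: "1 \<le> real N / Q" using QN Q0 by simp
    have lnN: "ln (real N) > 0" using N' by simp
    have "2 \<le> 2 * real N / Q" using QN Q0 by (simp add: pos_le_divide_eq)
    then have ln2': "ln 2 \<le> ln (2 * real N / Q)" by (intro ln_mono) auto
    have "0 < ln (2::real)" by simp
    then have ln2: "0 < ln (2::real)" "ln 2 \<le> ln (2 * real N / Q)" "0 < ln (2 * real N / Q)"
      using ln2' by linarith+
    have m: "c\<mu> * l \<le> m"
    proof -
      define z where "z = real N powr (1 / 4)"
      have z: "z \<ge> P0 powr (1 + 1)" using big by (simp add: z_def)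
      have lnz: "ln z / ln P0 = a * ln N" using N' by (simp add: z_def a_def ln_powr)
      have "c\<mu> * l = c3 * (l / 2)" by (simp add: c\<mu>_def)
      also have "\<dots> \<le> c3 * ln (ln z / ln P0)" unfolding lnz using big c3 by (intro mult_left_mono) auto
      also have "\<dots> \<le> prime_recip P0 z" by (rule recip1[OF order.refl z])
      also have "\<dots> \<le> m" unfolding m_def \<mu>_def z_def[symmetric] using P0 by (intro sum_mono2 primes_in_mono) auto
      finally show ?thesis .
    qed
    have m0: "m > 0" using m mult_pos_pos[OF c\<mu>, of l] l1 by linarith
    have lm: "l \<le> m / c\<mu>" using m c\<mu> by (simp add: pos_le_divide_eq mult.commute)
    show "\<kappa> * (Q\<^sup>2 * (ln (ln (real N)))\<^sup>2 + Q * real N * ln (ln (real N) / ln (2 * real N / Q)))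
       \<le> V N Q (\<lambda>n. of_nat (w n))"
      unfolding l_def[symmetric] \<Lambda>_def[symmetric]
    proof (cases "C2 * real N \<le> Q * m")
      case True
      have "\<Lambda> \<le> ln (ln (real N) / ln 2)"
      proof -
        have "ln (real N) / ln (2 * real N / Q) \<le> ln (real N) / ln 2"
          by (rule frac_le) (use ln2 lnN in linarith)+
        moreover have "0 < ln (real N) / ln (2 * real N / Q)" using ln2 lnN by simp
        ultimately show ?thesis unfolding \<Lambda>_def by (intro ln_mono)
      qed
      also have "\<dots> \<le> 2 * l" using big by simp
      also have "\<dots> \<le> 2 * (m / c\<mu>)" using lm by simp
      finally have "Q * real N * \<Lambda> \<le> Q * (Q * m / C2) * (2 * (m / c\<mu>))"
      proof -
        assume a: "\<Lambda> \<le> 2 * (m / c\<mu>)"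
        have "Q * real N * \<Lambda> \<le> Q * real N * (2 * (m / c\<mu>))" using a Q0 by (intro mult_left_mono) auto
        also have "\<dots> \<le> Q * (Q * m / C2) * (2 * (m / c\<mu>))"
          using True Q0 m0 c\<mu> C2 by (intro mult_right_mono mult_left_mono) (auto simp: field_simps)
        finally show ?thesis .
      qed
      moreover have "Q\<^sup>2 * l\<^sup>2 \<le> Q\<^sup>2 * (m / c\<mu>)\<^sup>2" using lm l1 by (intro mult_left_mono power_mono) auto
      moreover have "Q\<^sup>2 * (m / c\<mu>)\<^sup>2 + Q * (Q * m / C2) * (2 * (m / c\<mu>)) = KI * (Q\<^sup>2 * m\<^sup>2)"
        using c\<mu> C2 by (simp add: KI_def power2_eq_square field_simps)
      ultimately have "Q\<^sup>2 * l\<^sup>2 + Q * real N * \<Lambda> \<le> KI * (Q\<^sup>2 * m\<^sup>2)" by linarith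
      then have "\<kappa> * (Q\<^sup>2 * l\<^sup>2 + Q * real N * \<Lambda>) \<le> \<kappa> * (KI * (Q\<^sup>2 * m\<^sup>2))"
        using \<kappa> by (intro mult_left_mono) auto
      also have "\<dots> = (\<kappa> * KI) * (Q\<^sup>2 * m\<^sup>2)" by simp
      also have "\<dots> \<le> c1 * (Q\<^sup>2 * m\<^sup>2)" using \<kappa>(2) by (intro mult_right_mono) auto
      also have "\<dots> \<le> V N Q (\<lambda>n. of_nat (w n))"
        unfolding m_def using sine[OF N'(2) _ QN] True m_def by simp
      finally show "\<kappa> * (Q\<^sup>2 * l\<^sup>2 + Q * real N * \<Lambda>) \<le> V N Q (\<lambda>n. of_nat (w n))" .
    next
      case False
      define P where "P = 8 * real N / Q"
      define R where "R = real N powr (1 / 2 - \<delta> / 2)"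
      define X where "X = ln (ln R / ln P)"
      have "Q * (c\<mu> * l) \<le> Q * m" using m Q0 by (intro mult_left_mono) auto
      then have Ql: "Q * (c\<mu> * l) \<le> C2 * real N" using False by linarith
      then have "t * l \<le> P" using Q0 C2 by (simp add: t_def P_def field_simps)
      then have P: "16 \<le> P" "P4 \<le> P" using big by auto
      have lnP: "ln P > 0" using P by simp
      have "P \<le> 8 * real N / real N powr (1 / 2 + \<delta>)"
        unfolding P_def using Q1 N' Q0 by (intro divide_left_mono) auto
      also have "\<dots> = 8 * real N powr (1 - (1 / 2 + \<delta>))" using N' by (subst powr_diff) auto
      also have "\<dots> \<le> real N powr (\<delta> / 4) * real N powr (1 - (1 / 2 + \<delta>))"
        using big by (intro mult_right_mono) auto
      also have "\<dots> = real N powr (1 / 2 - 3 / 4 * \<delta>)" by (simp add: powr_add[symmetric])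
      finally have "P powr (1 + \<eta>) \<le> (real N powr (1 / 2 - 3 / 4 * \<delta>)) powr (1 + \<eta>)"
        using P \<eta>(1) by (intro powr_mono2) auto
      also have "\<dots> = R" unfolding powr_powr \<eta>(2) R_def ..
      finally have PR: "P powr (1 + \<eta>) \<le> R" .
      have lnR: "ln R = (1 / 2 - \<delta> / 2) * ln (real N)" using N' by (simp add: R_def ln_powr)
      have lnR2: "3 / 8 * ln (real N) \<le> ln R" unfolding lnR using \<delta> lnN by (intro mult_right_mono) auto
      have "ln (P powr (1 + \<eta>)) \<le> ln R" using PR P by (intro ln_mono) auto
      then have "(1 + \<eta>) * ln P \<le> ln R" using P by (simp add: ln_powr)
      then have "1 + \<eta> \<le> ln R / ln P" using lnP by (simp add: pos_le_divide_eq)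
      then have X\<rho>: "\<rho> \<le> X" unfolding \<rho>_def X_def using \<eta>(1) by (intro ln_mono) auto
      have L: "c4 * X \<le> prime_recip P R" unfolding X_def by (rule recip2[OF P(2) PR])
      have "c4 * \<rho> \<le> c4 * X" using X\<rho> c4 by (intro mult_left_mono) auto
      then have c4L: "c4 * \<rho> \<le> prime_recip P R" using L by linarith
      have "\<kappa>2 * (Q * real N * prime_recip P R) \<le> V N Q (\<lambda>n. of_nat (w n))"
        unfolding P_def R_def using primes[OF N'(3) Q1 QN] P(1) c4L unfolding P_def R_def by blast
      moreover have "\<kappa>2 * (Q * real N * (c4 * X)) \<le> \<kappa>2 * (Q * real N * prime_recip P R)"
        using \<kappa>2 Q0 L by (intro mult_left_mono) auto
      ultimately have VX: "\<kappa>2 * c4 * (Q * real N * X) \<le> V N Q (\<lambda>n. of_nat (w n))" by (simp add: mult_ac)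
      \<comment> \<open>\<open>2 N / Q\<close> is \<open>P / 4\<close>, and
        \<open>P \<ge> 16\<close> gives \<open>ln (P / 4) \<ge> ln P / 2\<close>. With
        \<open>ln N \<le> 4 ln R\<close> this yields \<open>\<Lambda> \<le> ln 8 + X\<close>, and
        \<open>X \<ge> \<rho>\<close> turns the constant into a multiple of
        \<open>X\<close>.\<close>
      have \<Lambda>X: "\<Lambda> \<le> (1 + ln 8 / \<rho>) * X"
      proof -
        have "ln P \<ge> ln 16" using P by (intro ln_mono) auto
        also have "ln (16::real) = 2 * ln 4" using ln_realpow[of 4 2] by simp
        finally have "ln P / 2 \<le> ln P - ln 4" by simp
        also have "\<dots> = ln (P / 4)" using P by (intro ln_divide_pos[symmetric]) auto
        also have "P / 4 = 2 * real N / Q" by (simp add: P_def)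
        finally have lnP2: "ln P / 2 \<le> ln (2 * real N / Q)" .
        have "ln (real N) / ln (2 * real N / Q) \<le> (4 * ln R) / (ln P / 2)"
          using lnR2 lnN lnP lnP2 by (intro frac_le) auto
        also have "\<dots> = 8 * (ln R / ln P)" by simp
        finally have "\<Lambda> \<le> ln (8 * (ln R / ln P))"
          unfolding \<Lambda>_def using lnN ln2 by (intro ln_mono divide_pos_pos) auto
        also have "\<dots> = ln 8 + X"
          unfolding X_def using lnR2 lnN lnP by (intro ln_mult_pos divide_pos_pos) auto
        also have "ln 8 \<le> ln 8 / \<rho> * X"
        proof -
          have "ln 8 / \<rho> * \<rho> \<le> ln 8 / \<rho> * X" using X\<rho> \<rho> by (intro mult_left_mono) auto
          then show ?thesis using \<rho> by simp
        qed
        finally show ?thesis by (simp add: algebra_simps)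
      qed
      \<comment> \<open>If \<open>Q l^2 \<ge> N\<close>, then \<open>P \<le> 8 l^2\<close> and so
        \<open>X \<ge> l / 2\<close>: one factor \<open>l\<close> is paid by
        \<open>Q l \<le> (C2 / c\<mu>) N\<close>, the other by \<open>2 X\<close>. Otherwise
        \<open>Q l^2 < N\<close>, and \<open>X \<ge> \<rho>\<close> suffices.\<close>
      have QlX: "Q * l\<^sup>2 \<le> (2 * C2 / c\<mu> + 1 / \<rho>) * (real N * X)"
      proof (cases "real N \<le> Q * l\<^sup>2")
        case True
        have "P \<le> 8 * l\<^sup>2" using True Q0 by (simp add: P_def pos_divide_le_eq mult.commute)
        then have "ln P \<le> ln (8 * l\<^sup>2)" using P by (intro ln_mono) auto
        then have "3 / 8 * ln (real N) / ln (8 * l\<^sup>2) \<le> ln R / ln P"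
          using lnR2 lnN lnP by (intro frac_le) auto
        moreover have "0 < 3 / 8 * ln (real N) / ln (8 * l\<^sup>2)"
          using lnN lnP \<open>ln P \<le> ln (8 * l\<^sup>2)\<close> by (intro divide_pos_pos) auto
        ultimately have "ln (3 / 8 * ln (real N) / ln (8 * l\<^sup>2)) \<le> X" unfolding X_def by (intro ln_mono) auto
        then have lX: "l \<le> 2 * X" using big by simp
        have "Q * l\<^sup>2 = (Q * (c\<mu> * l)) * (l / c\<mu>)" using c\<mu> by (simp add: power2_eq_square)
        also have "\<dots> \<le> (C2 * real N) * (2 * X / c\<mu>)"
          by (rule mult_mono[OF Ql]) (use lX l1 c\<mu> C2 in \<open>auto intro: divide_right_mono\<close>)
        also have "\<dots> = 2 * C2 / c\<mu> * (real N * X)" by simp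
        also have "\<dots> \<le> (2 * C2 / c\<mu> + 1 / \<rho>) * (real N * X)"
          using \<rho> X\<rho> by (intro mult_right_mono) auto
        finally show ?thesis .
      next
        case False
        then have "Q * l\<^sup>2 \<le> real N * 1" by simp
        also have "\<dots> \<le> real N * (1 / \<rho> * X)" using X\<rho> \<rho> by (intro mult_left_mono) (auto simp: pos_le_divide_eq)
        also have "\<dots> = 1 / \<rho> * (real N * X)" by simp
        also have "\<dots> \<le> (2 * C2 / c\<mu> + 1 / \<rho>) * (real N * X)"
          using \<rho> X\<rho> C2 c\<mu> by (intro mult_right_mono) auto
        finally show ?thesis .
      qed
      have "Q\<^sup>2 * l\<^sup>2 = Q * (Q * l\<^sup>2)" by (simp add: power2_eq_square)
      also have "\<dots> \<le> Q * ((2 * C2 / c\<mu> + 1 / \<rho>) * (real N * X))" using QlX Q0 by (intro mult_left_mono) auto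
      finally have e1: "Q\<^sup>2 * l\<^sup>2 \<le> Q * ((2 * C2 / c\<mu> + 1 / \<rho>) * (real N * X))" .
      have e2: "Q * real N * \<Lambda> \<le> Q * real N * ((1 + ln 8 / \<rho>) * X)"
        using \<Lambda>X Q0 by (intro mult_left_mono) auto
      have "Q * ((2 * C2 / c\<mu> + 1 / \<rho>) * (real N * X)) + Q * real N * ((1 + ln 8 / \<rho>) * X) = KII * (Q * real N * X)"
        unfolding KII_def by (simp add: algebra_simps)
      then have "Q\<^sup>2 * l\<^sup>2 + Q * real N * \<Lambda> \<le> KII * (Q * real N * X)" using e1 e2 by linarith
      then have "\<kappa> * (Q\<^sup>2 * l\<^sup>2 + Q * real N * \<Lambda>) \<le> \<kappa> * (KII * (Q * real N * X))"
        using \<kappa>(1) by (intro mult_left_mono) auto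
      also have "\<dots> = (\<kappa> * KII) * (Q * real N * X)" by simp
      also have "\<dots> \<le> \<kappa>2 * c4 * (Q * real N * X)"
        using \<kappa>(3) Q0 X\<rho> \<rho> by (intro mult_right_mono) auto
      also note VX
      finally show "\<kappa> * (Q\<^sup>2 * l\<^sup>2 + Q * real N * \<Lambda>) \<le> V N Q (\<lambda>n. of_nat (w n))" .
    qed
  qed
qed

end
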